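(* Let $\Gamma\subset\mathrm{SL}(n,\mathbb{R})$ be a projective Anosov subgroup, with limit set $\Lambda_\Gamma=\xi(\partial_\infty\Gamma)\subset\mathbf{P}(\mathbb{R}^n)$. Then $\dim_H(\Lambda_\Gamma)\le\delta_{1,2}(\Gamma)$.
   Context: For $g\in\mathrm{SL}(n,\mathbb{R})$, $\mu_i(g)$ is the logarithm of the $i$-th eigenvalue (decreasing order) of $\sqrt{gg^T}$. A finitely generated $\Gamma\subset\mathrm{SL}(n,\mathbb{R})$ is projective Anosov if there are $C,C'>0$ with $\mu_1(g)-\mu_2(g)\ge C|g|-C'$ for all $g\in\Gamma$ ($|g|$ word length). Such $\Gamma$ is Gromov hyperbolic and has a continuous $\Gamma$-equivariant boundary map $\xi:\partial_\infty\Gamma\to\mathbf{P}(\mathbb{R}^n)$ such that, for every infinite-order $g\in\Gamma$, $\xi(g_+)$ is the eigenline of the unique eigenvalue of $g$ of maximal modulus ($g_+$ the attracting fixed point of $g$ in $\partial_\infty\Gamma$). $\delta_{1,2}(\Gamma)=\limsup_{R\to\infty}\frac1R\log\#\{\gamma\in\Gamma:\mu_1(\gamma)-\mu_2(\gamma)\le R\}$. $\dim_H$ is the Hausdorff dimension for any Riemannian metric on $\mathbf{P}(\mathbb{R}^n)$. *)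

theory Defs
  imports "HOL-Analysis.Analysis" "HOL-Computational_Algebra.Polynomial"
begin

type_synonym 'n mat = "real ^ 'n ^ 'n"

section \<open>Linear algebra\<close>

definition SL :: "'n::finite mat set" where
  "SL = {g. det g = 1}"

fun mpow :: "'n::finite mat \<Rightarrow> nat \<Rightarrow> 'n mat" where
  "mpow g 0 = mat 1"
| "mpow g (Suc k) = g ** mpow g k"

text \<open>Characteristic polynomial det(X I - A), as a real polynomial.\<close>
definition charpoly :: "'n::finite mat \<Rightarrow> real poly" where
  "charpoly A = det (\<chi> i j. (if i = j then [:0, 1:] else 0) - [: A $ i $ j :])"

text \<open>Eigenvalues of the symmetric matrix g g^T, with multiplicity, in decreasing order.
  The singular values of g (eigenvalues of sqrt(g g^T)) are their square roots.\<close>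
definition sq_sing_vals :: "'n::finite mat \<Rightarrow> real list" where
  "sq_sing_vals g = rev (sorted_list_of_multiset (proots (charpoly (g ** transpose g))))"

text \<open>mu i g = log of the i-th singular value (i = 1..n), i.e. log of the i-th eigenvalue of sqrt(g g^T).\<close>
definition mu :: "nat \<Rightarrow> 'n::finite mat \<Rightarrow> real" where
  "mu i g = ln (sqrt (sq_sing_vals g ! (i - 1)))"

definition complex_eigenvalues :: "'n::finite mat \<Rightarrow> complex set" where
  "complex_eigenvalues g = {z. poly (map_poly complex_of_real (charpoly g)) z = 0}"

section \<open>Finitely generated groups and word length\<close>

definition word_prod :: "'n::finite mat list \<Rightarrow> 'n mat" where
  "word_prod ws = foldr (**) ws (mat 1)"

definition gen_words :: "'n::finite mat set \<Rightarrow> 'n mat list set" where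
  "gen_words S = {ws. set ws \<subseteq> S \<union> matrix_inv ` S}"

text \<open>The subgroup generated by a set S of invertible matrices.\<close>
definition generated :: "'n::finite mat set \<Rightarrow> 'n mat set" where
  "generated S = word_prod ` gen_words S"

text \<open>Word length with respect to the generating set S.\<close>
definition word_length :: "'n::finite mat set \<Rightarrow> 'n mat \<Rightarrow> nat" where
  "word_length S g = (LEAST k. \<exists>ws \<in> gen_words S. length ws = k \<and> word_prod ws = g)"

definition projective_Anosov :: "'n::finite mat set \<Rightarrow> 'n mat set \<Rightarrow> bool" where
  "projective_Anosov S \<Gamma> \<longleftrightarrow>
     finite S \<and> S \<subseteq> SL \<and> \<Gamma> = generated S \<and>
     (\<exists>C C'. C > 0 \<and> C' > 0 \<and>
        (\<forall>g\<in>\<Gamma>. mu 1 g - mu 2 g \<ge> C * real (word_length S g) - C'))"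

section \<open>Gromov boundary of (\<Gamma>, word metric)\<close>

text \<open>Word metric d(g,h) = |g^-1 h| and Gromov product based at the identity.\<close>
definition gromov_prod :: "'n::finite mat set \<Rightarrow> 'n mat \<Rightarrow> 'n mat \<Rightarrow> real" where
  "gromov_prod S g h = (real (word_length S g) + real (word_length S h)
       - real (word_length S (matrix_inv g ** h))) / 2"

text \<open>Sequences in \<Gamma> converging at infinity: liminf_{i,j} (x_i|x_j) = \<infinity>.\<close>
definition conv_infty :: "'n::finite mat set \<Rightarrow> 'n mat set \<Rightarrow> (nat \<Rightarrow> 'n mat) \<Rightarrow> bool" where
  "conv_infty S \<Gamma> x \<longleftrightarrow> (\<forall>k. x k \<in> \<Gamma>) \<and>
     (\<forall>M. \<exists>N. \<forall>i\<ge>N. \<forall>j\<ge>N. gromov_prod S (x i) (x j) \<ge> M)"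

definition seq_equiv :: "'n::finite mat set \<Rightarrow> (nat \<Rightarrow> 'n mat) \<Rightarrow> (nat \<Rightarrow> 'n mat) \<Rightarrow> bool" where
  "seq_equiv S x y \<longleftrightarrow> (\<forall>M. \<exists>N. \<forall>i\<ge>N. \<forall>j\<ge>N. gromov_prod S (x i) (y j) \<ge> M)"

text \<open>Boundary points are equivalence classes of sequences converging at infinity.\<close>
definition bdry_class :: "'n::finite mat set \<Rightarrow> 'n mat set \<Rightarrow> (nat \<Rightarrow> 'n mat) \<Rightarrow> (nat \<Rightarrow> 'n mat) set" where
  "bdry_class S \<Gamma> x = {y. conv_infty S \<Gamma> y \<and> seq_equiv S x y}"

definition gromov_bdry :: "'n::finite mat set \<Rightarrow> 'n mat set \<Rightarrow> (nat \<Rightarrow> 'n mat) set set" where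
  "gromov_bdry S \<Gamma> = bdry_class S \<Gamma> ` {x. conv_infty S \<Gamma> x}"

text \<open>Convergence a_k \<rightarrow> a in the boundary: the Gromov product (a_k|a) tends to \<infinity>.\<close>
definition bdry_tendsto :: "'n::finite mat set \<Rightarrow> (nat \<Rightarrow> (nat \<Rightarrow> 'n mat) set) \<Rightarrow> (nat \<Rightarrow> 'n mat) set \<Rightarrow> bool" where
  "bdry_tendsto S a b \<longleftrightarrow> (\<forall>M. \<exists>K. \<forall>k\<ge>K. \<exists>x\<in>a k. \<exists>y\<in>b.
      \<exists>N. \<forall>i\<ge>N. \<forall>j\<ge>N. gromov_prod S (x i) (y j) \<ge> M)"

text \<open>Left action of \<Gamma> on its boundary.\<close>
definition bdry_act :: "'n::finite mat \<Rightarrow> (nat \<Rightarrow> 'n mat) set \<Rightarrow> (nat \<Rightarrow> 'n mat) set" where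
  "bdry_act g a = (\<lambda>x. \<lambda>i. g ** x i) ` a"

text \<open>Attracting fixed point g_+ of an infinite-order element: the class of (g^k)_k.\<close>
definition attr_pt :: "'n::finite mat set \<Rightarrow> 'n mat set \<Rightarrow> 'n mat \<Rightarrow> (nat \<Rightarrow> 'n mat) set" where
  "attr_pt S \<Gamma> g = bdry_class S \<Gamma> (\<lambda>k. mpow g k)"

section \<open>Projective space\<close>

definition proj_space :: "(real ^ 'n::finite) set set" where
  "proj_space = {span {v} | v. v \<noteq> 0}"

text \<open>Standard round (Riemannian) metric on P(R^n): angle between lines.\<close>
definition line_dist :: "(real ^ 'n::finite) set \<Rightarrow> (real ^ 'n) set \<Rightarrow> real" where
  "line_dist l m = (SOME d. \<exists>u v. u \<in> l \<and> v \<in> m \<and> norm u = 1 \<and> norm v = 1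
                              \<and> d = arccos \<bar>u \<bullet> v\<bar>)"

definition mat_act_line :: "'n::finite mat \<Rightarrow> (real ^ 'n) set \<Rightarrow> (real ^ 'n) set" where
  "mat_act_line g l = (\<lambda>v. g *v v) ` l"

section \<open>Hausdorff dimension of a subset of a metric space (X, d)\<close>

definition diam_d :: "('p \<Rightarrow> 'p \<Rightarrow> real) \<Rightarrow> 'p set \<Rightarrow> real" where
  "diam_d d U = (if U = {} then 0 else Sup {d x y | x y. x \<in> U \<and> y \<in> U})"

text \<open>delta-approximate s-dimensional Hausdorff measure (X bounded here).\<close>
definition hausdorff_approx :: "'p set \<Rightarrow> ('p \<Rightarrow> 'p \<Rightarrow> real) \<Rightarrow> real \<Rightarrow> real \<Rightarrow> 'p set \<Rightarrow> ennreal" where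
  "hausdorff_approx X d s \<delta> E = (INF U \<in> {U :: nat \<Rightarrow> 'p set. E \<subseteq> (\<Union>i. U i) \<and>
        (\<forall>i. U i \<subseteq> X \<and> diam_d d (U i) \<le> \<delta>)}. (\<Sum>i. ennreal (diam_d d (U i) powr s)))"

definition hausdorff_measure :: "'p set \<Rightarrow> ('p \<Rightarrow> 'p \<Rightarrow> real) \<Rightarrow> real \<Rightarrow> 'p set \<Rightarrow> ennreal" where
  "hausdorff_measure X d s E = (SUP \<delta> \<in> {0<..}. hausdorff_approx X d s \<delta> E)"

definition hausdorff_dim :: "'p set \<Rightarrow> ('p \<Rightarrow> 'p \<Rightarrow> real) \<Rightarrow> 'p set \<Rightarrow> ereal" where
  "hausdorff_dim X d E = (INF s \<in> {s. s > 0 \<and> hausdorff_measure X d s E = 0}. ereal s)"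

section \<open>Critical exponent delta_{1,2}\<close>

definition delta12 :: "'n::finite mat set \<Rightarrow> ereal" where
  "delta12 \<Gamma> = Limsup at_top (\<lambda>R::real.
      ereal (ln (real (card {\<gamma> \<in> \<Gamma>. mu 1 \<gamma> - mu 2 \<gamma> \<le> R})) / R))"

end

theory Submission
  imports Defs
begin

text \<open>
  For \<open>g\<close> with a large gap \<open>mu 1 g - mu 2 g\<close> let \<open>U g\<close> and \<open>W g\<close> be its top left and right singular
  vectors. Multiplying \<open>g\<close> on the right by a generator moves the line \<open>U g\<close> by
  \<open>O(exp (- (mu 1 g - mu 2 g)))\<close>, so along a geodesic ray \<open>q\<close> in \<open>\<Gamma>\<close> the lines \<open>U (q j)\<close> converge.
  If \<open>\<gamma>\<close> is the point of the ray beyond \<open>k0\<close> with the smallest gap, then for every \<open>e > 0\<close> the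
  tail of the steps from \<open>\<gamma>\<close> on is \<open>O(exp (- (1 - e) (mu 1 \<gamma> - mu 2 \<gamma>)))\<close>. Hence balls of these
  radii around the \<open>U \<gamma>\<close>, \<open>|\<gamma>| \<ge> k0\<close>, cover all limits, and the sum of the \<open>s\<close>-th powers of the
  radii is a tail of a convergent series as soon as \<open>(1 - e) s\<close> exceeds the critical exponent.

  It remains to see that \<open>\<xi>\<close> takes the value \<open>lim U (x i)\<close> at the class of \<open>x\<close>. The norm is
  supermultiplicative up to a constant along quasigeodesics, so a bounded Gromov product forces
  transversality of singular lines; this yields a weak form of hyperbolicity and an element \<open>g\<close>
  whose powers are undistorted. The eigenvalue hypothesis gives the claim at the two fixed points
  of \<open>g\<close>, and by equivariance and continuity of \<open>\<xi>\<close> it spreads to all boundary points, since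
  \<open>x i\<close> moves one of these fixed points close to the class of \<open>x\<close>.
\<close>

text \<open>The map \<open>\<xi>\<close> enters only through its range, continuity, equivariance and
  values at attracting points, and the geometry of the group only through the gap inequality, so
  everything has to be read off the lines \<open>U g\<close>. The one hard estimate is the
  supermultiplicativity of the norm: a lower bound for the norm of a product must exclude
  cancellation along the whole word, with a constant independent of its length. Singular vectors are
  determined at best up to sign. Lines are therefore compared through the projections
  \<open>outer u\<close>, which live in a Euclidean space, where completeness, compactness and
  pairings are at hand. In the covering argument the gap need not be monotone along a ray, so the
  tail of steps cannot be compared with the gap at a prescribed time. At the time of smallest gap
  every later ratio of singular values is at most the chosen one; its power 1 - e is bounded in this
  way, and its power e decays geometrically by the Anosov inequality.\<close>

declare transpose_matrix_vector [simp del]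

section \<open>Spectral theorem and singular values\<close>

text \<open>First variation at a maximum: for small \<open>t\<close> of the sign of \<open>a\<close>
  the linear term would win. With \<open>t = a / d\<close>, \<open>d\<close> positive and at least
  \<open>c\<close>, the left side is twice an upper bound of the right side.\<close>

lemma linear_le_quadratic_imp_zero:
  fixes a c :: real
  assumes "\<And>t. 2 * t * a \<le> t\<^sup>2 * c"
  shows "a = 0"
proof (rule ccontr)
  assume a: "a \<noteq> 0"
  define d where "d = \<bar>c\<bar> + 1"
  have d: "d > 0" "c \<le> d" by (auto simp: d_def)
  have "2 * (a / d) * a \<le> (a / d)\<^sup>2 * c" by (rule assms)
  also have "\<dots> \<le> (a / d)\<^sup>2 * d" using d by (intro mult_left_mono) auto
  also have "\<dots> = a\<^sup>2 / d" using d by (simp add: power2_eq_square)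
  finally have "2 * a\<^sup>2 / d \<le> a\<^sup>2 / d" by (simp add: power2_eq_square)
  hence "a\<^sup>2 / d \<le> 0" by (simp add: field_simps)
  moreover have "a\<^sup>2 / d > 0" using a d by simp
  ultimately show False by linarith
qed

lemma dot_transpose: "(A *v x) \<bullet> y = x \<bullet> (transpose A *v y)" for A :: "real^'n^'m"
  by (metis dot_lmul_matrix inner_commute transpose_matrix_vector transpose_transpose)

text \<open>A maximiser \<open>x\<close> of the Rayleigh quotient on the unit sphere of
  \<open>V\<close> is an eigenvector: the residual \<open>y\<close> of the eigenvalue equation stays
  in \<open>V\<close>, and varying \<open>x\<close> in the direction \<open>y\<close> gives
  \<open>y \<bullet> y = 0\<close>.\<close>

lemma symmetric_eigenvector_in_subspace:
  fixes A :: "real^'n^'n"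
  assumes sym: "transpose A = A" and V: "subspace V" "V \<noteq> {0}"
    and inv: "\<And>x. x \<in> V \<Longrightarrow> A *v x \<in> V"
  shows "\<exists>x L. x \<in> V \<and> norm x = 1 \<and> A *v x = L *\<^sub>R x"
proof -
  let ?K = "V \<inter> sphere 0 1"
  obtain z where z: "z \<in> V" "z \<noteq> 0" using V subspace_0 by blast
  have "z /\<^sub>R norm z \<in> ?K" using z V by (auto intro: subspace_scale)
  hence ne: "?K \<noteq> {}" by blast
  have "compact ?K" using V by (intro closed_Int_compact closed_subspace) auto
  moreover have "continuous_on ?K (\<lambda>x. x \<bullet> (A *v x))"
    by (intro continuous_intros linear_continuous_on) (simp add: linear_conv_bounded_linear[symmetric])
  ultimately have "\<exists>x\<in>?K. \<forall>y\<in>?K. y \<bullet> (A *v y) \<le> x \<bullet> (A *v x)"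
    by (intro continuous_attains_sup ne)
  then obtain x where x: "x \<in> ?K" and mx: "\<And>y. y \<in> ?K \<Longrightarrow> y \<bullet> (A *v y) \<le> x \<bullet> (A *v x)"
    by blast
  define l where "l = x \<bullet> (A *v x)"
  have x1: "norm x = 1" "x \<in> V" using x by auto
  have le: "y \<bullet> (A *v y) \<le> l * (y \<bullet> y)" if "y \<in> V" for y
  proof (cases "y = 0")
    case False
    have "y /\<^sub>R norm y \<in> ?K" using that V False by (auto intro: subspace_scale)
    from mx[OF this] have "(y \<bullet> (A *v y)) / (norm y)\<^sup>2 \<le> l"
      unfolding l_def by (simp add: matrix_vector_mult_scaleR power2_eq_square field_simps)
    thus ?thesis using False by (simp add: power2_norm_eq_inner field_simps)
  qed simp
  define y where "y = A *v x - l *\<^sub>R x"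
  have y: "y \<in> V" unfolding y_def using inv x1 V by (intro subspace_diff subspace_scale) auto
  have "y \<bullet> y = 0"
  proof (rule linear_le_quadratic_imp_zero)
    fix t
    have "x + t *\<^sub>R y \<in> V" using x1 y V by (intro subspace_add subspace_scale)
    from le[OF this] have le': "(x + t *\<^sub>R y) \<bullet> (A *v (x + t *\<^sub>R y)) \<le> l * ((x + t *\<^sub>R y) \<bullet> (x + t *\<^sub>R y))" .
    have 1: "x \<bullet> (A *v y) = y \<bullet> (A *v x)"
      using dot_transpose[of A x y] by (simp add: sym inner_commute)
    have 2: "x \<bullet> x = 1" using x1 by (simp add: norm_eq_1)
    have 3: "y \<bullet> y = y \<bullet> (A *v x) - l * (x \<bullet> y)"
      by (subst (2) y_def) (simp add: inner_diff_right inner_commute)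
    have "(x + t *\<^sub>R y) \<bullet> (A *v (x + t *\<^sub>R y)) = l + 2 * t * (y \<bullet> (A *v x)) + t\<^sup>2 * (y \<bullet> (A *v y))"
      by (simp add: matrix_vector_right_distrib matrix_vector_mult_scaleR inner_add_left inner_add_right
        1 l_def power2_eq_square distrib_left)
    moreover have "(x + t *\<^sub>R y) \<bullet> (x + t *\<^sub>R y) = 1 + 2 * t * (x \<bullet> y) + t\<^sup>2 * (y \<bullet> y)"
      by (simp add: inner_add_left inner_add_right 2 power2_eq_square inner_commute[of y x] distrib_left)
    ultimately have "2 * t * (y \<bullet> (A *v x)) + t\<^sup>2 * (y \<bullet> (A *v y)) \<le> l * (2 * t * (x \<bullet> y)) + l * (t\<^sup>2 * (y \<bullet> y))"
      using le' by (simp add: distrib_left)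
    thus "2 * t * (y \<bullet> y) \<le> t\<^sup>2 * (l * (y \<bullet> y) - y \<bullet> (A *v y))"
      unfolding right_diff_distrib by (subst 3) (simp add: algebra_simps)
  qed
  hence "A *v x = l *\<^sub>R x" by (simp add: y_def)
  thus ?thesis using x1 by blast
qed

text \<open>A largest orthonormal set \<open>B\<close> of eigenvectors spans: its orthogonal
  complement is invariant by symmetry, so if it were non-zero it would contain one more eigenvector.
  The basis is indexed by \<open>'n\<close> so that it can form the columns of a square
  matrix.\<close>

lemma symmetric_orthonormal_eigenbasis:
  fixes A :: "real^'n^'n"
  assumes sym: "transpose A = A"
  shows "\<exists>(q :: 'n \<Rightarrow> real^'n) L. (\<forall>i j. q i \<bullet> q j = (if i = j then 1 else 0)) \<and>
            (\<forall>i. A *v q i = L i *\<^sub>R q i)"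
proof -
  define P where "P B \<longleftrightarrow> pairwise orthogonal B \<and> (\<forall>b\<in>B. norm b = 1 \<and> (\<exists>L. A *v b = L *\<^sub>R b))"
    for B :: "(real^'n) set"
  have indep: "independent B" if "P B" for B
    using that unfolding P_def by (intro pairwise_orthogonal_independent) auto
  have bound: "finite B \<and> card B \<le> CARD('n)" if "P B" for B
    using independent_bound[OF indep[OF that]] by simp
  have "P {}" by (simp add: P_def)
  then obtain B where B: "P B" and mx: "\<And>C. P C \<Longrightarrow> card C \<le> card B"
    using ex_has_greatest_nat[of P "{}" card "Suc CARD('n)"] bound by (metis less_Suc_eq_le)
  define V where "V = {x. \<forall>b\<in>B. b \<bullet> x = 0}"
  have V: "subspace V" by (auto simp: V_def subspace_def inner_add_right)
  have inv: "A *v x \<in> V" if "x \<in> V" for x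
  proof -
    have "b \<bullet> (A *v x) = 0" if bB: "b \<in> B" for b
    proof -
      obtain l where "A *v b = l *\<^sub>R b" using B bB unfolding P_def by auto
      moreover have "b \<bullet> (A *v x) = (A *v b) \<bullet> x" by (simp add: dot_transpose sym)
      ultimately show ?thesis using \<open>x \<in> V\<close> bB by (simp add: V_def)
    qed
    thus ?thesis by (simp add: V_def)
  qed
  have "V = {0}"
  proof (rule ccontr)
    assume "V \<noteq> {0}"
    then obtain x l where x: "x \<in> V" "norm x = 1" "A *v x = l *\<^sub>R x"
      using symmetric_eigenvector_in_subspace[OF sym V _ inv] by blast
    have "x \<notin> B" using x by (auto simp: V_def)
    moreover have "P (insert x B)"
      using B x by (auto simp: P_def pairwise_insert orthogonal_def V_def inner_commute)
    ultimately show False using mx[of "insert x B"] bound[OF B] by auto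
  qed
  have "span B = UNIV"
  proof (rule ccontr)
    assume "span B \<noteq> UNIV"
    then obtain a where "a \<noteq> 0" "\<forall>x\<in>span B. a \<bullet> x = 0" using span_not_univ_subset_hyperplane[of B]
      by (auto simp: subset_eq)
    hence "a \<in> V" by (auto simp: V_def inner_commute span_base)
    thus False using \<open>V = {0}\<close> \<open>a \<noteq> 0\<close> by auto
  qed
  hence "card B = CARD('n)" using indep[OF B] bound[OF B]
    dim_span_eq_card_independent[of B] by simp
  then obtain q :: "'n \<Rightarrow> real^'n" where q: "bij_betw q UNIV B"
    using bound[OF B] finite_same_card_bij[of "UNIV :: 'n set" B] by auto
  have qB: "q i \<in> B" for i using q by (auto simp: bij_betw_def)
  have "q i \<bullet> q j = (if i = j then 1 else 0)" for i j
  proof (cases "i = j")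
    case True thus ?thesis using B qB[of j] by (simp add: P_def norm_eq_1)
  next
    case False
    hence "q i \<noteq> q j" using q by (auto simp: bij_betw_def inj_on_def)
    thus ?thesis using B qB False by (auto simp: P_def pairwise_def orthogonal_def)
  qed
  moreover have "\<forall>i. \<exists>l. A *v q i = l *\<^sub>R q i" using B qB by (auto simp: P_def)
  ultimately show ?thesis by metis
qed

text \<open>With the eigenvectors as constant columns of \<open>Q\<close>, the matrix
  \<open>M\<close> of X I - A satisfies M Q = Q D over the polynomial ring. Cancelling
  \<open>det Q\<close> against the determinant of its transpose \<open>R\<close> keeps the
  computation inside that ring.\<close>

lemma charpoly_diagonalized:
  fixes A :: "real^'n^'n" and q :: "'n \<Rightarrow> real^'n"
  assumes q: "\<And>i j. q i \<bullet> q j = (if i = j then 1 else 0)" and ev: "\<And>i. A *v q i = L i *\<^sub>R q i"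
  shows "charpoly A = (\<Prod>i\<in>UNIV. [: - L i, 1:])"
proof -
  define Q where "Q = (\<chi> i j. [: q j $ i :])"
  define R where "R = (\<chi> i j. [: q i $ j :])"
  define M where "M = (\<chi> i j. (if i = j then [:0, 1:] else 0) - [: A $ i $ j :])"
  define D where "D = (\<chi> i j. if i = j then [: - L i, 1:] else (0 :: real poly))"
  have RQ: "R ** Q = mat 1"
    using q by (simp add: R_def Q_def matrix_matrix_mult_def mat_def vec_eq_iff inner_vec_def
      sum_to_poly mult.commute pCons_one if_distrib)
  have MQ: "M ** Q = Q ** D"
  proof -
    have "(\<Sum>k\<in>UNIV. ((if i = k then [:0, 1:] else 0) - [:A $ i $ k:]) * [: q j $ k :])
       = (\<Sum>k\<in>UNIV. [: q k $ i :] * (if k = j then [: - L k, 1:] else 0))" for i j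
    proof -
      have "(\<Sum>k\<in>UNIV. A $ i $ k * q j $ k) = L j * q j $ i"
        using ev[of j] by (simp add: vec_eq_iff matrix_vector_mult_def)
      moreover have "(\<Sum>k\<in>UNIV. ((if i = k then [:0, 1:] else 0) - [:A $ i $ k:]) * [: q j $ k :])
        = (\<Sum>k\<in>UNIV. (if i = k then [:0, 1:] * [: q j $ k :] else 0)) - [: \<Sum>k\<in>UNIV. A $ i $ k * q j $ k :]"
        by (subst sum_to_poly[symmetric], subst sum_subtractf[symmetric], intro sum.cong refl) auto
      moreover have "(\<Sum>k\<in>UNIV. [: q k $ i :] * (if k = j then [: - L k, 1:] else 0)) = [: q j $ i :] * [: - L j, 1:]"
        by (simp add: if_distrib cong: if_cong)
      ultimately show ?thesis by simp
    qed
    thus ?thesis by (simp add: M_def Q_def D_def matrix_matrix_mult_def vec_eq_iff)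
  qed
  have 1: "det R * det Q = 1" using arg_cong[OF RQ, of det] by (simp add: det_mul)
  have 2: "det M * det Q = det Q * det D" using arg_cong[OF MQ, of det] by (simp add: det_mul)
  have "det M = det M * det Q * det R" using 1 by (simp add: ac_simps)
  also have "\<dots> = det D * (det R * det Q)" unfolding 2 by (simp only: ac_simps)
  also have "\<dots> = det D" unfolding 1 by simp
  also have "det D = (\<Prod>i\<in>UNIV. [: - L i, 1:])" by (subst det_diagonal) (auto simp: D_def)
  finally show ?thesis by (simp add: charpoly_def M_def)
qed


section \<open>Roots of the characteristic polynomial in decreasing order\<close>

lemma poly_charpoly: "poly (charpoly A) c = det (\<chi> i j. (if i = j then c else 0) - A $ i $ j)"
proof -
  have *: "poly ((if i = j then [:0, 1:] else 0) - [:x:]) c = (if i = j then c else 0) - x" for i j :: 'a and x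
    by simp
  show ?thesis unfolding charpoly_def det_def by (simp add: poly_sum poly_prod * del: poly_diff)
qed

lemma proots_prod_linear:
  fixes L :: "'n::finite \<Rightarrow> real"
  shows "proots (\<Prod>i\<in>UNIV. [: - L i, 1:]) = image_mset L (mset_set UNIV)"
proof -
  have "(\<Sum>i\<in>I. {# L i #}) = image_mset L (mset_set I)" if "finite I" for I :: "'n set"
    using that by induction auto
  thus ?thesis by (subst proots_prod) auto
qed

text \<open>Translates entries 0 and 1 of the sorted list behind \<open>mu\<close> into indices of
  an eigenbasis. Exactly one copy of the top entry is removed, at index \<open>i\<close>, so a
  multiple top eigenvalue is covered: then the second entry equals the first.\<close>

lemma two_largest_values:
  fixes L :: "'n::finite \<Rightarrow> real"
  assumes n2: "CARD('n) \<ge> 2"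
    and xs: "xs = rev (sorted_list_of_multiset (image_mset L (mset_set UNIV)))"
  shows "\<exists>i j. L i = xs ! 0 \<and> L j = xs ! 1 \<and> L j \<le> L i \<and> (\<forall>k. k \<noteq> i \<longrightarrow> L k \<le> xs ! 1)"
proof -
  have ms: "mset xs = image_mset L (mset_set UNIV)" unfolding xs by simp
  have "size (mset xs) = CARD('n)" unfolding ms by simp
  hence "length xs \<ge> 2" using n2 by simp
  then obtain a b ys where ab: "xs = a # b # ys"
    by (cases xs; cases "tl xs") auto
  have "sorted (rev xs)" unfolding xs by simp
  hence ord: "b \<le> a" "\<And>y. y \<in> set ys \<Longrightarrow> y \<le> b" unfolding ab by (auto simp: sorted_append)
  have "a \<in># image_mset L (mset_set UNIV)" unfolding ms[symmetric] ab by simp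
  then obtain i where i: "L i = a" by auto
  have "mset_set (UNIV :: 'n set) = add_mset i (mset_set (UNIV - {i}))"
    by (metis UNIV_I finite_class.finite_UNIV mset_set.remove)
  hence rest: "mset (b # ys) = image_mset L (mset_set (UNIV - {i}))" using ms i unfolding ab by simp
  have "b \<in># mset (b # ys)" by simp
  then obtain j where j: "L j = b" unfolding rest by auto
  have "L k \<le> b" if "k \<noteq> i" for k
  proof -
    have "L k \<in># image_mset L (mset_set (UNIV - {i}))" using that by simp
    hence "L k \<in># mset (b # ys)" unfolding rest .
    thus ?thesis using ord by auto
  qed
  thus ?thesis using i j ord ab by auto
qed

section \<open>Operator norms and matrices close to rank one\<close>

abbreviation opn :: "real^'n^'m \<Rightarrow> real" where
  "opn A \<equiv> onorm ((*v) A)"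

lemma opn: "norm (A *v x) \<le> opn A * norm x" for A :: "real^'n^'m"
  by (rule onorm) simp

lemma opn_nonneg: "0 \<le> opn A" for A :: "real^'n^'m"
  by (rule onorm_pos_le) simp

lemma opn_le: "(\<And>x. norm (A *v x) \<le> c * norm x) \<Longrightarrow> opn A \<le> c" for A :: "real^'n^'m"
  by (rule onorm_le)

lemma opn_mult: "opn (A ** B) \<le> opn A * opn B" for A :: "real^'n^'m" and B :: "real^'k^'n"
proof (rule opn_le)
  fix x
  have "norm ((A ** B) *v x) = norm (A *v (B *v x))" by (simp add: matrix_vector_mul_assoc)
  also have "\<dots> \<le> opn A * norm (B *v x)" by (rule opn)
  also have "\<dots> \<le> opn A * (opn B * norm x)" by (intro mult_left_mono opn opn_nonneg)
  finally show "norm ((A ** B) *v x) \<le> opn A * opn B * norm x" by (simp add: mult.assoc)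
qed

lemma norm_bound_transpose:
  fixes A :: "real^'n^'m"
  assumes "0 \<le> c" and "\<And>v. norm (A *v v) \<le> c * norm v"
  shows "norm (transpose A *v v) \<le> c * norm v"
proof -
  let ?w = "transpose A *v v"
  have "norm ?w * norm ?w = (A *v ?w) \<bullet> v" 
    using dot_transpose[of A ?w v] by (simp add: power2_norm_eq_inner flip: power2_eq_square)
  also have "\<dots> \<le> norm (A *v ?w) * norm v" by (rule norm_cauchy_schwarz)
  also have "\<dots> \<le> c * norm ?w * norm v" using assms by (intro mult_right_mono) auto
  finally have "norm ?w * norm ?w \<le> norm ?w * (c * norm v)" by (simp add: ac_simps)
  show ?thesis
  proof (cases "norm ?w = 0")
    case True
    thus ?thesis using assms(1) by simp
  next
    case False
    thus ?thesis using \<open>norm ?w * norm ?w \<le> norm ?w * (c * norm v)\<close>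
      by (metis less_eq_real_def mult_le_cancel_left_pos norm_ge_zero)
  qed
qed

lemma opn_transpose: "opn (transpose A) = opn A" for A :: "real^'n^'m"
proof (rule antisym)
  show "opn (transpose A) \<le> opn A" by (intro opn_le norm_bound_transpose opn opn_nonneg)
  show "opn A \<le> opn (transpose A)"
    using norm_bound_transpose[of "opn (transpose A)" "transpose A", OF opn_nonneg opn] by (intro opn_le) simp
qed

text \<open>\<open>u\<close> and \<open>w\<close> are top left and right singular vectors of \<open>X\<close>; if \<open>s\<close> is the ratio of the second
  singular value to the first, then \<open>X\<close> differs from its top rank-one part by \<open>s\<close> times its norm.\<close>

definition near_rank_one :: "'n::finite mat \<Rightarrow> real \<Rightarrow> real^'n \<Rightarrow> real^'n \<Rightarrow> bool" where
  "near_rank_one X s u w \<longleftrightarrow> norm u = 1 \<and> norm w = 1 \<and>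
     X *v w = opn X *\<^sub>R u \<and> transpose X *v u = opn X *\<^sub>R w \<and>
     (\<forall>v. norm (X *v v - (opn X * (w \<bullet> v)) *\<^sub>R u) \<le> s * opn X * norm v) \<and>
     (\<forall>v. norm (transpose X *v v - (opn X * (u \<bullet> v)) *\<^sub>R w) \<le> s * opn X * norm v)"

lemma near_rank_one_transpose: "near_rank_one X s u w \<Longrightarrow> near_rank_one (transpose X) s w u"
  by (simp add: near_rank_one_def opn_transpose)

lemma near_rank_one_mono:
  assumes "near_rank_one X s u w" "s \<le> t" shows "near_rank_one X t u w"
proof -
  have "s * opn X * norm v \<le> t * opn X * norm v" for v
    using assms by (intro mult_right_mono opn_nonneg) auto
  thus ?thesis using assms(1) unfolding near_rank_one_def by (meson order_trans)
qed

lemma SL_invertible: "g \<in> SL \<Longrightarrow> invertible g"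
  by (simp add: SL_def invertible_det_nz)

lemma matrix_inv_cancel [simp]:
  assumes "invertible g"
  shows "g ** matrix_inv g = mat 1" "matrix_inv g ** g = mat 1"
  using assms by (simp_all add: invertible_def matrix_inv_def) (metis (mono_tags, lifting) someI_ex)+

text \<open>Diagonalising \<open>g ** transpose g\<close> gives \<open>u\<close> as a top
  eigenvector and \<open>w\<close> as its normalised image under the transpose. The second claim
  comes from determinant 1: the squared singular values multiply to 1, so the two largest satisfy
  \<sigma> \<tau> \<ge> 1 and their ratio is at most \<sigma>^2. It turns a large gap into a large
  norm.\<close>

theorem near_rank_one_SL:
  fixes g :: "real^'n^'n"
  assumes n2: "CARD('n) \<ge> 2" and g: "g \<in> SL"
  shows "\<exists>u w. near_rank_one g (exp (- (mu 1 g - mu 2 g))) u w"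
    and "exp (mu 1 g - mu 2 g) \<le> (opn g)\<^sup>2"
proof -
  define A where "A = g ** transpose g"
  have "transpose A = A" by (simp add: A_def matrix_transpose_mul)
  then obtain q :: "'n \<Rightarrow> real^'n" and L where
    q: "\<And>i j. q i \<bullet> q j = (if i = j then 1 else 0)" and ev: "\<And>i. A *v q i = L i *\<^sub>R q i"
    using symmetric_orthonormal_eigenbasis by blast
  have cp: "charpoly A = (\<Prod>i\<in>UNIV. [: - L i, 1:])" using q ev by (rule charpoly_diagonalized)
  define xs where "xs = sq_sing_vals g"
  have xs: "xs = rev (sorted_list_of_multiset (image_mset L (mset_set UNIV)))"
    unfolding xs_def sq_sing_vals_def A_def[symmetric] cp proots_prod_linear ..
  obtain i j where i: "L i = xs ! 0" and j: "L j = xs ! 1" and ji: "L j \<le> L i"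
    and le: "\<And>k. k \<noteq> i \<Longrightarrow> L k \<le> L j"
    using two_largest_values[OF n2 xs] by metis
  let ?g = "transpose g"
  have inner_A: "(?g *v x) \<bullet> (?g *v y) = x \<bullet> (A *v y)" for x y
    using dot_transpose[of ?g x "?g *v y"] by (simp add: A_def matrix_vector_mul_assoc)
  have L: "L k = (norm (?g *v q k))\<^sup>2" for k
    using inner_A[of "q k" "q k"] q[of k k] by (simp add: ev power2_norm_eq_inner)
  have inv: "invertible ?g" using g by (simp add: SL_def invertible_det_nz)
  have "?g *v q k \<noteq> 0" for k
  proof
    assume "?g *v q k = 0"
    hence "matrix_inv ?g *v (?g *v q k) = 0" by simp
    hence "q k = 0" using inv by (simp add: matrix_vector_mul_assoc)
    thus False using q[of k k] by simp
  qed
  hence Lpos: "L k > 0" for k unfolding L by simp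
  define u where "u = q i"
  define \<sigma> where "\<sigma> = sqrt (L i)"
  define \<tau> where "\<tau> = sqrt (L j)"
  have \<sigma>: "\<sigma> > 0" "\<sigma>\<^sup>2 = L i" and \<tau>: "\<tau> > 0" "\<tau>\<^sup>2 = L j" "\<tau> \<le> \<sigma>"
    using Lpos[of i] Lpos[of j] ji by (auto simp: \<sigma>_def \<tau>_def)
  have mu: "mu 1 g = ln \<sigma>" "mu 2 g = ln \<tau>" by (simp_all add: mu_def xs_def[symmetric] i j \<sigma>_def \<tau>_def)
  have ratio: "exp (- (mu 1 g - mu 2 g)) = \<tau> / \<sigma>" "exp (mu 1 g - mu 2 g) = \<sigma> / \<tau>"
    unfolding mu using \<sigma> \<tau> by (simp_all add: exp_diff exp_minus)
  define w where "w = (1 / \<sigma>) *\<^sub>R (?g *v u)"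
  have u1: "norm u = 1" using q[of i i] by (simp add: u_def norm_eq_1)
  have gu: "?g *v u = \<sigma> *\<^sub>R w" using \<sigma> by (simp add: w_def)
  have "norm (?g *v u) = \<sigma>" using L[of i] by (simp add: \<sigma>_def u_def)
  hence w1: "norm w = 1" using \<sigma> by (simp add: w_def)
  have gw: "g *v w = \<sigma> *\<^sub>R u"
  proof -
    have "g *v w = (1 / \<sigma>) *\<^sub>R (A *v u)"
      by (simp add: w_def A_def matrix_vector_mult_scaleR matrix_vector_mul_assoc)
    also have "\<dots> = (1 / \<sigma>) *\<^sub>R (\<sigma>\<^sup>2 *\<^sub>R u)" by (simp add: u_def ev \<sigma>(2))
    finally show ?thesis using \<sigma> by (simp add: power2_eq_square)
  qed
  have expand: "v = (\<Sum>k\<in>UNIV. (q k \<bullet> v) *\<^sub>R q k)" for v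
  proof -
    let ?r = "v - (\<Sum>k\<in>UNIV. (q k \<bullet> v) *\<^sub>R q k)"
    have orth: "q l \<bullet> ?r = 0" for l
      by (simp add: inner_diff_right inner_sum_right q if_distrib cong: if_cong)
    have inj: "inj q" using q by (metis (mono_tags, lifting) injI zero_neq_one)
    have "pairwise orthogonal (range q)" using q by (auto simp: pairwise_def orthogonal_def)
    moreover have "0 \<notin> range q" using q by (metis imageE inner_zero_left zero_neq_one)
    ultimately have "independent (range q)" by (rule pairwise_orthogonal_independent)
    moreover have "card (range q) = CARD('n)" using inj by (rule card_image)
    ultimately have "span (range q) = UNIV" 
      by (metis DIM_cart DIM_real card_eq_dim dim_UNIV finite_class.finite_UNIV finite_imageI mult.right_neutral subset_UNIV top.extremum_uniqueI)
    hence "?r \<in> span (range q)" by simp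
    hence "orthogonal ?r ?r" 
      by (rule orthogonal_to_span) (use orth in \<open>auto simp: orthogonal_def inner_commute\<close>)
    thus ?thesis by (simp add: orthogonal_def)
  qed
  \<comment> \<open>Only eigenvalues whose eigenvector pairs non-trivially with \<open>v\<close>
    enter, so the bound serves twice: with \<open>\<sigma>\<^sup>2\<close> for every
    \<open>v\<close>, and with \<open>\<tau>\<^sup>2\<close> for \<open>v\<close> orthogonal to
    \<open>u\<close>.\<close>
  have rayleigh: "(norm (?g *v v))\<^sup>2 \<le> c * (norm v)\<^sup>2" if "\<And>k. q k \<bullet> v \<noteq> 0 \<Longrightarrow> L k \<le> c" for v c
  proof -
    have "A *v v = (\<Sum>k\<in>UNIV. (L k * (q k \<bullet> v)) *\<^sub>R q k)"
      using arg_cong[OF expand[of v], of "(*v) A"]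
      by (simp add: linear_sum[OF matrix_vector_mul_linear] matrix_vector_mult_scaleR ev mult.commute)
    hence "(norm (?g *v v))\<^sup>2 = (\<Sum>k\<in>UNIV. L k * (q k \<bullet> v)\<^sup>2)"
      unfolding power2_norm_eq_inner using inner_A[of v v] by (simp add: inner_sum_right power2_eq_square inner_commute ac_simps)
    also have "\<dots> \<le> (\<Sum>k\<in>UNIV. c * (q k \<bullet> v)\<^sup>2)"
      using that by (intro sum_mono) (metis mult_eq_0_iff mult_right_mono order_refl power_zero_numeral zero_le_power2)
    also have "\<dots> = c * (\<Sum>k\<in>UNIV. (q k \<bullet> v)\<^sup>2)" by (simp add: sum_distrib_left)
    also have "(\<Sum>k\<in>UNIV. (q k \<bullet> v)\<^sup>2) = v \<bullet> v"
      using arg_cong[OF expand[of v], of "\<lambda>x. v \<bullet> x"] by (simp add: inner_sum_right power2_eq_square inner_commute)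
    finally show ?thesis by (simp add: power2_norm_eq_inner)
  qed
  have Lle: "L k \<le> \<sigma>\<^sup>2" for k unfolding \<sigma> using le[of k] ji by (cases "k = i") auto
  have ub: "norm (?g *v v) \<le> \<sigma> * norm v" for v
  proof (rule power2_le_imp_le)
    show "(norm (?g *v v))\<^sup>2 \<le> (\<sigma> * norm v)\<^sup>2" unfolding power_mult_distrib by (intro rayleigh Lle)
  qed (use \<sigma> in simp)
  have opg: "opn ?g = \<sigma>"
  proof (rule antisym)
    show "opn ?g \<le> \<sigma>" by (intro opn_le ub)
    show "\<sigma> \<le> opn ?g" using opn[of ?g u] by (simp add: gu u1 w1 \<sigma>(1)[THEN less_imp_le])
  qed
  hence op: "opn g = \<sigma>" by (simp add: opn_transpose)
  have bt: "norm (?g *v v - (\<sigma> * (u \<bullet> v)) *\<^sub>R w) \<le> \<tau> * norm v" for v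
  proof -
    let ?v = "v - (u \<bullet> v) *\<^sub>R u"
    have eq: "?g *v v - (\<sigma> * (u \<bullet> v)) *\<^sub>R w = ?g *v ?v"
      by (simp add: matrix_vector_mult_diff_distrib matrix_vector_mult_scaleR gu mult.commute)
    have "q i \<bullet> ?v = 0" using q[of i i] by (simp add: u_def inner_diff_right)
    hence "(norm (?g *v ?v))\<^sup>2 \<le> (\<tau> * norm ?v)\<^sup>2"
      unfolding power_mult_distrib \<tau> by (intro rayleigh le) auto
    hence 1: "norm (?g *v ?v) \<le> \<tau> * norm ?v"
      by (rule power2_le_imp_le) (use \<tau> in simp)
    have "(norm ?v)\<^sup>2 = (norm v)\<^sup>2 - (u \<bullet> v)\<^sup>2"
      using u1 unfolding power2_norm_eq_inner
      by (simp add: inner_diff_left inner_diff_right norm_eq_1 inner_commute power2_eq_square)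
    hence "(norm ?v)\<^sup>2 \<le> (norm v)\<^sup>2" by simp
    hence "norm ?v \<le> norm v" by simp
    thus ?thesis unfolding eq using 1 \<tau> by (meson less_imp_le mult_left_mono order_trans)
  qed
  \<comment> \<open>\<open>E\<close> is the transpose of \<open>g\<close> minus its top rank-one
    part. Its estimate passes to its own transpose, which is the corresponding remainder of
    \<open>g\<close>.\<close>
  define E where "E = (\<chi> a b. ?g $ a $ b - \<sigma> * w $ a * u $ b)"
  have Ev: "E *v v = ?g *v v - (\<sigma> * (u \<bullet> v)) *\<^sub>R w" for v
    by (simp add: E_def vec_eq_iff matrix_vector_mult_def inner_vec_def left_diff_distrib right_diff_distrib sum_subtractf
      sum_distrib_left sum_distrib_right ac_simps)
  have tEv: "transpose E *v v = g *v v - (\<sigma> * (w \<bullet> v)) *\<^sub>R u" for v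
    by (simp add: E_def transpose_def vec_eq_iff matrix_vector_mult_def inner_vec_def left_diff_distrib right_diff_distrib sum_subtractf
      sum_distrib_left sum_distrib_right ac_simps)
  have b: "norm (g *v v - (\<sigma> * (w \<bullet> v)) *\<^sub>R u) \<le> \<tau> * norm v" for v
    using norm_bound_transpose[of \<tau> E v] bt \<tau> by (simp add: Ev tEv)
  have "near_rank_one g (\<tau> / \<sigma>) u w"
    using u1 w1 gw gu b bt \<sigma> by (simp add: near_rank_one_def op)
  thus "\<exists>u w. near_rank_one g (exp (- (mu 1 g - mu 2 g))) u w" unfolding ratio by blast
  have "(\<Prod>k\<in>UNIV. L k) = det A"
  proof -
    have "poly (charpoly A) 0 = (\<Prod>k\<in>UNIV. - L k)" unfolding cp by (simp add: poly_prod)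
    moreover have "poly (charpoly A) 0 = det (- A)"
      unfolding poly_charpoly by (rule arg_cong[of _ _ det]) (simp add: vec_eq_iff)
    moreover have "det (- A) = (\<Prod>k\<in>(UNIV :: 'n set). -1) * det A"
      by (simp add: det_def sum_distrib_left prod_uminus ac_simps)
    ultimately show ?thesis by (simp add: prod_uminus)
  qed
  also have "\<dots> = 1" using g by (simp add: A_def det_mul SL_def)
  finally have "(\<Prod>k\<in>UNIV. L k) = 1" .
  hence "1 = L i * (\<Prod>k\<in>UNIV - {i}. L k)" by (simp add: prod.remove[of UNIV i])
  also have "\<dots> \<le> L i * (\<Prod>k\<in>UNIV - {i}. L j)"
    using Lpos le by (intro mult_left_mono prod_mono) (auto intro: less_imp_le)
  also have "\<dots> = L i * L j ^ (CARD('n) - 1)" by (simp add: card_Diff_singleton)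
  finally have det: "1 \<le> \<sigma>\<^sup>2 * (\<tau>\<^sup>2) ^ (CARD('n) - 1)" by (simp add: \<sigma> \<tau>)
  \<comment> \<open>If \<open>\<tau>\<close> is at least 1, so are both factors. Otherwise the
    exponent \<open>CARD('n) - 1\<close>, which is at least 1, may be lowered to 1 because powers of
    a number below 1 decrease.\<close>
  have "1 \<le> \<sigma> * \<tau>"
  proof (cases "1 \<le> \<tau>")
    case True thus ?thesis using \<tau>(3) mult_mono[of 1 \<sigma> 1 \<tau>] \<sigma>(1) by simp
  next
    case False
    have "(\<tau>\<^sup>2) ^ (CARD('n) - 1) \<le> (\<tau>\<^sup>2) ^ 1"
      using False \<tau>(1) n2 by (intro power_decreasing) (auto simp: power_le_one)
    hence "\<sigma>\<^sup>2 * (\<tau>\<^sup>2) ^ (CARD('n) - 1) \<le> \<sigma>\<^sup>2 * (\<tau>\<^sup>2) ^ 1" by (rule mult_left_mono) simp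
    hence "1 \<le> \<sigma>\<^sup>2 * \<tau>\<^sup>2" using det unfolding power_one_right by (rule order_trans[rotated])
    hence "1\<^sup>2 \<le> (\<sigma> * \<tau>)\<^sup>2" unfolding power_mult_distrib by simp
    thus ?thesis using \<sigma>(1) \<tau>(1) by (intro power2_le_imp_le[of 1 "\<sigma> * \<tau>"]) auto
  qed
  hence "\<sigma> * 1 \<le> \<sigma> * (\<sigma> * \<tau>)" using \<sigma>(1) by (intro mult_left_mono) auto
  hence "\<sigma> / \<tau> \<le> \<sigma>\<^sup>2" using \<tau>(1) by (simp add: pos_divide_le_eq power2_eq_square mult.assoc)
  thus "exp (mu 1 g - mu 2 g) \<le> (opn g)\<^sup>2" unfolding ratio op .
qed

section \<open>Lines as rank-one projections\<close>

text \<open>For a unit vector this is the orthogonal projection onto its line. It ignores the sign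
  of \<open>u\<close> and lies in a Euclidean space, so lines inherit a complete metric and
  compactness.\<close>

definition outer :: "real^'n \<Rightarrow> real^'n^'n" where
  "outer u = (\<chi> i j. u $ i * u $ j)"

lemma inner_outer: "outer u \<bullet> outer v = (u \<bullet> v)\<^sup>2"
  by (simp add: outer_def inner_vec_def power2_eq_square sum_product ac_simps)

lemma outer_mult: "outer u *v x = (u \<bullet> x) *\<^sub>R u"
  by (simp add: outer_def matrix_vector_mult_def vec_eq_iff inner_vec_def sum_distrib_left sum_distrib_right ac_simps)

text \<open>The value is twice the squared sine of the angle between the lines.\<close>

lemma dist_outer:
  assumes "norm u = 1" "norm v = 1"
  shows "(dist (outer u) (outer v))\<^sup>2 = 2 - 2 * (u \<bullet> v)\<^sup>2"
proof -
  have "u \<bullet> u = 1" "v \<bullet> v = 1" using assms by (simp_all add: norm_eq_1)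
  thus ?thesis unfolding dist_norm power2_norm_eq_inner
    by (simp add: inner_diff_left inner_diff_right inner_outer inner_commute)
qed

text \<open>Whatever \<open>c\<close> is, the difference is at least as long as the distance from
  \<open>v\<close> to the line of \<open>u\<close>, which is the sine of the angle; the factor 2
  rounds up the square root of 2.\<close>

lemma dist_outer_le:
  assumes "norm u = 1" "norm v = 1" "norm (v - c *\<^sub>R u) \<le> r"
  shows "dist (outer u) (outer v) \<le> 2 * r"
proof -
  have uv: "u \<bullet> u = 1" "v \<bullet> v = 1" using assms by (simp_all add: norm_eq_1)
  have r: "0 \<le> r" using assms(3) norm_ge_zero order_trans by blast
  have "1 - (u \<bullet> v)\<^sup>2 \<le> (norm (v - c *\<^sub>R u))\<^sup>2"
  proof -
    have "(norm (v - c *\<^sub>R u))\<^sup>2 = 1 - 2 * c * (u \<bullet> v) + c\<^sup>2"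
      unfolding power2_norm_eq_inner
      by (simp add: inner_diff_left inner_diff_right uv inner_commute power2_eq_square)
    moreover have "0 \<le> (c - u \<bullet> v)\<^sup>2" by simp
    ultimately show ?thesis by (simp add: power2_eq_square algebra_simps)
  qed
  also have "\<dots> \<le> r\<^sup>2" using assms by (intro power_mono) auto
  finally have "(dist (outer u) (outer v))\<^sup>2 \<le> 2 * r\<^sup>2" using dist_outer[OF assms(1,2)] by simp
  also have "\<dots> \<le> (2 * r)\<^sup>2" by (simp add: power_mult_distrib)
  finally show ?thesis by (rule power2_le_imp_le) (use r in simp)
qed

text \<open>The squared cosine is linear in \<open>outer u\<close>, being its pairing with
  \<open>outer x\<close>, which has norm 1. This carries transversality over to nearby
  lines.\<close>

lemma inner_outer_diff: "\<bar>(u \<bullet> x)\<^sup>2 - (v \<bullet> x)\<^sup>2\<bar> \<le> dist (outer u) (outer v)" if "norm x = 1"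
proof -
  have "(u \<bullet> x)\<^sup>2 - (v \<bullet> x)\<^sup>2 = (outer u - outer v) \<bullet> outer x"
    by (simp add: inner_diff_left inner_outer)
  also have "\<bar>\<dots>\<bar> \<le> norm (outer u - outer v) * norm (outer x)" by (rule Cauchy_Schwarz_ineq2)
  also have "norm (outer x) = 1"
    using that by (simp add: norm_eq_sqrt_inner inner_outer)
  finally show ?thesis by (simp add: dist_norm)
qed

lemma outer_eq_imp_span_eq:
  assumes "norm u = 1" "norm v = 1" "outer u = outer v"
  shows "span {u} = span {v}"
proof -
  have u: "u = (v \<bullet> u) *\<^sub>R v" 
    using outer_mult[of u u] outer_mult[of v u] assms by (simp add: norm_eq_1)
  have v: "v = (u \<bullet> v) *\<^sub>R u"
    using outer_mult[of u v] outer_mult[of v v] assms by (simp add: norm_eq_1)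
  have "u \<in> span {v}" by (subst u) (intro span_scale span_base, simp)
  moreover have "v \<in> span {u}" by (subst v) (intro span_scale span_base, simp)
  ultimately show ?thesis
    by (intro antisym span_minimal) auto
qed

lemma unit_in_span:
  assumes "x \<in> span {v}" "norm x = 1" "norm v = 1"
  shows "x = v \<or> x = - v"
proof -
  obtain k where k: "x = k *\<^sub>R v" using assms(1) by (auto simp: span_singleton)
  hence "\<bar>k\<bar> = 1" using assms by simp
  thus ?thesis unfolding k by (auto simp: abs_if split: if_splits) 
qed

text \<open>The choice in \<open>line_dist\<close> is harmless: unit vectors of one line differ by a
  sign, which the absolute value removes.\<close>

lemma line_dist_span:
  assumes "norm u = 1" "norm v = 1"
  shows "line_dist (span {u}) (span {v}) = arccos \<bar>u \<bullet> v\<bar>"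
  unfolding line_dist_def
proof (rule some_equality)
  show "\<exists>ua va. ua \<in> span {u} \<and> va \<in> span {v} \<and> norm ua = 1 \<and> norm va = 1 \<and> arccos \<bar>u \<bullet> v\<bar> = arccos \<bar>ua \<bullet> va\<bar>"
    using assms by (intro exI[of _ u] exI[of _ v]) (auto intro: span_base)
next
  fix d assume "\<exists>ua va. ua \<in> span {u} \<and> va \<in> span {v} \<and> norm ua = 1 \<and> norm va = 1 \<and> d = arccos \<bar>ua \<bullet> va\<bar>"
  then obtain a b where ab: "a \<in> span {u}" "b \<in> span {v}" "norm a = 1" "norm b = 1" "d = arccos \<bar>a \<bullet> b\<bar>"
    by blast
  have "a = u \<or> a = - u" "b = v \<or> b = - v" using ab assms unit_in_span by blast+
  thus "d = arccos \<bar>u \<bullet> v\<bar>" using ab by auto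
qed

lemma abs_inner_le_1: "norm u = 1 \<Longrightarrow> norm v = 1 \<Longrightarrow> \<bar>u \<bullet> v\<bar> \<le> 1"
  using Cauchy_Schwarz_ineq2[of u v] by simp

lemma line_dist_le_outer:
  assumes "norm u = 1" "norm v = 1"
  shows "line_dist (span {u}) (span {v}) \<le> 4 * dist (outer u) (outer v)"
proof -
  define t where "t = \<bar>u \<bullet> v\<bar>"
  have t: "0 \<le> t" "t \<le> 1" using abs_inner_le_1[OF assms] by (auto simp: t_def)
  define \<theta> where "\<theta> = arccos t"
  have th: "0 \<le> \<theta>" "\<theta> \<le> pi / 2" "cos \<theta> = t" "0 \<le> sin \<theta>"
    unfolding \<theta>_def using t arccos_le_pi2[of t] arccos_lbound[of t] cos_arccos[of t] sin_arccos_nonzero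
    by (auto intro!: sin_ge_zero intro: arccos_ubound)
  have "(dist (outer u) (outer v))\<^sup>2 = 2 * (sin \<theta>)\<^sup>2"
    unfolding dist_outer[OF assms] sin_squared_eq th by (simp add: t_def)
  hence "(sin \<theta>)\<^sup>2 \<le> (dist (outer u) (outer v))\<^sup>2" by simp
  hence s: "sin \<theta> \<le> dist (outer u) (outer v)" by (rule power2_le_imp_le) simp
  \<comment> \<open>Up to \<theta> = 1, which is below pi/3, the cosine is at least 1/2 and the mean
    value theorem applies; beyond it the sine is at least 1/2 while \<theta> is below 2.\<close>
  have "\<theta> \<le> 4 * sin \<theta>"
  proof (cases "\<theta> \<le> 1")
    case True
    show ?thesis
    proof (cases "\<theta> = 0")
      case False
      hence "0 < \<theta>" using th by simp
      then obtain z where z: "0 < z" "z < \<theta>" "sin \<theta> - sin 0 = (\<theta> - 0) * cos z"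
        using MVT2[of 0 \<theta> sin cos] DERIV_sin by blast
      have "cos (pi / 3) \<le> cos z" using z True pi_gt3 by (intro cos_monotone_0_pi_le) auto
      hence "\<theta> * (1 / 2) \<le> \<theta> * cos z" using th by (intro mult_left_mono) (auto simp: cos_60)
      thus ?thesis using z th by simp
    qed simp
  next
    case False
    have "sin (pi / 6) \<le> sin \<theta>" using False th pi_less_4 by (intro sin_monotone_2pi_le) auto
    hence "1 / 2 \<le> sin \<theta>" by (simp add: sin_30)
    thus ?thesis using th pi_less_4 by simp
  qed
  thus ?thesis unfolding line_dist_span[OF assms] t_def[symmetric] \<theta>_def[symmetric] using s by linarith
qed

lemma line_dist_tendsto_0_imp:
  assumes "\<And>k. norm (u k) = 1" "norm v = 1"
    and "(\<lambda>k. line_dist (span {u k}) (span {v})) \<longlonglongrightarrow> 0"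
  shows "(\<lambda>k. outer (u k)) \<longlonglongrightarrow> outer v"
proof -
  have "dist (outer (u k)) (outer v) = sqrt (2 - 2 * (cos (line_dist (span {u k}) (span {v})))\<^sup>2)" for k
  proof -
    have "cos (line_dist (span {u k}) (span {v})) = \<bar>u k \<bullet> v\<bar>"
      unfolding line_dist_span[OF assms(1,2)] using abs_inner_le_1[OF assms(1,2), of k] by (intro cos_arccos) auto
    hence "(dist (outer (u k)) (outer v))\<^sup>2 = 2 - 2 * (cos (line_dist (span {u k}) (span {v})))\<^sup>2"
      by (simp add: dist_outer[OF assms(1,2)])
    thus ?thesis by (metis real_sqrt_unique zero_le_dist)
  qed
  moreover have "(\<lambda>k. sqrt (2 - 2 * (cos (line_dist (span {u k}) (span {v})))\<^sup>2)) \<longlonglongrightarrow> sqrt (2 - 2 * (cos 0)\<^sup>2)"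
    by (intro tendsto_intros assms(3))
  ultimately have "(\<lambda>k. dist (outer (u k)) (outer v)) \<longlonglongrightarrow> 0" by simp
  thus ?thesis by (simp only: tendsto_dist_iff[symmetric])
qed

lemma continuous_on_outer: "continuous_on A outer"
  unfolding outer_def by (intro continuous_intros)

lemma compact_outer_sphere: "compact (outer ` sphere (0 :: real^'n) 1)"
  by (intro compact_continuous_image continuous_on_outer compact_sphere)

lemma outer_limit:
  assumes "\<And>k. norm (u k) = 1" "(\<lambda>k. outer (u k)) \<longlonglongrightarrow> z"
  obtains v where "norm v = 1" "z = outer v"
proof -
  have "z \<in> outer ` sphere 0 1"
    using compact_imp_closed[OF compact_outer_sphere] assms
    by (intro Lim_in_closed_set[OF _ _ _ assms(2)]) auto
  thus ?thesis using that by auto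
qed

section \<open>Perturbation of singular lines\<close>

lemma near_rank_one_approx:
  "near_rank_one X s u w \<Longrightarrow> norm (X *v v - (opn X * (w \<bullet> v)) *\<^sub>R u) \<le> s * opn X * norm v"
  by (simp add: near_rank_one_def)

lemma near_rank_one_unit: "near_rank_one X s u w \<Longrightarrow> norm u = 1" "near_rank_one X s u w \<Longrightarrow> norm w = 1"
  by (simp_all add: near_rank_one_def)

text \<open>Pairing the image of \<open>v\<close> with \<open>u\<close> moves \<open>X\<close> to
  its transpose, which sends \<open>u\<close> exactly to a multiple of \<open>w\<close>; hence no
  error term in \<open>s\<close>.\<close>

lemma near_rank_one_norm_ge:
  assumes "near_rank_one X s u w"
  shows "opn X * \<bar>w \<bullet> v\<bar> \<le> norm (X *v v)"
proof -
  have "u \<bullet> (X *v v) = (transpose X *v u) \<bullet> v" using dot_transpose[of X v u] by (simp add: inner_commute)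
  also have "\<dots> = opn X * (w \<bullet> v)" using assms by (simp add: near_rank_one_def)
  finally have "\<bar>opn X * (w \<bullet> v)\<bar> \<le> norm u * norm (X *v v)" by (metis Cauchy_Schwarz_ineq2)
  thus ?thesis using assms opn_nonneg[of X] by (simp add: near_rank_one_def abs_mult)
qed

lemma near_rank_one_norm_le:
  assumes "near_rank_one X s u w"
  shows "norm (X *v v) \<le> opn X * (\<bar>w \<bullet> v\<bar> + s * norm v)"
proof -
  have "norm (X *v v) \<le> norm ((opn X * (w \<bullet> v)) *\<^sub>R u) + norm (X *v v - (opn X * (w \<bullet> v)) *\<^sub>R u)"
    using norm_triangle_ineq[of "(opn X * (w \<bullet> v)) *\<^sub>R u" "X *v v - (opn X * (w \<bullet> v)) *\<^sub>R u"] by simp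
  also have "\<dots> \<le> opn X * \<bar>w \<bullet> v\<bar> + s * opn X * norm v"
    using assms opn_nonneg[of X] by (intro add_mono near_rank_one_approx[OF assms]) (auto simp: near_rank_one_unit abs_mult)
  finally show ?thesis by (simp add: algebra_simps)
qed

text \<open>The component of \<open>X v\<close> orthogonal to \<open>u\<close> has size at most \<open>s |X|\<close>.\<close>

lemma image_near_top_line:
  assumes X: "near_rank_one X s u w" and v: "norm v = 1" and k: "\<kappa> \<le> \<bar>w \<bullet> v\<bar>" "0 < \<kappa>" and op: "0 < opn X"
    and z: "norm z = 1" "X *v v = c *\<^sub>R z" and s: "0 \<le> s"
  shows "dist (outer u) (outer z) \<le> 2 * s / \<kappa>"
proof -
  have "opn X * \<kappa> \<le> norm (X *v v)"
    using near_rank_one_norm_ge[OF X, of v] mult_left_mono[OF k(1), of "opn X"] op by linarith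
  hence c: "opn X * \<kappa> \<le> \<bar>c\<bar>" using z by simp
  have cpos: "0 < \<bar>c\<bar>" using c mult_pos_pos[OF op k(2)] by linarith
  have "norm (z - ((opn X * (w \<bullet> v)) / c) *\<^sub>R u) = norm (X *v v - (opn X * (w \<bullet> v)) *\<^sub>R u) / \<bar>c\<bar>"
  proof -
    have "X *v v - (opn X * (w \<bullet> v)) *\<^sub>R u = c *\<^sub>R (z - ((opn X * (w \<bullet> v)) / c) *\<^sub>R u)"
      using cpos z by (simp add: scaleR_diff_right)
    thus ?thesis using cpos by simp
  qed
  also have "\<dots> \<le> s * opn X / \<bar>c\<bar>"
    using near_rank_one_approx[OF X, of v] v by (intro divide_right_mono) auto
  also have "\<dots> \<le> s * opn X / (opn X * \<kappa>)"
    using c op k s cpos by (intro divide_left_mono mult_pos_pos) auto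
  also have "\<dots> = s / \<kappa>" using op by simp
  finally show ?thesis
    using dist_outer_le[OF near_rank_one_unit(1)[OF X] z(1)] by fastforce
qed

text \<open>Up to scaling, \<open>u'\<close> is the image under \<open>X\<close> of
  \<open>B *v w'\<close>. The component of that image off \<open>u\<close> is at most
  \<open>s * opn X * K\<close>, while \<open>opn X\<close> is at most \<open>K\<close> times the
  norm of the product: one factor \<open>K\<close> comes from \<open>B\<close>, the other from its
  inverse \<open>B'\<close>.\<close>

lemma top_line_mult_right:
  assumes X: "near_rank_one X s u w" and Y: "near_rank_one (X ** B) s' u' w'"
    and B: "opn B \<le> K" "opn B' \<le> K" "B ** B' = mat 1" and op: "0 < opn X" and s: "0 \<le> s"
  shows "dist (outer u) (outer u') \<le> 2 * K\<^sup>2 * s"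
proof -
  let ?b = "B *v w'"
  have K: "0 \<le> K" using B opn_nonneg order_trans by blast
  have "opn X = opn ((X ** B) ** B')" by (simp add: matrix_mul_assoc[symmetric] B)
  also have "\<dots> \<le> opn (X ** B) * opn B'" by (rule opn_mult)
  also have "\<dots> \<le> opn (X ** B) * K" using B by (intro mult_left_mono opn_nonneg)
  finally have le: "opn X \<le> opn (X ** B) * K" .
  hence pos: "0 < opn (X ** B)" using op K opn_nonneg[of "X ** B"]
    by (cases "opn (X ** B) = 0") auto
  have Xb: "X *v ?b = opn (X ** B) *\<^sub>R u'" using Y by (simp add: near_rank_one_def matrix_vector_mul_assoc)
  have nb: "norm ?b \<le> K" using opn[of B w'] Y B by (simp add: near_rank_one_def)
  let ?c = "opn X * (w \<bullet> ?b) / opn (X ** B)"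
  have "opn (X ** B) *\<^sub>R (u' - ?c *\<^sub>R u) = X *v ?b - (opn X * (w \<bullet> ?b)) *\<^sub>R u"
    using pos by (simp add: Xb scaleR_diff_right)
  from arg_cong[OF this, of norm] have "opn (X ** B) * norm (u' - ?c *\<^sub>R u) = norm (X *v ?b - (opn X * (w \<bullet> ?b)) *\<^sub>R u)"
    using pos by simp
  also have "\<dots> \<le> s * opn X * norm ?b" using X by (simp add: near_rank_one_def)
  also have "\<dots> \<le> s * (opn (X ** B) * K) * K" using le nb s K op by (intro mult_mono) auto
  finally have "opn (X ** B) * norm (u' - ?c *\<^sub>R u) \<le> opn (X ** B) * (K\<^sup>2 * s)" by (simp add: power2_eq_square ac_simps)
  hence "norm (u' - ?c *\<^sub>R u) \<le> K\<^sup>2 * s" using pos by (simp only: mult_le_cancel_left_pos)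
  from dist_outer_le[OF near_rank_one_unit(1)[OF X] near_rank_one_unit(1)[OF Y] this] show ?thesis by simp
qed

lemma top_line_mult_left:
  assumes X: "near_rank_one X s u w" and Y: "near_rank_one (B ** X) s' u' w'"
    and B: "opn B \<le> K" "opn B' \<le> K" "B' ** B = mat 1" and op: "0 < opn X" and s: "0 \<le> s"
  shows "dist (outer w) (outer w') \<le> 2 * K\<^sup>2 * s"
proof (rule top_line_mult_right)
  show "near_rank_one (transpose X) s w u" by (rule near_rank_one_transpose[OF X])
  show "near_rank_one (transpose X ** transpose B) s' w' u'"
    using near_rank_one_transpose[OF Y] by (simp add: matrix_transpose_mul)
  show "transpose B ** transpose B' = mat 1" using B(3) by (metis matrix_transpose_mul transpose_mat)
qed (use B op s in \<open>simp_all add: opn_transpose\<close>)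

text \<open>Up to the errors \<open>s\<close> and \<open>t\<close>, \<open>B\<close> outputs only
  the direction \<open>u'\<close> and \<open>A\<close> reads only the pairing with \<open>w\<close>.
  So a product that loses only a bounded factor of norm forces \<open>w\<close> and
  \<open>u'\<close> to be transverse.\<close>

lemma top_vectors_inner_ge:
  assumes A: "near_rank_one A s u w" and B: "near_rank_one B t u' w'" and s: "0 \<le> s" "0 \<le> t" "t \<le> 1"
    and pos: "0 < opn A" "0 < opn B"
    and c: "c * (opn A * opn B) \<le> opn (A ** B)"
  shows "c - s - t \<le> \<bar>w \<bullet> u'\<bar>"
proof -
  have "opn (A ** B) \<le> opn A * opn B * (\<bar>w \<bullet> u'\<bar> + s + t)"
  proof (rule opn_le)
    fix v
    let ?y = "B *v v" and ?a = "opn B * (w' \<bullet> v)"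
    have wv: "\<bar>w' \<bullet> v\<bar> \<le> norm v" using Cauchy_Schwarz_ineq2[of w' v] B by (simp add: near_rank_one_def)
    have yb: "norm (?y - ?a *\<^sub>R u') \<le> t * opn B * norm v" using B by (simp add: near_rank_one_def)
    have "w \<bullet> ?y = ?a * (w \<bullet> u') + w \<bullet> (?y - ?a *\<^sub>R u')" by (simp add: inner_diff_right)
    also have "\<bar>\<dots>\<bar> \<le> \<bar>?a\<bar> * \<bar>w \<bullet> u'\<bar> + norm w * norm (?y - ?a *\<^sub>R u')"
      using Cauchy_Schwarz_ineq2[of w "?y - ?a *\<^sub>R u'"] by (intro abs_triangle_ineq[THEN order_trans] add_mono) (auto simp: abs_mult)
    also have "\<dots> \<le> opn B * norm v * \<bar>w \<bullet> u'\<bar> + t * opn B * norm v"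
      using yb A wv pos by (intro add_mono mult_right_mono) (auto simp: near_rank_one_def abs_mult)
    finally have 1: "\<bar>w \<bullet> ?y\<bar> \<le> opn B * norm v * \<bar>w \<bullet> u'\<bar> + t * opn B * norm v" .
    have "norm (A *v ?y) \<le> opn A * (\<bar>w \<bullet> ?y\<bar> + s * norm ?y)" by (rule near_rank_one_norm_le[OF A])
    also have "\<dots> \<le> opn A * (opn B * norm v * \<bar>w \<bullet> u'\<bar> + t * opn B * norm v + s * (opn B * norm v))"
      using 1 pos s opn[of B v] by (intro mult_left_mono add_mono) auto
    also have "\<dots> = opn A * opn B * (\<bar>w \<bullet> u'\<bar> + s + t) * norm v" by (simp add: algebra_simps)
    finally show "norm ((A ** B) *v v) \<le> opn A * opn B * (\<bar>w \<bullet> u'\<bar> + s + t) * norm v"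
      by (simp add: matrix_vector_mul_assoc)
  qed
  hence "(opn A * opn B) * c \<le> (opn A * opn B) * (\<bar>w \<bullet> u'\<bar> + s + t)" using c by (simp add: ac_simps)
  hence "c \<le> \<bar>w \<bullet> u'\<bar> + s + t" using pos by (subst (asm) mult_le_cancel_left_pos) auto
  thus ?thesis by simp
qed

section \<open>Cocycles with an exponential singular value gap\<close>

lemma exp_seq_tendsto_0:
  fixes A l :: real
  assumes "0 < l" shows "(\<lambda>n. A * exp (- l * real n)) \<longlonglongrightarrow> 0"
proof -
  have "(\<lambda>n. A * exp (- l * real n)) \<longlonglongrightarrow> A * 0"
    using assms by (intro tendsto_intros filterlim_compose[OF exp_at_bot]
       filterlim_tendsto_neg_mult_at_bot[OF tendsto_const _ filterlim_real_sequentially]) auto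
  thus ?thesis by simp
qed

text \<open>A discrete Gronwall bound whose feedback involves the new value: (1 - q) S(t+1) \<le>
  S(t) with q exponentially small. It can be solved for S(t+1) once q < 1/2; the finitely many
  earlier steps use the crude factor \<open>A\<close>. What matters is that \<open>R\<close> depends
  on \<open>A\<close>, \<open>C\<close>, \<open>l\<close> only.\<close>

lemma self_improving_growth_bounded:
  fixes A C l :: real
  assumes A: "1 \<le> A" and C: "0 \<le> C" and l: "0 < l"
  shows "\<exists>R\<ge>1. \<forall>S n. (\<forall>t\<le>n. 0 \<le> S t) \<longrightarrow> (\<forall>t<n. S (Suc t) \<le> A * S t) \<longrightarrow>
     (\<forall>t<n. S (Suc t) \<le> S t + C * exp (- l * real (Suc t)) * S (Suc t)) \<longrightarrow> S n \<le> R * (S 0 :: real)"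
proof -
  have "eventually (\<lambda>n. C * exp (- l * real n) < 1 / 2) sequentially"
    by (rule order_tendstoD(2)[OF exp_seq_tendsto_0[OF l]]) simp
  then obtain m where m: "\<And>n. n \<ge> m \<Longrightarrow> C * exp (- l * real n) < 1 / 2"
    by (auto simp: eventually_sequentially)
  \<comment> \<open>\<open>E * (1 - exp (- l * real t))\<close> is the sum of
    \<open>2 * C * exp (- l * real j)\<close> for \<open>j\<close> from 1 to \<open>t\<close>, the
    exponent accumulated by the factors 1 + 2q.\<close>
  define E where "E = 2 * C / (exp l - 1)"
  have el: "exp l - 1 > 0" using l by simp
  have E: "E \<ge> 0" using C el by (simp add: E_def)
  have Estep: "E * (exp (- l * real t) - exp (- l * real (Suc t))) = 2 * (C * exp (- l * real (Suc t)))" for t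
  proof -
    have "exp (- l * real t) = exp l * exp (- l * real (Suc t))"
      by (simp add: exp_add[symmetric] algebra_simps)
    hence "exp (- l * real t) - exp (- l * real (Suc t)) = (exp l - 1) * exp (- l * real (Suc t))"
      by (simp add: algebra_simps)
    thus ?thesis using el by (simp add: E_def)
  qed
  define R where "R = A ^ m * exp E"
  have "S n \<le> R * S 0"
    if pos: "\<forall>t\<le>n. 0 \<le> S t" and a: "\<forall>t<n. S (Suc t) \<le> A * S t"
      and b: "\<forall>t<n. S (Suc t) \<le> S t + C * exp (- l * real (Suc t)) * S (Suc t)" for S :: "nat \<Rightarrow> real" and n
  proof -
    have S0: "0 \<le> S 0" using pos by simp
    have "S t \<le> A ^ (min t m) * exp (E * (1 - exp (- l * real t))) * S 0" if "t \<le> n" for t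
      using that
    proof (induction t)
      case 0 thus ?case by simp
    next
      case (Suc t)
      hence t: "t < n" and IH: "S t \<le> A ^ (min t m) * exp (E * (1 - exp (- l * real t))) * S 0" by auto
      let ?e = "\<lambda>t. exp (E * (1 - exp (- l * real t)))"
      let ?q = "C * exp (- l * real (Suc t))"
      have q: "0 \<le> ?q" using C by simp
      have e: "?e (Suc t) = ?e t * exp (2 * ?q)"
        unfolding Estep[symmetric] exp_add[symmetric] by (simp add: algebra_simps)
      show ?case
      proof (cases "t < m")
        case True
        have "S (Suc t) \<le> A * S t" using a t by simp
        also have "\<dots> \<le> A * (A ^ (min t m) * ?e t * S 0)" using IH A by (intro mult_left_mono) auto
        also have "\<dots> = A ^ (min (Suc t) m) * ?e t * S 0" using True by (simp add: min_def)
        also have "\<dots> \<le> A ^ (min (Suc t) m) * ?e (Suc t) * S 0"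
          unfolding e using S0 A q by (intro mult_right_mono mult_left_mono) auto
        finally show ?thesis .
      next
        case False
        have "?q < 1 / 2" using m[of "Suc t"] False by simp
        hence "1 \<le> (1 - ?q) * (1 + 2 * ?q)"
          using mult_nonneg_nonneg[of ?q "1 - 2 * ?q"] q by (simp add: algebra_simps)
        hence "S (Suc t) \<le> (1 - ?q) * (1 + 2 * ?q) * S (Suc t)"
          using pos Suc.prems mult_right_mono[of 1 "(1 - ?q) * (1 + 2 * ?q)" "S (Suc t)"] by simp
        also have "\<dots> = (1 + 2 * ?q) * (S (Suc t) - ?q * S (Suc t))" by (simp add: algebra_simps)
        also have "\<dots> \<le> (1 + 2 * ?q) * S t" using b t q by (intro mult_left_mono) (auto simp: algebra_simps)
        also have "\<dots> \<le> exp (2 * ?q) * S t"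
          using pos t by (intro mult_right_mono exp_ge_add_one_self) auto
        also have "\<dots> \<le> exp (2 * ?q) * (A ^ (min t m) * ?e t * S 0)" using IH by (intro mult_left_mono) auto
        also have "\<dots> = A ^ (min (Suc t) m) * ?e (Suc t) * S 0" unfolding e using False by (simp add: min_def)
        finally show ?thesis .
      qed
    qed
    from this[of n] have "S n \<le> A ^ (min n m) * exp (E * (1 - exp (- l * real n))) * S 0" by simp
    also have "\<dots> \<le> A ^ m * exp E * S 0"
      using A E S0 by (intro mult_right_mono mult_mono power_increasing) (auto simp: mult_left_le)
    finally show ?thesis by (simp add: R_def)
  qed
  moreover have "R \<ge> 1" unfolding R_def using A E by (simp add: mult_ge1_I)
  ultimately show ?thesis by blast
qed

text \<open>\<open>Y k i\<close> is the transition from time \<open>i\<close> to time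
  \<open>k\<close>, composed on the left as time grows, and \<open>Z i\<close> inverts the step from
  \<open>i\<close> to \<open>Suc i\<close>. The horizon \<open>N\<close> is finite, but the
  constants \<open>K\<close>, \<open>D\<close>, \<open>l\<close> are separate parameters, so that
  estimates can be uniform over words of all lengths.\<close>

locale gap_cocycle =
  fixes Y :: "nat \<Rightarrow> nat \<Rightarrow> 'n::finite mat" and Z :: "nat \<Rightarrow> 'n mat" and N :: nat and K D l :: real
  assumes cocycle: "i \<le> j \<Longrightarrow> j \<le> k \<Longrightarrow> k \<le> N \<Longrightarrow> Y k i = Y k j ** Y j i"
    and refl: "i \<le> N \<Longrightarrow> Y i i = mat 1"
    and unit_step: "i < N \<Longrightarrow> opn (Y (Suc i) i) \<le> K" "i < N \<Longrightarrow> opn (Z i) \<le> K"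
      "i < N \<Longrightarrow> Y (Suc i) i ** Z i = mat 1" "i < N \<Longrightarrow> Z i ** Y (Suc i) i = mat 1"
    and gap: "i < j \<Longrightarrow> j \<le> N \<Longrightarrow> \<exists>u w. near_rank_one (Y j i) (D * exp (- l * (real j - real i))) u w"
    and K: "1 \<le> K" and D: "0 \<le> D" and l: "0 < l"
begin

definition "U j i = (SOME u. \<exists>w. near_rank_one (Y j i) (D * exp (- l * (real j - real i))) u w)"
definition "W j i = (SOME w. near_rank_one (Y j i) (D * exp (- l * (real j - real i))) (U j i) w)"

abbreviation "Ul j i \<equiv> outer (U j i)"
abbreviation "Wl j i \<equiv> outer (W j i)"

lemma UW: "i < j \<Longrightarrow> j \<le> N \<Longrightarrow> near_rank_one (Y j i) (D * exp (- l * (real j - real i))) (U j i) (W j i)"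
  unfolding W_def by (rule someI_ex, unfold U_def, rule someI_ex, rule gap)

lemma norm_lower: "i \<le> j \<Longrightarrow> j \<le> N \<Longrightarrow> norm v \<le> K ^ (j - i) * norm (Y j i *v v)"
proof (induction j rule: dec_induct)
  case base thus ?case by (simp add: refl)
next
  case (step j)
  have Y: "Y (Suc j) i *v v = Y (Suc j) j *v (Y j i *v v)"
    using cocycle[of i j "Suc j"] step by (simp add: matrix_vector_mul_assoc)
  let ?x = "Y j i *v v"
  have "norm ?x = norm (Z j *v (Y (Suc j) j *v ?x))"
    using unit_step(4)[of j] step by (simp add: matrix_vector_mul_assoc[of "Z j"])
  also have "\<dots> \<le> opn (Z j) * norm (Y (Suc j) j *v ?x)" by (rule opn)
  also have "\<dots> \<le> K * norm (Y (Suc j) j *v ?x)" using unit_step(2)[of j] step by (intro mult_right_mono) auto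
  finally have 1: "norm ?x \<le> K * norm (Y (Suc j) i *v v)" unfolding Y .
  have "norm v \<le> K ^ (j - i) * norm ?x" using step by simp
  also have "\<dots> \<le> K ^ (j - i) * (K * norm (Y (Suc j) i *v v))" using 1 K by (intro mult_left_mono) auto
  finally show ?case using step by (simp add: Suc_diff_le ac_simps)
qed

lemma opn_pos: assumes "i \<le> j" "j \<le> N" shows "0 < opn (Y j i)"
proof -
  have "(axis undefined 1 :: real^'n) \<noteq> 0" by (simp add: axis_eq_0_iff)
  then obtain v :: "real^'n" where v: "v \<noteq> 0" by blast
  have "Y j i *v v \<noteq> 0" using norm_lower[OF assms, of v] v by auto
  hence "opn (Y j i) \<noteq> 0" using opn[of "Y j i" v] by auto
  thus ?thesis using opn_nonneg[of "Y j i"] by simp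
qed

text \<open>The sum of the geometric series of step bounds in \<open>U_converges\<close> and
  \<open>W_converges\<close>, up to the exponential factor; \<open>C1_step\<close> is its
  telescoping form.\<close>

definition "C1 = 2 * K\<^sup>2 * D / (1 - exp (- l))"

lemma C1: "0 \<le> C1" using D l by (simp add: C1_def)

lemma C1_step: "C1 * (exp (- l * x) - exp (- l * (x + 1))) = 2 * K\<^sup>2 * (D * exp (- l * x))"
proof -
  have "exp (- l * (x + 1)) = exp (- l) * exp (- l * x)" by (simp add: exp_add[symmetric] algebra_simps)
  hence "exp (- l * x) - exp (- l * (x + 1)) = (1 - exp (- l)) * exp (- l * x)" by (simp add: algebra_simps)
  moreover have "1 - exp (- l) \<noteq> 0" using l by simp
  ultimately show ?thesis by (simp add: C1_def)
qed

text \<open>With the end time \<open>j\<close> fixed, starting one step earlier multiplies on the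
  right and moves the image line by a term of a geometric series. So this line is essentially
  settled by the last stretch before \<open>j\<close>.\<close>

lemma U_converges:
  assumes "i \<le> t" "t < j" "j \<le> N"
  shows "dist (Ul j t) (Ul j i) \<le> C1 * (exp (- l * (real j - real t)) - exp (- l * (real j - real i)))"
  using assms(1)
proof (induction i rule: inc_induct)
  case base show ?case by simp
next
  case (step i)
  have Yj: "Y j i = Y j (Suc i) ** Y (Suc i) i" using cocycle[of i "Suc i" j] step assms by simp
  have "dist (Ul j (Suc i)) (Ul j i) \<le> 2 * K\<^sup>2 * (D * exp (- l * (real j - real (Suc i))))"
    by (rule top_line_mult_right[OF UW UW[of i j, unfolded Yj], where B' = "Z i"])
      (use step assms unit_step opn_pos D in auto)
  also have "\<dots> = C1 * (exp (- l * (real j - real (Suc i))) - exp (- l * (real j - real i)))"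
    unfolding C1_step[symmetric] by simp
  finally have 1: "dist (Ul j (Suc i)) (Ul j i) \<le> C1 * (exp (- l * (real j - real (Suc i))) - exp (- l * (real j - real i)))" .
  have "dist (Ul j t) (Ul j i) \<le> dist (Ul j t) (Ul j (Suc i)) + dist (Ul j (Suc i)) (Ul j i)"
    by (rule dist_triangle)
  also have "\<dots> \<le> C1 * (exp (- l * (real j - real t)) - exp (- l * (real j - real (Suc i))))
     + C1 * (exp (- l * (real j - real (Suc i))) - exp (- l * (real j - real i)))"
    using step.IH 1 by (rule add_mono)
  finally show ?case by (simp add: algebra_simps)
qed

text \<open>The mirror image: with the start fixed, later steps multiply on the left, and the input
  line is settled by the first stretch.\<close>

lemma W_converges:
  assumes "i < t" "t \<le> j" "j \<le> N"
  shows "dist (Wl t i) (Wl j i) \<le> C1 * (exp (- l * (real t - real i)) - exp (- l * (real j - real i)))"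
  using assms(2,3)
proof (induction j rule: dec_induct)
  case base show ?case by simp
next
  case (step j)
  have Yj: "Y (Suc j) i = Y (Suc j) j ** Y j i" using cocycle[of i j "Suc j"] step assms by simp
  have "dist (Wl j i) (Wl (Suc j) i) \<le> 2 * K\<^sup>2 * (D * exp (- l * (real j - real i)))"
    by (rule top_line_mult_left[OF UW UW[of i "Suc j", unfolded Yj], where B' = "Z j"])
      (use step assms unit_step opn_pos D in auto)
  also have "\<dots> = C1 * (exp (- l * (real j - real i)) - exp (- l * (real (Suc j) - real i)))"
    unfolding C1_step[symmetric] by (simp add: algebra_simps)
  finally have 1: "dist (Wl j i) (Wl (Suc j) i) \<le> C1 * (exp (- l * (real j - real i)) - exp (- l * (real (Suc j) - real i)))" .
  have "dist (Wl t i) (Wl (Suc j) i) \<le> dist (Wl t i) (Wl j i) + dist (Wl j i) (Wl (Suc j) i)"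
    by (rule dist_triangle)
  also have "\<dots> \<le> C1 * (exp (- l * (real t - real i)) - exp (- l * (real j - real i)))
     + C1 * (exp (- l * (real j - real i)) - exp (- l * (real (Suc j) - real i)))"
    using step.IH[OF Suc_leD[OF step.prems]] 1 by (rule add_mono)
  finally show ?case by (simp add: algebra_simps)
qed

text \<open>\<open>C1 + 4 * D\<close> bounds the deviation of the image line from the reference line
  \<open>e t\<close> of the next lemma; the fifth \<open>D\<close> is the remainder outside the top
  rank-one part.\<close>

definition "C3 = C1 + 5 * D"

text \<open>Here \<open>e t\<close> spans the image at time \<open>t\<close> of the top direction at time \<open>m\<close>. The complement
  of this line grows exponentially slower than the norm (\<open>comp_bound\<close>), so the norm is carried
  by the accumulated feedback of the complement into the line; this feedback, relative to the
  growth \<open>b\<close> of the line itself, satisfies a self-improving recursion and hence stays bounded.\<close>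

lemma norm_supermultiplicative_large:
  assumes m: "0 < m" "m \<le> N" and small: "C1 * exp (- l * real m) \<le> 1 / 2"
    and R: "1 \<le> R" "\<And>S n. (\<forall>t\<le>n. 0 \<le> S t) \<Longrightarrow> (\<forall>t<n. S (Suc t) \<le> (1 + K^4) * S t) \<Longrightarrow>
     (\<forall>t<n. S (Suc t) \<le> S t + K\<^sup>2 * C3 * exp (- l * real (Suc t)) * S (Suc t)) \<Longrightarrow> S n \<le> R * (S 0 :: real)"
  shows "opn (Y N m) * opn (Y m 0) \<le> R * (1 + K\<^sup>2) * opn (Y N 0)"
proof -
  \<comment> \<open>A direction in which \<open>Y m 0\<close> attains its norm, so that
    \<open>b m\<close> below equals \<open>opn (Y m 0)\<close>.\<close>
  define x where "x = W m 0"
  define b where "b t = norm (Y t 0 *v x)" for t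
  define e where "e t = (1 / b t) *\<^sub>R (Y t 0 *v x)" for t
  have x1: "norm x = 1" using UW[of 0 m] m by (simp add: x_def near_rank_one_unit(2))
  have bpos: "0 < b t" if "t \<le> N" for t
  proof -
    have "Y t 0 *v x \<noteq> 0" using norm_lower[of 0 t x] that x1 by auto
    thus ?thesis by (simp add: b_def)
  qed
  have Ye0: "Y t 0 *v x = b t *\<^sub>R e t" if "t \<le> N" for t using bpos[OF that] by (simp add: e_def)
  have e1: "norm (e t) = 1" if "t \<le> N" for t using bpos[OF that] by (simp add: e_def b_def)
  have Ye: "Y t s *v e s = (b t / b s) *\<^sub>R e t" if "s \<le> t" "t \<le> N" for s t
  proof -
    have "Y t s *v (b s *\<^sub>R e s) = b t *\<^sub>R e t"
      using cocycle[of 0 s t] that by (simp add: Ye0[symmetric] matrix_vector_mul_assoc)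
    hence "b s *\<^sub>R (Y t s *v e s) = b t *\<^sub>R e t" by (simp add: matrix_vector_mult_scaleR)
    hence "(1 / b s) *\<^sub>R (b s *\<^sub>R (Y t s *v e s)) = (1 / b s) *\<^sub>R (b t *\<^sub>R e t)" by simp
    thus ?thesis using bpos[of s] that by simp
  qed
  have bstep: "b t \<le> K * b (Suc t)" if "t < N" for t
  proof -
    have "1 \<le> K * norm (Y (Suc t) t *v e t)" using norm_lower[of t "Suc t" "e t"] that e1[of t] by simp
    hence "1 \<le> K * (b (Suc t) / b t)"
      using Ye[of t "Suc t"] that e1[of "Suc t"] bpos[of t] bpos[of "Suc t"] by simp
    thus ?thesis using bpos[of t] that by (simp add: field_simps)
  qed
  \<comment> \<open>By the smallness assumption the input line at time \<open>t\<close> is still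
    within 1/2 of that of \<open>x\<close>. Hence \<open>x\<close> is transverse to the directions
    that \<open>Y t 0\<close> contracts, and its image lies near \<open>U t 0\<close>, which lies
    near \<open>U t s\<close>.\<close>
  have near: "dist (Ul t s) (outer (e t)) \<le> (C1 + 4 * D) * exp (- l * (real t - real s))"
    if "m \<le> s" "s < t" "t \<le> N" for s t
  proof -
    have "dist (outer x) (Wl t 0) \<le> C1 * (exp (- l * (real m - real 0)) - exp (- l * (real t - real 0)))"
      unfolding x_def using that m by (intro W_converges) auto
    also have "\<dots> \<le> C1 * exp (- l * real m)" using C1 by (intro mult_left_mono) auto
    finally have "dist (outer x) (Wl t 0) \<le> 1 / 2" using small by simp
    hence "(dist (outer x) (Wl t 0))\<^sup>2 \<le> (1 / 2)\<^sup>2" by (intro power_mono) auto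
    moreover have "norm (W t 0) = 1" using UW[of 0 t] that m by (simp add: near_rank_one_unit(2))
    ultimately have "7 / 8 \<le> (x \<bullet> W t 0)\<^sup>2" using dist_outer[OF x1] by (simp add: power2_eq_square)
    hence "(1 / 2)\<^sup>2 \<le> \<bar>W t 0 \<bullet> x\<bar>\<^sup>2" by (simp add: inner_commute power2_eq_square)
    hence "1 / 2 \<le> \<bar>W t 0 \<bullet> x\<bar>" by (rule power2_le_imp_le) simp
    hence "dist (Ul t 0) (outer (e t)) \<le> 2 * (D * exp (- l * (real t - real 0))) / (1 / 2)"
      using that m D by (intro image_near_top_line[OF UW x1 _ _ opn_pos e1 Ye0]) auto
    also have "\<dots> \<le> 4 * D * exp (- l * (real t - real s))" using l D by (simp add: mult_left_mono)
    finally have 1: "dist (Ul t 0) (outer (e t)) \<le> 4 * D * exp (- l * (real t - real s))" .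
    have "dist (Ul t s) (Ul t 0) \<le> C1 * (exp (- l * (real t - real s)) - exp (- l * (real t - real 0)))"
      using that by (intro U_converges) auto
    also have "\<dots> \<le> C1 * exp (- l * (real t - real s))" using C1 by (intro mult_left_mono) auto
    finally show ?thesis using 1 dist_triangle[of "Ul t s" "outer (e t)" "Ul t 0"]
      by (simp add: algebra_simps)
  qed
  define p where "p t v = v - (e t \<bullet> v) *\<^sub>R e t" for t v
  have p_norm: "(norm (p t v))\<^sup>2 = (norm v)\<^sup>2 - (e t \<bullet> v)\<^sup>2" if "t \<le> N" for t v
    unfolding power2_norm_eq_inner using e1[OF that]
    by (simp add: p_def inner_diff_left inner_diff_right norm_eq_1 inner_commute power2_eq_square)
  have p_le: "norm (p t v) \<le> norm v" if "t \<le> N" for t v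
    by (rule power2_le_imp_le) (use p_norm[OF that, of v] in auto)
  have pU: "norm (p t (U t s)) \<le> (C1 + 4 * D) * exp (- l * (real t - real s))" if "m \<le> s" "s < t" "t \<le> N" for s t
  proof -
    have u1: "norm (U t s) = 1" using UW[OF that(2,3)] by (rule near_rank_one_unit(1))
    have "(norm (p t (U t s)))\<^sup>2 \<le> (dist (Ul t s) (outer (e t)))\<^sup>2"
      unfolding p_norm[OF that(3)] dist_outer[OF u1 e1[OF that(3)]] u1
      using abs_inner_le_1[OF u1 e1[OF that(3)]] by (simp add: inner_commute abs_square_le_1)
    hence "norm (p t (U t s)) \<le> dist (Ul t s) (outer (e t))" by (rule power2_le_imp_le) simp
    thus ?thesis using near[OF that] by simp
  qed
  have plin: "bounded_linear (\<lambda>v. p t (Y t m *v v))" for t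
    unfolding p_def by (intro bounded_linear_intros bounded_linear_sub
      bounded_linear_compose[OF bounded_linear_scaleR_left] bounded_linear_compose[OF bounded_linear_inner_right]) simp_all
  \<comment> \<open>\<open>nn t\<close> measures the part of \<open>Y t m\<close> that lands outside
    the line of \<open>e t\<close>.\<close>
  define nn where "nn t = onorm (\<lambda>v. p t (Y t m *v v))" for t
  have nn: "norm (p t (Y t m *v v)) \<le> nn t * norm v" for t v
    unfolding nn_def by (rule onorm[OF plin])
  have nn0: "0 \<le> nn t" for t unfolding nn_def by (rule onorm_pos_le[OF plin])
  have nn_le: "nn t \<le> opn (Y t m)" if "t \<le> N" for t
    unfolding nn_def by (rule onorm_le) (meson p_le[OF that] opn order_trans)
  have comp_bound: "nn t \<le> C3 * exp (- l * (real t - real m)) * opn (Y t m)" if "m < t" "t \<le> N" for t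
    unfolding nn_def
  proof (rule onorm_le)
    fix v
    let ?c = "opn (Y t m) * (W t m \<bullet> v)" and ?x = "exp (- l * (real t - real m))"
    have wv: "\<bar>W t m \<bullet> v\<bar> \<le> norm v"
      using Cauchy_Schwarz_ineq2[of "W t m" v] near_rank_one_unit(2)[OF UW] that by simp
    have "p t (Y t m *v v) = ?c *\<^sub>R p t (U t m) + p t (Y t m *v v - ?c *\<^sub>R U t m)"
      by (simp add: p_def inner_diff_right algebra_simps)
    from arg_cong[OF this, of norm]
    have "norm (p t (Y t m *v v)) \<le> norm (?c *\<^sub>R p t (U t m)) + norm (p t (Y t m *v v - ?c *\<^sub>R U t m))"
      by (simp only: norm_triangle_ineq)
    also have "\<dots> \<le> opn (Y t m) * norm v * ((C1 + 4 * D) * ?x) + D * ?x * opn (Y t m) * norm v"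
    proof (rule add_mono)
      have "norm (?c *\<^sub>R p t (U t m)) = opn (Y t m) * \<bar>W t m \<bullet> v\<bar> * norm (p t (U t m))"
        using opn_nonneg[of "Y t m"] by (simp add: abs_mult)
      also have "\<dots> \<le> opn (Y t m) * norm v * ((C1 + 4 * D) * ?x)"
        using pU[of m t] that wv opn_nonneg[of "Y t m"] by (intro mult_mono) auto
      finally show "norm (?c *\<^sub>R p t (U t m)) \<le> opn (Y t m) * norm v * ((C1 + 4 * D) * ?x)" .
      show "norm (p t (Y t m *v v - ?c *\<^sub>R U t m)) \<le> D * ?x * opn (Y t m) * norm v"
        using p_le[OF that(2)] near_rank_one_approx[OF UW[of m t], of v] that order_trans by blast
    qed
    finally show "norm (p t (Y t m *v v)) \<le> C3 * ?x * opn (Y t m) * norm v" by (simp add: C3_def algebra_simps)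
  qed
  \<comment> \<open>\<open>b t * S t\<close> will bound \<open>opn (Y t m)\<close>. The term
    \<open>1 / b m\<close> stands for the component on the line at time \<open>m\<close>; each
    summand bounds what the complement feeds into the line in one step, with one \<open>K\<close>
    for the step and one for \<open>b j \<le> K * b (Suc j)\<close>.\<close>
  define S where "S t = 1 / b m + K\<^sup>2 * (\<Sum>j=m..t. nn j / b j)" for t
  have S_Suc: "S (Suc t) = S t + K\<^sup>2 * (nn (Suc t) / b (Suc t))" if "m \<le> t" for t
    using that by (simp add: S_def algebra_simps)
  \<comment> \<open>The sum stops before \<open>t\<close>, since the complement at time
    \<open>t\<close> reaches the line only in the next step. The summand \<open>j = t\<close> of
    \<open>S t\<close> will pay for that complement itself.\<close>
  have line: "\<bar>e t \<bullet> (Y t m *v v)\<bar> / b t \<le> norm v * (1 / b m + K\<^sup>2 * (\<Sum>j=m..<t. nn j / b j))"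
    if "m \<le> t" "t \<le> N" for t v
    using that
  proof (induction t rule: dec_induct)
    case base
    have "\<bar>e m \<bullet> v\<bar> \<le> norm v" using Cauchy_Schwarz_ineq2[of "e m" v] e1[of m] m by simp
    thus ?case using bpos[of m] m by (simp add: refl divide_right_mono)
  next
    case (step t)
    have tN: "t \<le> N" "t < N" using step by auto
    let ?y = "Y t m *v v" and ?A = "Y (Suc t) t"
    have "Y (Suc t) m *v v = ?A *v ?y" using cocycle[of m t "Suc t"] step by (simp add: matrix_vector_mul_assoc)
    also have "\<dots> = (e t \<bullet> ?y) *\<^sub>R (?A *v e t) + ?A *v p t ?y"
      by (simp add: p_def matrix_vector_mult_diff_distrib matrix_vector_mult_scaleR)
    also have "?A *v e t = (b (Suc t) / b t) *\<^sub>R e (Suc t)" using Ye step by simp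
    finally have "e (Suc t) \<bullet> (Y (Suc t) m *v v) = (e t \<bullet> ?y) * (b (Suc t) / b t) + e (Suc t) \<bullet> (?A *v p t ?y)"
      using e1[of "Suc t"] step by (simp add: inner_add_right norm_eq_1)
    hence "\<bar>e (Suc t) \<bullet> (Y (Suc t) m *v v)\<bar> \<le> \<bar>(e t \<bullet> ?y) * (b (Suc t) / b t)\<bar> + \<bar>e (Suc t) \<bullet> (?A *v p t ?y)\<bar>"
      by (simp only: abs_triangle_ineq)
    also have "\<dots> \<le> \<bar>e t \<bullet> ?y\<bar> * (b (Suc t) / b t) + K * (nn t * norm v)"
    proof (rule add_mono)
      show "\<bar>(e t \<bullet> ?y) * (b (Suc t) / b t)\<bar> \<le> \<bar>e t \<bullet> ?y\<bar> * (b (Suc t) / b t)"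
        using bpos[of t] bpos[of "Suc t"] step by (simp add: abs_mult)
      have "\<bar>e (Suc t) \<bullet> (?A *v p t ?y)\<bar> \<le> norm (?A *v p t ?y)"
        using Cauchy_Schwarz_ineq2[of "e (Suc t)"] e1[of "Suc t"] step by (metis mult_1)
      also have "\<dots> \<le> opn ?A * norm (p t ?y)" by (rule opn)
      also have "\<dots> \<le> K * (nn t * norm v)"
        using unit_step(1)[OF tN(2)] nn[of t v] K by (intro mult_mono) auto
      finally show "\<bar>e (Suc t) \<bullet> (?A *v p t ?y)\<bar> \<le> K * (nn t * norm v)" .
    qed
    finally have "\<bar>e (Suc t) \<bullet> (Y (Suc t) m *v v)\<bar> / b (Suc t)
       \<le> (\<bar>e t \<bullet> ?y\<bar> * (b (Suc t) / b t) + K * (nn t * norm v)) / b (Suc t)"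
      using bpos[of "Suc t"] step by (intro divide_right_mono) auto
    also have "\<dots> = \<bar>e t \<bullet> ?y\<bar> / b t + K * (nn t * norm v) / b (Suc t)"
      using bpos[of "Suc t"] step by (simp add: add_divide_distrib)
    also have "\<dots> \<le> norm v * (1 / b m + K\<^sup>2 * (\<Sum>j=m..<t. nn j / b j)) + K\<^sup>2 * (nn t / b t) * norm v"
    proof (rule add_mono)
      show "\<bar>e t \<bullet> ?y\<bar> / b t \<le> norm v * (1 / b m + K\<^sup>2 * (\<Sum>j=m..<t. nn j / b j))" using step by simp
      have "1 / b (Suc t) \<le> K / b t"
        using bstep[OF tN(2)] bpos[of t] bpos[of "Suc t"] step by (simp add: field_simps)
      hence "K * (nn t * norm v) * (1 / b (Suc t)) \<le> K * (nn t * norm v) * (K / b t)"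
        using nn0 K by (intro mult_left_mono) auto
      thus "K * (nn t * norm v) / b (Suc t) \<le> K\<^sup>2 * (nn t / b t) * norm v"
        by (simp add: power2_eq_square ac_simps)
    qed
    also have "\<dots> = norm v * (1 / b m + K\<^sup>2 * (\<Sum>j=m..<Suc t. nn j / b j))"
      using step by (simp add: algebra_simps)
    finally show ?case .
  qed
  have opn_le_S: "opn (Y t m) \<le> b t * S t" if "m \<le> t" "t \<le> N" for t
  proof (rule opn_le)
    fix v
    let ?y = "Y t m *v v"
    have "norm ?y \<le> norm ((e t \<bullet> ?y) *\<^sub>R e t) + norm (p t ?y)"
      unfolding p_def using norm_triangle_ineq[of "(e t \<bullet> ?y) *\<^sub>R e t" "?y - (e t \<bullet> ?y) *\<^sub>R e t"] by simp
    also have "\<dots> \<le> b t * (\<bar>e t \<bullet> ?y\<bar> / b t) + nn t * norm v"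
      using e1[of t] nn[of t v] bpos[of t] that by simp
    also have "\<dots> \<le> b t * (norm v * (1 / b m + K\<^sup>2 * (\<Sum>j=m..<t. nn j / b j))) + b t * (K\<^sup>2 * (nn t / b t) * norm v)"
    proof (intro add_mono mult_left_mono line that)
      have "1 * (nn t * norm v) \<le> K\<^sup>2 * (nn t * norm v)"
        using K nn0 by (intro mult_right_mono) auto
      thus "nn t * norm v \<le> b t * (K\<^sup>2 * (nn t / b t) * norm v)" using bpos[of t] that by simp
    qed (use bpos[of t] that in auto)
    also have "\<dots> = b t * S t * norm v"
    proof -
      have "{m..t} = insert t {m..<t}" using that by auto
      thus ?thesis by (simp add: S_def algebra_simps)
    qed
    finally show "norm ?y \<le> b t * S t * norm v" .
  qed
  have Spos: "0 \<le> S t" if "t \<le> N" for t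
    unfolding S_def using bpos[of m] m nn0 bpos that by (intro add_nonneg_nonneg mult_nonneg_nonneg sum_nonneg divide_nonneg_nonneg) (auto intro!: less_imp_le[OF bpos])
  \<comment> \<open>The recursion is run from time \<open>m\<close> on. The crude factor is
    \<open>1 + K ^ 4\<close> because \<open>nn\<close> over \<open>b\<close> at the next time is at
    most \<open>K\<^sup>2\<close> times the current \<open>S\<close>, and the feedback carries
    another \<open>K\<^sup>2\<close>. The sharp inequality combines \<open>comp_bound\<close> with
    \<open>opn_le_S\<close>.\<close>
  have "S (m + (N - m)) \<le> R * S (m + 0)"
  proof (rule R(2)[of "N - m" "\<lambda>t. S (m + t)"], intro allI impI, goal_cases)
    case (1 t) thus ?case using m by (intro Spos) auto
  next
    show "\<forall>t<N - m. S (m + Suc t) \<le> (1 + K ^ 4) * S (m + t)"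
    proof (intro allI impI)
      fix t assume "t < N - m"
      hence t: "m + t < N" "m + t \<le> N" "Suc (m + t) \<le> N" by auto
      have "nn (Suc (m + t)) \<le> opn (Y (Suc (m + t)) m)" using t by (intro nn_le) auto
      also have "\<dots> = opn (Y (Suc (m + t)) (m + t) ** Y (m + t) m)" using cocycle[of m "m + t" "Suc (m + t)"] t by simp
      also have "\<dots> \<le> opn (Y (Suc (m + t)) (m + t)) * opn (Y (m + t) m)" by (rule opn_mult)
      also have "\<dots> \<le> K * (b (m + t) * S (m + t))"
        using unit_step(1)[OF t(1)] opn_le_S[of "m + t"] t K opn_nonneg by (intro mult_mono) auto
      also have "\<dots> \<le> K * (K * b (Suc (m + t)) * S (m + t))"
        using bstep[OF t(1)] Spos[of "m + t"] t K by (intro mult_left_mono mult_right_mono) auto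
      finally have "nn (Suc (m + t)) / b (Suc (m + t)) \<le> K\<^sup>2 * S (m + t)"
        using bpos[of "Suc (m + t)"] t by (simp add: field_simps power2_eq_square)
      hence "K\<^sup>2 * (nn (Suc (m + t)) / b (Suc (m + t))) \<le> K\<^sup>2 * (K\<^sup>2 * S (m + t))"
        by (intro mult_left_mono) auto
      thus "S (m + Suc t) \<le> (1 + K ^ 4) * S (m + t)"
        using S_Suc[of "m + t"] by (simp add: algebra_simps power2_eq_square power4_eq_xxxx)
    qed
    show "\<forall>t<N - m. S (m + Suc t) \<le> S (m + t) + K\<^sup>2 * C3 * exp (- l * real (Suc t)) * S (m + Suc t)"
    proof (intro allI impI)
      fix t assume "t < N - m"
      hence t: "m < Suc (m + t)" "Suc (m + t) \<le> N" by auto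
      let ?x = "exp (- l * real (Suc t))"
      have C3: "0 \<le> C3" using C1 D by (simp add: C3_def)
      have "nn (Suc (m + t)) \<le> C3 * exp (- l * (real (Suc (m + t)) - real m)) * opn (Y (Suc (m + t)) m)"
        by (rule comp_bound[OF t])
      also have "\<dots> = C3 * ?x * opn (Y (Suc (m + t)) m)" by simp
      also have "\<dots> \<le> C3 * ?x * (b (Suc (m + t)) * S (Suc (m + t)))"
        using opn_le_S[of "Suc (m + t)"] t C3 by (intro mult_left_mono) auto
      finally have "nn (Suc (m + t)) / b (Suc (m + t)) \<le> C3 * ?x * S (Suc (m + t))"
        using bpos[OF t(2)] by (simp add: pos_divide_le_eq ac_simps)
      hence "K\<^sup>2 * (nn (Suc (m + t)) / b (Suc (m + t))) \<le> K\<^sup>2 * (C3 * ?x * S (Suc (m + t)))"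
        by (intro mult_left_mono) auto
      thus "S (m + Suc t) \<le> S (m + t) + K\<^sup>2 * C3 * ?x * S (m + Suc t)"
        using S_Suc[of "m + t"] by (simp add: mult.assoc)
    qed
  qed
  hence SN: "S N \<le> R * S m" using m by simp
  \<comment> \<open>\<open>Y m m\<close> is the identity, so \<open>S m\<close> is of order
    \<open>1 / b m\<close>; this is the origin of the factor \<open>opn (Y m 0)\<close> in the
    claim.\<close>
  have "nn m \<le> 1"
  proof -
    have "opn (Y m m) \<le> 1" by (rule opn_le) (use m in \<open>simp add: refl\<close>)
    thus ?thesis using nn_le[of m] m by simp
  qed
  hence "nn m / b m \<le> 1 / b m" using bpos[of m] m by (intro divide_right_mono) auto
  hence Sm: "S m \<le> (1 + K\<^sup>2) / b m"
    using mult_left_mono[of "nn m / b m" "1 / b m" "K\<^sup>2"] by (simp add: S_def add_divide_distrib)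
  have bm: "b m = opn (Y m 0)"
    using UW[of 0 m] m opn_nonneg[of "Y m 0"] unfolding b_def x_def by (simp add: near_rank_one_def)
  have bN: "b N \<le> opn (Y N 0)" using opn[of "Y N 0" x] x1 by (simp add: b_def)
  have "opn (Y N m) \<le> b N * S N" using opn_le_S[of N] m by simp
  also have "\<dots> \<le> b N * (R * ((1 + K\<^sup>2) / b m))"
    using SN Sm R(1) bpos[of N] by (intro mult_left_mono order_trans[OF SN]) auto
  finally have "opn (Y N m) * b m \<le> b N * (R * (1 + K\<^sup>2))"
    using bpos[of m] m by (simp add: field_simps)
  also have "\<dots> \<le> opn (Y N 0) * (R * (1 + K\<^sup>2))" using bN R(1) by (intro mult_right_mono) auto
  finally show ?thesis unfolding bm by (simp add: ac_simps)
qed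

text \<open>Moving the cut by one step costs at most \<open>K\<close> on either side. The loss grows
  with \<open>m\<close>, so this serves the boundedly many \<open>m\<close> that are too small for
  \<open>norm_supermultiplicative_large\<close>.\<close>

lemma norm_supermultiplicative_small:
  assumes "m \<le> N"
  shows "opn (Y N m) * opn (Y m 0) \<le> K ^ (2 * m) * opn (Y N 0)"
  using assms
proof (induction m)
  case 0
  have "opn (mat 1 :: real^'n^'n) \<le> 1" by (rule opn_le) simp
  from mult_left_mono[OF this opn_nonneg[of "Y N 0"]] show ?case by (simp add: refl del: matrix_vector_mul_lid)
next
  case (Suc m)
  have "Y N m = Y N (Suc m) ** Y (Suc m) m" using cocycle[of m "Suc m" N] Suc by simp
  hence "Y N m ** Z m = Y N (Suc m)" using unit_step(3)[of m] Suc by (simp add: matrix_mul_assoc[symmetric])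
  hence "opn (Y N (Suc m)) \<le> opn (Y N m) * opn (Z m)" by (metis opn_mult)
  also have "\<dots> \<le> opn (Y N m) * K" using unit_step(2)[of m] Suc by (intro mult_left_mono opn_nonneg) auto
  finally have 1: "opn (Y N (Suc m)) \<le> opn (Y N m) * K" .
  have "opn (Y (Suc m) 0) \<le> opn (Y (Suc m) m) * opn (Y m 0)" 
    using cocycle[of 0 m "Suc m"] Suc.prems opn_mult[of "Y (Suc m) m" "Y m 0"] by simp
  also have "\<dots> \<le> K * opn (Y m 0)" using unit_step(1)[of m] Suc by (intro mult_right_mono opn_nonneg) auto
  finally have 2: "opn (Y (Suc m) 0) \<le> K * opn (Y m 0)" .
  have "opn (Y N (Suc m)) * opn (Y (Suc m) 0) \<le> (opn (Y N m) * K) * (K * opn (Y m 0))"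
    using 1 2 K opn_nonneg by (intro mult_mono) auto
  also have "\<dots> = K\<^sup>2 * (opn (Y N m) * opn (Y m 0))" by (simp add: power2_eq_square ac_simps)
  also have "\<dots> \<le> K\<^sup>2 * (K ^ (2 * m) * opn (Y N 0))" using Suc by (intro mult_left_mono) auto
  also have "\<dots> = K ^ (2 * Suc m) * opn (Y N 0)" by (simp add: power2_eq_square ac_simps)
  finally show ?case .
qed

end

text \<open>The order of the quantifiers is the point: one \<open>c\<close>, chosen from
  \<open>K\<close>, \<open>D\<close>, \<open>l\<close>, serves every cocycle, every horizon and
  every cut.\<close>

theorem gap_cocycle_norm_supermultiplicative:
  fixes K D l :: real
  assumes K: "1 \<le> K" and D: "0 \<le> D" and l: "0 < l"
  shows "\<exists>c>0. \<forall>(Y :: nat \<Rightarrow> nat \<Rightarrow> 'n::finite mat) Z N m. gap_cocycle Y Z N K D l \<longrightarrow> m \<le> N \<longrightarrow>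
           c * (opn (Y N m) * opn (Y m 0)) \<le> opn (Y N 0)"
proof -
  define c1 where "c1 = 2 * K\<^sup>2 * D / (1 - exp (- l))"
  define c3 where "c3 = c1 + 5 * D"
  have c1: "0 \<le> c1" using D l by (simp add: c1_def)
  have c3: "0 \<le> c3" using c1 D by (simp add: c3_def)
  obtain R where R: "1 \<le> R" "\<And>S n. (\<forall>t\<le>n. 0 \<le> S t) \<Longrightarrow> (\<forall>t<n. S (Suc t) \<le> (1 + K^4) * S t) \<Longrightarrow>
     (\<forall>t<n. S (Suc t) \<le> S t + K\<^sup>2 * c3 * exp (- l * real (Suc t)) * S (Suc t)) \<Longrightarrow> S n \<le> R * (S 0 :: real)"
    using self_improving_growth_bounded[of "1 + K^4" "K\<^sup>2 * c3" l] K c3 l by auto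
  have "eventually (\<lambda>n. c1 * exp (- l * real n) < 1 / 2) sequentially"
    by (rule order_tendstoD(2)[OF exp_seq_tendsto_0[OF l]]) simp
  then obtain m0 where m0: "\<And>n. n \<ge> m0 \<Longrightarrow> c1 * exp (- l * real n) < 1 / 2"
    by (auto simp: eventually_sequentially)
  define M where "M = R * (1 + K\<^sup>2) + K ^ (2 * Suc m0)"
  have M: "0 < M" "R * (1 + K\<^sup>2) \<le> M" "K ^ (2 * Suc m0) \<le> M"
    using R(1) K by (auto simp: M_def intro!: add_pos_pos mult_pos_pos add_pos_nonneg)
  have "(1 / M) * (opn (Y N m) * opn (Y m 0)) \<le> opn (Y N 0)"
    if coc: "gap_cocycle Y Z N K D l" and m: "m \<le> N" for Y :: "nat \<Rightarrow> nat \<Rightarrow> 'n mat" and Z N m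
  proof -
    interpret gap_cocycle Y Z N K D l by (rule coc)
    have eq: "local.C1 = c1" "local.C3 = c3"
      by (simp_all add: c3_def c1_def local.C1_def local.C3_def)
    have "opn (Y N m) * opn (Y m 0) \<le> M * opn (Y N 0)"
    proof (cases "m \<ge> Suc m0")
      case True
      hence "opn (Y N m) * opn (Y m 0) \<le> R * (1 + K\<^sup>2) * opn (Y N 0)"
        using m0[of m] m R(1) by (intro norm_supermultiplicative_large R(1)) (auto simp: eq intro!: R(2))
      also have "\<dots> \<le> M * opn (Y N 0)" using M by (intro mult_right_mono opn_nonneg)
      finally show ?thesis .
    next
      case False
      have "opn (Y N m) * opn (Y m 0) \<le> K ^ (2 * m) * opn (Y N 0)" by (rule norm_supermultiplicative_small[OF m])
      also have "\<dots> \<le> K ^ (2 * Suc m0) * opn (Y N 0)"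
        using False K by (intro mult_right_mono power_increasing opn_nonneg) auto
      also have "\<dots> \<le> M * opn (Y N 0)" using M by (intro mult_right_mono opn_nonneg)
      finally show ?thesis .
    qed
    thus ?thesis using M(1) by (simp add: field_simps)
  qed
  thus ?thesis using M(1) by (intro exI[of _ "1 / M"]) auto
qed

section \<open>Word length\<close>

lemma matrix_inv_unique:
  fixes A B :: "'a::semiring_1^'n^'n"
  assumes "A ** B = mat 1" "B ** A = mat 1"
  shows "matrix_inv A = B"
proof -
  have "invertible A" using assms by (auto simp: invertible_def)
  hence "matrix_inv A ** A = mat 1" unfolding invertible_def matrix_inv_def by (rule someI2_ex) auto
  have "matrix_inv A = matrix_inv A ** (A ** B)" by (simp add: assms)
  also have "\<dots> = B" unfolding matrix_mul_assoc by (simp add: \<open>matrix_inv A ** A = mat 1\<close>)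
  finally show ?thesis .
qed

lemma matrix_inv_inv: "invertible A \<Longrightarrow> matrix_inv (matrix_inv A) = (A :: real^'n^'n)"
  by (intro matrix_inv_unique) auto

lemma invertible_matrix_inv: "invertible A \<Longrightarrow> invertible (matrix_inv A :: real^'n^'n)"
  unfolding invertible_def[of "matrix_inv A"] by (intro exI[of _ A]) auto

lemma matrix_inv_mult:
  fixes A B :: "real^'n^'n"
  assumes "invertible A" "invertible B"
  shows "matrix_inv (A ** B) = matrix_inv B ** matrix_inv A"
proof (rule matrix_inv_unique)
  have "A ** B ** (matrix_inv B ** matrix_inv A) = A ** (B ** matrix_inv B) ** matrix_inv A"
    by (simp only: matrix_mul_assoc)
  thus "A ** B ** (matrix_inv B ** matrix_inv A) = mat 1" using assms by simp
  have "matrix_inv B ** matrix_inv A ** (A ** B) = matrix_inv B ** (matrix_inv A ** A) ** B"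
    by (simp only: matrix_mul_assoc)
  thus "matrix_inv B ** matrix_inv A ** (A ** B) = mat 1" using assms by simp
qed

lemma matrix_inv_1: "matrix_inv (mat 1) = (mat 1 :: real^'n^'n)"
  by (rule matrix_inv_unique) auto

lemma word_prod_Nil [simp]: "word_prod [] = mat 1"
  by (simp add: word_prod_def)

lemma word_prod_Cons [simp]: "word_prod (a # ws) = a ** word_prod ws"
  by (simp add: word_prod_def)

lemma word_prod_append: "word_prod (xs @ ys) = word_prod xs ** word_prod ys"
  by (induction xs) (auto simp: matrix_mul_assoc)

lemma mpow_add: "mpow g (m + n) = mpow g m ** mpow g n"
  by (induction m) (auto simp: matrix_mul_assoc)

locale SL_generators =
  fixes S :: "'n::finite mat set"
  assumes finS: "finite S" and SSL: "S \<subseteq> SL"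
begin

abbreviation "\<Gamma> \<equiv> generated S"
abbreviation "wl \<equiv> word_length S"
abbreviation "gp \<equiv> gromov_prod S"

definition "T = S \<union> matrix_inv ` S"

lemma SL_inv: "g \<in> SL \<Longrightarrow> matrix_inv g \<in> SL" for g :: "'n mat"
proof -
  assume g: "g \<in> SL"
  hence "det (g ** matrix_inv g) = 1" using SL_invertible[OF g] by simp
  thus ?thesis using g by (simp add: SL_def det_mul)
qed

lemma T_SL: "T \<subseteq> SL" unfolding T_def using SSL SL_inv by auto

lemma T_inv: "s \<in> T \<Longrightarrow> matrix_inv s \<in> T"
  unfolding T_def using SSL by (auto simp: matrix_inv_inv SL_invertible subset_eq)

lemma finite_T: "finite T" unfolding T_def using finS by simp

lemma gen_words_iff: "ws \<in> gen_words S \<longleftrightarrow> set ws \<subseteq> T" by (simp add: gen_words_def T_def)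

lemma word_prod_SL: "set ws \<subseteq> T \<Longrightarrow> word_prod ws \<in> SL"
  using T_SL by (induction ws) (auto simp: SL_def det_mul)

lemma word_prod_in: "set ws \<subseteq> T \<Longrightarrow> word_prod ws \<in> \<Gamma>"
  by (auto simp: generated_def gen_words_iff)

lemma \<Gamma>_word: "g \<in> \<Gamma> \<Longrightarrow> \<exists>ws. set ws \<subseteq> T \<and> word_prod ws = g"
  unfolding generated_def gen_words_iff[abs_def] by (metis gen_words_iff imageE)

lemma \<Gamma>_SL: "g \<in> \<Gamma> \<Longrightarrow> g \<in> SL" using \<Gamma>_word word_prod_SL by blast

lemma \<Gamma>_invertible: "g \<in> \<Gamma> \<Longrightarrow> invertible g" using \<Gamma>_SL SL_invertible by blast

lemma \<Gamma>_1: "mat 1 \<in> \<Gamma>" using word_prod_in[of "[]"] by simp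

lemma \<Gamma>_mult: "g \<in> \<Gamma> \<Longrightarrow> h \<in> \<Gamma> \<Longrightarrow> g ** h \<in> \<Gamma>"
  using \<Gamma>_word word_prod_in word_prod_append by (metis Un_least set_append)

lemma word_prod_inv: "set ws \<subseteq> T \<Longrightarrow> matrix_inv (word_prod ws) = word_prod (rev (map matrix_inv ws))"
proof (induction ws)
  case Nil thus ?case by (simp add: matrix_inv_1)
next
  case (Cons a ws)
  hence "invertible a" "invertible (word_prod ws)" using T_SL word_prod_SL SL_invertible by auto
  thus ?case using Cons by (simp add: matrix_inv_mult word_prod_append)
qed

lemma set_inv_word: "set ws \<subseteq> T \<Longrightarrow> set (rev (map matrix_inv ws)) \<subseteq> T" using T_inv by auto

lemma \<Gamma>_inv: "g \<in> \<Gamma> \<Longrightarrow> matrix_inv g \<in> \<Gamma>"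
  using \<Gamma>_word word_prod_inv set_inv_word word_prod_in by metis

lemma \<Gamma>_mpow: "g \<in> \<Gamma> \<Longrightarrow> mpow g k \<in> \<Gamma>"
  by (induction k) (auto simp: \<Gamma>_1 \<Gamma>_mult)

lemma inv_mult_cancel [simp]: "g \<in> \<Gamma> \<Longrightarrow> matrix_inv g ** (g ** h) = h" "g \<in> \<Gamma> \<Longrightarrow> g ** (matrix_inv g ** h) = h"
  by (simp_all add: matrix_mul_assoc \<Gamma>_invertible)

lemma wl_word: assumes "g \<in> \<Gamma>" obtains ws where "set ws \<subseteq> T" "length ws = wl g" "word_prod ws = g"
proof -
  have "\<exists>k. \<exists>ws\<in>gen_words S. length ws = k \<and> word_prod ws = g"
    using \<Gamma>_word[OF assms] gen_words_iff by blast
  hence "\<exists>ws\<in>gen_words S. length ws = wl g \<and> word_prod ws = g" unfolding word_length_def by (rule LeastI_ex)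
  thus ?thesis using that by (auto simp: gen_words_iff)
qed

lemma wl_le: "set ws \<subseteq> T \<Longrightarrow> wl (word_prod ws) \<le> length ws"
  unfolding word_length_def by (rule Least_le) (auto simp: gen_words_iff)

lemma wl_1 [simp]: "wl (mat 1) = 0" using wl_le[of "[]"] by simp

lemma wl_mult: assumes "g \<in> \<Gamma>" "h \<in> \<Gamma>" shows "wl (g ** h) \<le> wl g + wl h"
proof -
  obtain a where a: "set a \<subseteq> T" "length a = wl g" "word_prod a = g" using wl_word[OF assms(1)] .
  obtain b where b: "set b \<subseteq> T" "length b = wl h" "word_prod b = h" using wl_word[OF assms(2)] .
  show ?thesis using wl_le[of "a @ b"] a b by (simp add: word_prod_append)
qed

lemma wl_inv_le: assumes "g \<in> \<Gamma>" shows "wl (matrix_inv g) \<le> wl g"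
proof -
  obtain a where a: "set a \<subseteq> T" "length a = wl g" "word_prod a = g" using wl_word[OF assms] .
  show ?thesis using wl_le[OF set_inv_word[OF a(1)]] a word_prod_inv[OF a(1)] by simp
qed

lemma wl_inv: assumes "g \<in> \<Gamma>" shows "wl (matrix_inv g) = wl g"
  using wl_inv_le[OF assms] wl_inv_le[OF \<Gamma>_inv[OF assms]] matrix_inv_inv[OF \<Gamma>_invertible[OF assms]] by simp

lemma finite_ball: "finite {g \<in> \<Gamma>. wl g \<le> n}"
proof -
  have "{g \<in> \<Gamma>. wl g \<le> n} \<subseteq> word_prod ` {ws. set ws \<subseteq> T \<and> length ws \<le> n}"
    using wl_word by (smt (verit) imageI mem_Collect_eq subsetI)
  thus ?thesis using finite_lists_length_le[OF finite_T] finite_subset by blast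
qed

lemma dist_sym: "x \<in> \<Gamma> \<Longrightarrow> y \<in> \<Gamma> \<Longrightarrow> wl (matrix_inv x ** y) = wl (matrix_inv y ** x)"
  using wl_inv[of "matrix_inv x ** y"] by (simp add: \<Gamma>_mult \<Gamma>_inv matrix_inv_mult \<Gamma>_invertible matrix_inv_inv invertible_matrix_inv)

lemma gp_sym: "x \<in> \<Gamma> \<Longrightarrow> y \<in> \<Gamma> \<Longrightarrow> gp x y = gp y x"
  by (simp add: gromov_prod_def dist_sym)

lemma wl_tri: "x \<in> \<Gamma> \<Longrightarrow> y \<in> \<Gamma> \<Longrightarrow> wl y \<le> wl x + wl (matrix_inv x ** y)"
  using wl_mult[of x "matrix_inv x ** y"] by (simp add: \<Gamma>_mult \<Gamma>_inv)

lemma gp_le: "x \<in> \<Gamma> \<Longrightarrow> y \<in> \<Gamma> \<Longrightarrow> gp x y \<le> wl x"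
  using wl_tri[of x y] by (simp add: gromov_prod_def)

lemma gp_le': "x \<in> \<Gamma> \<Longrightarrow> y \<in> \<Gamma> \<Longrightarrow> gp x y \<le> wl y"
  using gp_le gp_sym by metis

lemma gp_self: "x \<in> \<Gamma> \<Longrightarrow> gp x x = wl x"
  by (simp add: gromov_prod_def \<Gamma>_invertible)

text \<open>Translation by \<open>g\<close> keeps the distance between the two points and changes
  each distance to the identity by at most \<open>wl g\<close>.\<close>

lemma gp_translate:
  assumes "g \<in> \<Gamma>" "x \<in> \<Gamma>" "y \<in> \<Gamma>"
  shows "gp x y - wl g \<le> gp (g ** x) (g ** y)"
proof -
  have eq: "matrix_inv (g ** x) ** (g ** y) = matrix_inv x ** y"
    using assms by (simp add: matrix_inv_mult \<Gamma>_invertible matrix_mul_assoc[symmetric])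
  have "wl x \<le> wl g + wl (g ** x)" "wl y \<le> wl g + wl (g ** y)"
    using wl_tri[of "matrix_inv g" x] wl_tri[of "matrix_inv g" y] assms
    by (simp_all add: \<Gamma>_inv wl_inv matrix_inv_inv \<Gamma>_invertible)
  hence "real (wl x) \<le> real (wl g) + real (wl (g ** x))" "real (wl y) \<le> real (wl g) + real (wl (g ** y))"
    by (simp_all flip: of_nat_add)
  thus ?thesis unfolding gromov_prod_def eq by (simp add: field_simps)
qed

text \<open>Seen from \<open>g\<close>, the identity sits at \<open>matrix_inv g\<close>. If
  \<open>h\<close> has bounded product with it, then \<open>g ** h\<close> has the largest possible
  product with \<open>g\<close>, up to a bounded error.\<close>

lemma gp_mult:
  assumes "g \<in> \<Gamma>" "h \<in> \<Gamma>"
  shows "gp (g ** h) g = wl g - gp (matrix_inv g) h"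
proof -
  have "matrix_inv (g ** h) ** g = matrix_inv h"
    using assms by (simp add: matrix_inv_mult \<Gamma>_invertible matrix_mul_assoc[symmetric])
  thus ?thesis using assms by (simp add: gromov_prod_def wl_inv matrix_inv_inv \<Gamma>_invertible field_simps)
qed

section \<open>Operator norm against word length\<close>

lemma generators_bounded: "\<exists>K\<ge>1. \<forall>s\<in>T. opn s \<le> K"
proof -
  have "finite (insert 1 (opn ` T))" using finite_T by simp
  thus ?thesis by (intro exI[of _ "Max (insert 1 (opn ` T))"]) auto
qed

definition "K = (SOME K. K \<ge> 1 \<and> (\<forall>s\<in>T. opn s \<le> K))"

lemma K: "1 \<le> K" "s \<in> T \<Longrightarrow> opn s \<le> K"
  using someI_ex[of "\<lambda>K. K \<ge> 1 \<and> (\<forall>s\<in>T. opn s \<le> K)"] generators_bounded unfolding K_def by auto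

lemma opn_1: "opn (mat 1 :: 'n mat) \<le> 1" by (rule opn_le) simp

lemma opn_word: "set ws \<subseteq> T \<Longrightarrow> opn (word_prod ws) \<le> K ^ length ws"
proof (induction ws)
  case Nil thus ?case using opn_1 by (simp del: matrix_vector_mul_lid)
next
  case (Cons a ws)
  have "opn (a ** word_prod ws) \<le> opn a * opn (word_prod ws)" by (rule opn_mult)
  also have "\<dots> \<le> K * K ^ length ws" using Cons K opn_nonneg by (intro mult_mono) auto
  finally show ?case by simp
qed

lemma opn_wl: "g \<in> \<Gamma> \<Longrightarrow> opn g \<le> K ^ wl g"
  using wl_word opn_word by metis

lemma opn_pos: "g \<in> \<Gamma> \<Longrightarrow> 0 < opn g"
proof -
  assume g: "g \<in> \<Gamma>"
  have "opn (mat 1 :: 'n mat) \<noteq> 0"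
  proof
    assume "opn (mat 1 :: 'n mat) = 0"
    hence "norm (mat 1 *v (axis undefined 1 :: real^'n)) \<le> 0" using opn[of "mat 1 :: 'n mat" "axis undefined 1"] by simp
    thus False by (simp add: axis_eq_0_iff)
  qed
  moreover have "opn (mat 1 :: 'n mat) \<le> opn (matrix_inv g) * opn g"
    using opn_mult[of "matrix_inv g" g] g by (simp add: \<Gamma>_invertible)
  ultimately have "opn g \<noteq> 0" using opn_nonneg[of "mat 1 :: 'n mat"] by auto
  thus ?thesis using opn_nonneg[of g] by simp
qed

end

section \<open>The singular value gap along words\<close>

text \<open>Two geometric series, to the left and to the right of the integer part of
  \<open>t\<close>; rounding \<open>t\<close> costs the factor \<open>exp l\<close>.\<close>

lemma sum_exp_dist_le:
  fixes l t :: real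
  assumes l: "0 < l" and t: "0 \<le> t"
  shows "(\<Sum>k<n::nat. exp (- l * \<bar>real k - t\<bar>)) \<le> 2 * exp l / (1 - exp (- l))"
proof -
  define q where "q = exp (- l)"
  have q: "0 \<le> q" "q < 1" using l by (auto simp: q_def)
  define z where "z = nat \<lfloor>t\<rfloor>"
  have z: "real z \<le> t" "t < real z + 1" using t by (auto simp: z_def)
  have tail: "(\<Sum>k\<in>A. q ^ f k) \<le> 1 / (1 - q)" if "finite A" "inj_on f A" for A and f :: "nat \<Rightarrow> nat"
  proof -
    have "(\<Sum>k\<in>A. q ^ f k) = (\<Sum>i\<in>f ` A. q ^ i)" using that by (simp add: sum.reindex)
    also have "\<dots> \<le> (\<Sum>i. q ^ i)" using q that by (intro sum_le_suminf summable_geometric) auto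
    also have "\<dots> = 1 / (1 - q)" using q by (intro suminf_geometric) auto
    finally show ?thesis .
  qed
  have term_le: "exp (- l * \<bar>real k - t\<bar>) \<le> exp l * q ^ (if k \<le> z then z - k else k - z)" for k
  proof -
    have "real (if k \<le> z then z - k else k - z) \<le> \<bar>real k - t\<bar> + 1" using z by (auto simp: of_nat_diff)
    hence "- l * \<bar>real k - t\<bar> \<le> l + real (if k \<le> z then z - k else k - z) * (- l)"
      using l mult_left_mono[of "real (if k \<le> z then z - k else k - z)" "\<bar>real k - t\<bar> + 1" l] by (simp add: algebra_simps)
    hence "exp (- l * \<bar>real k - t\<bar>) \<le> exp (l + real (if k \<le> z then z - k else k - z) * (- l))" by simp
    thus ?thesis unfolding q_def exp_of_nat_mult[symmetric] exp_add by simp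
  qed
  have "(\<Sum>k<n. exp (- l * \<bar>real k - t\<bar>)) \<le> (\<Sum>k<n. exp l * q ^ (if k \<le> z then z - k else k - z))"
    by (intro sum_mono term_le)
  also have "\<dots> = exp l * (\<Sum>k<n. q ^ (if k \<le> z then z - k else k - z))" by (simp add: sum_distrib_left)
  also have "(\<Sum>k<n. q ^ (if k \<le> z then z - k else k - z))
      = (\<Sum>k\<in>{k. k < n \<and> k \<le> z}. q ^ (z - k)) + (\<Sum>k\<in>{k. k < n \<and> \<not> k \<le> z}. q ^ (k - z))"
    by (simp add: if_distrib[of "\<lambda>x. q ^ x"] sum.If_cases Collect_conj_eq lessThan_def Collect_neg_eq)
  also have "exp l * \<dots> \<le> exp l * (1 / (1 - q) + 1 / (1 - q))"
    by (intro mult_left_mono add_mono tail) (auto simp: inj_on_def)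
  finally show ?thesis by (simp add: q_def mult.commute)
qed

locale anosov_group = SL_generators S for S :: "'n::finite mat set" +
  fixes C C' :: real
  assumes n2: "CARD('n) \<ge> 2" and C: "0 < C"
    and gap: "g \<in> \<Gamma> \<Longrightarrow> C * real (wl g) - C' \<le> mu 1 g - mu 2 g"
begin

definition "sg g = exp (- (mu 1 g - mu 2 g))" for g :: "'n mat"

lemma sg_pos: "0 < sg g" by (simp add: sg_def)

lemma sg_le: "g \<in> \<Gamma> \<Longrightarrow> sg g \<le> exp (C' - C * wl g)"
  using gap[of g] by (simp add: sg_def)

definition "U g = (SOME u. \<exists>w. near_rank_one g (sg g) u w)" for g :: "'n mat"
definition "W g = (SOME w. near_rank_one g (sg g) (U g) w)" for g :: "'n mat"

abbreviation "Ul g \<equiv> outer (U g)"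
abbreviation "Wl g \<equiv> outer (W g)"

lemma UW: "g \<in> \<Gamma> \<Longrightarrow> near_rank_one g (sg g) (U g) (W g)"
  unfolding W_def by (rule someI_ex, unfold U_def, rule someI_ex, unfold sg_def) (rule near_rank_one_SL(1)[OF n2 \<Gamma>_SL])

lemma norm_UW [simp]: "g \<in> \<Gamma> \<Longrightarrow> norm (U g) = 1" "g \<in> \<Gamma> \<Longrightarrow> norm (W g) = 1"
  using UW near_rank_one_unit by blast+

lemma U_generator_step:
  assumes "g \<in> \<Gamma>" "s \<in> T"
  shows "dist (Ul g) (Ul (g ** s)) \<le> 2 * K\<^sup>2 * sg g"
  using assms T_SL K T_inv word_prod_in[of "[s]"] opn_pos sg_pos[of g]
  by (intro top_line_mult_right[OF UW UW, where B' = "matrix_inv s"]) (auto simp: \<Gamma>_mult SL_invertible subset_eq less_imp_le)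

lemma W_generator_step:
  assumes "g \<in> \<Gamma>" "s \<in> T"
  shows "dist (Wl g) (Wl (s ** g)) \<le> 2 * K\<^sup>2 * sg g"
  using assms T_SL K T_inv word_prod_in[of "[s]"] opn_pos sg_pos[of g]
  by (intro top_line_mult_left[OF UW UW, where B' = "matrix_inv s"]) (auto simp: \<Gamma>_mult SL_invertible subset_eq less_imp_le)

lemma U_path:
  assumes "g \<in> \<Gamma>" "set ws \<subseteq> T"
  shows "dist (Ul g) (Ul (g ** word_prod ws)) \<le> (\<Sum>k<length ws. 2 * K\<^sup>2 * sg (g ** word_prod (take k ws)))"
  using assms(2)
proof (induction ws rule: rev_induct)
  case (snoc s ws)
  let ?h = "g ** word_prod ws"
  have "?h \<in> \<Gamma>" using snoc assms by (auto intro: \<Gamma>_mult word_prod_in)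
  hence "dist (Ul ?h) (Ul (?h ** s)) \<le> 2 * K\<^sup>2 * sg ?h" using snoc by (intro U_generator_step) auto
  moreover have "?h ** s = g ** word_prod (ws @ [s])" by (simp add: word_prod_append matrix_mul_assoc)
  ultimately show ?case
    using snoc dist_triangle[of "Ul g" "Ul (g ** word_prod (ws @ [s]))" "Ul ?h"] by simp
qed simp

lemma W_path:
  assumes "g \<in> \<Gamma>" "set ws \<subseteq> T"
  shows "dist (Wl g) (Wl (word_prod ws ** g)) \<le> (\<Sum>k<length ws. 2 * K\<^sup>2 * sg (word_prod (drop (length ws - k) ws) ** g))"
  using assms(2)
proof (induction ws)
  case (Cons s ws)
  let ?h = "word_prod ws ** g"
  have "?h \<in> \<Gamma>" using Cons assms by (auto intro: \<Gamma>_mult word_prod_in)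
  hence "dist (Wl ?h) (Wl (s ** ?h)) \<le> 2 * K\<^sup>2 * sg ?h" using Cons by (intro W_generator_step) auto
  moreover have "s ** ?h = word_prod (s # ws) ** g" by (simp add: matrix_mul_assoc)
  moreover have "(\<Sum>k<length ws. 2 * K\<^sup>2 * sg (word_prod (drop (length (s # ws) - k) (s # ws)) ** g))
     = (\<Sum>k<length ws. 2 * K\<^sup>2 * sg (word_prod (drop (length ws - k) ws) ** g))"
    by (intro sum.cong) (auto simp: Suc_diff_le)
  ultimately show ?case
    using Cons dist_triangle[of "Wl g" "Wl (word_prod (s # ws) ** g)" "Wl ?h"] by simp
qed simp

text \<open>The step factor of \<open>U_generator_step\<close>, the additive constant of the gap
  inequality and the series bound of \<open>sum_exp_dist_le\<close>, multiplied.\<close>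

definition "H = 2 * K\<^sup>2 * exp C' * (2 * exp C / (1 - exp (- C)))"

lemma H: "0 \<le> H" using C K by (simp add: H_def)

text \<open>All points of a geodesic from \<open>x\<close> to \<open>y\<close> are at distance at least \<open>gp x y\<close> from the identity.\<close>

lemma U_hoelder:
  assumes x: "x \<in> \<Gamma>" and y: "y \<in> \<Gamma>"
  shows "dist (Ul x) (Ul y) \<le> H * exp (- C * gp x y)"
proof -
  have xy: "matrix_inv x ** y \<in> \<Gamma>" using x y by (simp add: \<Gamma>_mult \<Gamma>_inv)
  obtain ws where ws: "set ws \<subseteq> T" "length ws = wl (matrix_inv x ** y)" "word_prod ws = matrix_inv x ** y"
    using wl_word[OF xy] .
  define d where "d = length ws"
  \<comment> \<open>The position on the geodesic where the two lower bounds for the distance to the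
    identity, \<open>wl x - k\<close> and \<open>wl y - (d - k)\<close>, agree. Both equal
    \<open>gp x y\<close> there, so together they give
    \<open>gp x y + \<bar>real k - t\<bar>\<close>.\<close>
  define t where "t = (real (wl x) - real (wl y) + real d) / 2"
  have gpe: "gp x y = (real (wl x) + real (wl y) - real d) / 2" by (simp add: gromov_prod_def d_def ws)
  have t: "0 \<le> t" using wl_tri[OF x y] by (simp add: t_def d_def ws)
  have bound: "2 * K\<^sup>2 * sg (x ** word_prod (take k ws)) \<le> 2 * K\<^sup>2 * exp C' * exp (- C * gp x y) * exp (- C * \<bar>real k - t\<bar>)"
    if "k < d" for k
  proof -
    let ?a = "word_prod (take k ws)" and ?b = "word_prod (drop k ws)"
    have sub: "set (take k ws) \<subseteq> T" "set (drop k ws) \<subseteq> T" using ws set_take_subset set_drop_subset by (metis order_trans)+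
    have a: "?a \<in> \<Gamma>" "?b \<in> \<Gamma>" using sub by (auto intro: word_prod_in)
    have p: "x ** ?a \<in> \<Gamma>" using a x by (simp add: \<Gamma>_mult)
    have "wl x \<le> wl (x ** ?a) + wl (matrix_inv ?a)"
      using wl_mult[OF p \<Gamma>_inv[OF a(1)]] a by (simp add: matrix_mul_assoc[symmetric] \<Gamma>_invertible)
    also have "wl (matrix_inv ?a) \<le> k" using wl_inv[OF a(1)] wl_le[OF sub(1)] by simp
    finally have 1: "wl x \<le> wl (x ** ?a) + k" by simp
    have "?a ** ?b = matrix_inv x ** y" using ws(3) by (metis append_take_drop_id word_prod_append)
    hence "y = (x ** ?a) ** ?b" using x by (simp add: matrix_mul_assoc[symmetric])
    hence "wl y \<le> wl (x ** ?a) + wl ?b" using wl_mult[OF p a(2)] by simp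
    also have "wl ?b \<le> d - k" using wl_le[OF sub(2)] by (simp add: d_def)
    finally have "wl y \<le> wl (x ** ?a) + (d - k)" by simp
    hence 2: "real (wl y) \<le> real (wl (x ** ?a)) + real d - real k" using that by linarith
    have "gp x y + \<bar>real k - t\<bar> \<le> wl (x ** ?a)" using 1 2 unfolding gpe t_def by (simp add: field_simps abs_if)
    hence "C' - C * wl (x ** ?a) \<le> C' + (- C * gp x y + - C * \<bar>real k - t\<bar>)"
      using mult_left_mono[of _ _ C] C by (fastforce simp: algebra_simps)
    hence "exp (C' - C * wl (x ** ?a)) \<le> exp (C' + (- C * gp x y + - C * \<bar>real k - t\<bar>))" by simp
    hence "sg (x ** ?a) \<le> exp C' * (exp (- C * gp x y) * exp (- C * \<bar>real k - t\<bar>))"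
      using sg_le[OF p] unfolding exp_add by linarith
    from mult_left_mono[OF this, of "2 * K\<^sup>2"] show ?thesis by (simp add: ac_simps)
  qed
  have "dist (Ul x) (Ul y) \<le> (\<Sum>k<d. 2 * K\<^sup>2 * sg (x ** word_prod (take k ws)))"
    using U_path[OF x ws(1)] x by (simp add: ws d_def)
  also have "\<dots> \<le> (\<Sum>k<d. 2 * K\<^sup>2 * exp C' * exp (- C * gp x y) * exp (- C * \<bar>real k - t\<bar>))"
    by (intro sum_mono bound) auto
  also have "\<dots> = 2 * K\<^sup>2 * exp C' * exp (- C * gp x y) * (\<Sum>k<d. exp (- C * \<bar>real k - t\<bar>))"
    by (simp add: sum_distrib_left)
  also have "\<dots> \<le> 2 * K\<^sup>2 * exp C' * exp (- C * gp x y) * (2 * exp C / (1 - exp (- C)))"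
    by (intro mult_left_mono sum_exp_dist_le C t) auto
  finally show ?thesis by (simp add: H_def ac_simps)
qed

text \<open>If a word is longer than its product by at most \<open>B\<close>, so is every subword,
  since a shortcut inside would shorten the whole. All subproducts then have an exponential gap with
  one constant, and the cocycle estimate applies.\<close>

lemma quasigeodesic_word_norm:
  "\<exists>c>0. \<forall>ws m. set ws \<subseteq> T \<longrightarrow> real (length ws) - B \<le> wl (word_prod ws) \<longrightarrow>
      c * (opn (word_prod (take m ws)) * opn (word_prod (drop m ws))) \<le> opn (word_prod ws)"
proof -
  define D where "D = exp (C' + C * B)"
  obtain c where c: "0 < c" and main: "\<And>(Y :: nat \<Rightarrow> nat \<Rightarrow> 'n mat) Z N m. gap_cocycle Y Z N K D C \<Longrightarrow> m \<le> N \<Longrightarrow>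
           c * (opn (Y N m) * opn (Y m 0)) \<le> opn (Y N 0)"
    using gap_cocycle_norm_supermultiplicative[of K D C, where 'n = 'n] K C unfolding D_def
    by (metis exp_ge_zero)
  have "c * (opn (word_prod (take m ws)) * opn (word_prod (drop m ws))) \<le> opn (word_prod ws)"
    if ws: "set ws \<subseteq> T" and len: "real (length ws) - B \<le> wl (word_prod ws)" and m: "m \<le> length ws" for ws m
  proof -
    define X where "X i j = word_prod (take (j - i) (drop i ws))" for i j
    define N where "N = length ws"
    have sub: "set (take a (drop b ws)) \<subseteq> T" for a b
      using ws by (meson order_trans set_drop_subset set_take_subset)
    have Xin: "X i j \<in> \<Gamma>" for i j unfolding X_def by (intro word_prod_in sub)
    have split: "X i k = X i j ** X j k" if "i \<le> j" "j \<le> k" for i j k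
    proof -
      have "take (k - i) (drop i ws) = take (j - i) (drop i ws) @ take (k - j) (drop j ws)"
        using that take_add[of "j - i" "k - j" "drop i ws"] by simp
      thus ?thesis by (simp add: X_def word_prod_append)
    qed
    have Xwl: "real j - real i - B \<le> wl (X i j)" if "i \<le> j" "j \<le> N" for i j
    proof -
      have "X 0 N = X 0 i ** X i j ** X j N" using split[of 0 i j] split[of 0 j N] that by simp
      hence "wl (X 0 N) \<le> wl (X 0 i) + wl (X i j) + wl (X j N)"
        using wl_mult[of "X 0 i ** X i j" "X j N"] wl_mult[of "X 0 i" "X i j"] Xin \<Gamma>_mult by fastforce
      moreover have "wl (X 0 i) \<le> i" using wl_le[OF sub[of i 0]] by (simp add: X_def min_def split: if_splits)
      moreover have "wl (X j N) \<le> N - j" using wl_le[OF sub[of "N - j" j]] by (simp add: X_def N_def)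
      moreover have "X 0 N = word_prod ws" by (simp add: X_def N_def)
      ultimately show ?thesis using len that by (simp add: N_def of_nat_diff)
    qed
    have unit: "X i (Suc i) = ws ! i" if "i < N" for i
      using that take_Suc_conv_app_nth[of 0 "drop i ws"] by (simp add: X_def N_def)
    \<comment> \<open>Words grow on the right while a cocycle composes on the left; transposing
      reconciles the two and preserves operator norms and \<open>near_rank_one\<close>.\<close>
    define Y where "Y j i = transpose (X i j)" for i j
    define Z where "Z i = transpose (matrix_inv (ws ! i))" for i
    have "gap_cocycle Y Z N K D C"
    proof
      show "Y k i = Y k j ** Y j i" if "i \<le> j" "j \<le> k" for i j k
        by (simp add: Y_def split[OF that] matrix_transpose_mul)
      show "Y i i = mat 1" for i by (simp add: Y_def X_def transpose_mat)
      fix i assume i: "i < N"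
      have T: "ws ! i \<in> T" using i ws by (auto simp: N_def)
      hence inv: "invertible (ws ! i)" using T_SL SL_invertible by blast
      show "opn (Y (Suc i) i) \<le> K" using T K by (simp add: Y_def unit[OF i] opn_transpose)
      show "opn (Z i) \<le> K" using T T_inv K by (simp add: Z_def opn_transpose)
      show "Y (Suc i) i ** Z i = mat 1" "Z i ** Y (Suc i) i = mat 1"
        using inv by (simp_all add: Y_def Z_def unit[OF i] matrix_transpose_mul[symmetric] transpose_mat)
    next
      fix i j assume ij: "i < j" "j \<le> N"
      have "sg (X i j) \<le> exp (C' - C * wl (X i j))" by (rule sg_le[OF Xin])
      also have "\<dots> \<le> exp (C' + C * B + - C * (real j - real i))"
        using Xwl[of i j] ij C mult_left_mono[of "real j - real i - B" "wl (X i j)" C] by (simp add: algebra_simps)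
      finally have "sg (X i j) \<le> D * exp (- C * (real j - real i))" unfolding D_def exp_add[symmetric] .
      from near_rank_one_mono[OF near_rank_one_transpose[OF UW[OF Xin]] this]
      show "\<exists>u w. near_rank_one (Y j i) (D * exp (- C * (real j - real i))) u w" unfolding Y_def by blast
    qed (use K C in \<open>auto simp: D_def\<close>)
    from main[OF this, of m] m show ?thesis
      by (simp add: Y_def opn_transpose X_def N_def mult.commute)
  qed
  moreover have "\<exists>m'\<le>length ws. take m ws = take m' ws \<and> drop m ws = drop m' ws" for m and ws :: "'n mat list"
    by (cases "m \<le> length ws") auto
  ultimately show ?thesis using c by metis
qed

lemma sg_small: assumes "0 < e" shows "\<exists>m. \<forall>g\<in>\<Gamma>. m \<le> wl g \<longrightarrow> sg g < e"
proof -
  have "(\<lambda>n. exp (C' - C * real n)) \<longlonglongrightarrow> 0"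
    using exp_seq_tendsto_0[OF C, of "exp C'"] by (simp add: exp_diff exp_minus divide_inverse)
  hence "eventually (\<lambda>n. exp (C' - C * real n) < e) sequentially" using assms by (rule order_tendstoD)
  then obtain m where "\<And>n. n \<ge> m \<Longrightarrow> exp (C' - C * real n) < e" by (auto simp: eventually_sequentially)
  thus ?thesis using sg_le by (meson le_less_trans)
qed

text \<open>Concatenating geodesic words for \<open>matrix_inv x\<close> and \<open>z\<close> gives
  a word that exceeds the length of its product by \<open>2 * gp x z\<close>. Its norm is almost
  multiplicative, so \<open>top_vectors_inner_ge\<close> makes the singular lines at the junction
  transverse once both ratios are below a quarter of the constant.\<close>

lemma transversality:
  "\<exists>c>0. \<exists>m. \<forall>x\<in>\<Gamma>. \<forall>z\<in>\<Gamma>. gp x z \<le> B \<longrightarrow> m \<le> wl x \<longrightarrow> m \<le> wl z \<longrightarrow> c \<le> \<bar>W (matrix_inv x) \<bullet> U z\<bar>"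
proof -
  obtain c where c: "0 < c" and main: "\<And>ws m. set ws \<subseteq> T \<Longrightarrow> real (length ws) - 2 * B \<le> wl (word_prod ws) \<Longrightarrow>
      c * (opn (word_prod (take m ws)) * opn (word_prod (drop m ws))) \<le> opn (word_prod ws)"
    using quasigeodesic_word_norm[of "2 * B"] by blast
  obtain m where m: "\<And>g. g \<in> \<Gamma> \<Longrightarrow> m \<le> wl g \<Longrightarrow> sg g < min (c / 4) 1" using sg_small[of "min (c / 4) 1"] c by auto
  have "c / 2 \<le> \<bar>W (matrix_inv x) \<bullet> U z\<bar>"
    if x: "x \<in> \<Gamma>" and z: "z \<in> \<Gamma>" and B: "gp x z \<le> B" and mx: "m \<le> wl x" "m \<le> wl z" for x z
  proof -
    have xi: "matrix_inv x \<in> \<Gamma>" "wl (matrix_inv x) = wl x" using x by (auto simp: \<Gamma>_inv wl_inv)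
    obtain a where a: "set a \<subseteq> T" "length a = wl x" "word_prod a = matrix_inv x" using wl_word[OF xi(1)] xi(2) by metis
    obtain b where b: "set b \<subseteq> T" "length b = wl z" "word_prod b = z" using wl_word[OF z] .
    have "c * (opn (matrix_inv x) * opn z) \<le> opn (matrix_inv x ** z)"
      using main[of "a @ b" "length a"] a b B by (simp add: word_prod_append gromov_prod_def)
    hence "c - sg (matrix_inv x) - sg z \<le> \<bar>W (matrix_inv x) \<bullet> U z\<bar>"
      using m[OF z mx(2)] sg_pos[of z] sg_pos[of "matrix_inv x"] opn_pos z xi
      by (intro top_vectors_inner_ge[OF UW UW]) auto
    thus ?thesis using m[OF z mx(2)] m[OF xi(1)] xi mx by simp
  qed
  thus ?thesis using c by (intro exI[of _ "c / 2"]) auto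
qed

end

section \<open>Boundary points and limits of singular lines\<close>

lemma geometric_steps_converge:
  fixes f :: "nat \<Rightarrow> 'a::complete_space"
  assumes step: "\<And>m. dist (f m) (f (Suc m)) \<le> A * q ^ m" and q: "0 \<le> q" "q < 1"
  shows "\<exists>L. f \<longlonglongrightarrow> L \<and> (\<forall>m. dist (f m) L \<le> A / (1 - q) * q ^ m)"
proof -
  have A: "0 \<le> A" using order_trans[OF zero_le_dist step[of 0]] by simp
  have tele: "dist (f m) (f (m + k)) \<le> A / (1 - q) * q ^ m * (1 - q ^ k)" for m k
  proof (induction k)
    case (Suc k)
    have "dist (f m) (f (m + Suc k)) \<le> dist (f m) (f (m + k)) + dist (f (m + k)) (f (Suc (m + k)))"
      by (simp add: dist_triangle)
    also have "\<dots> \<le> A / (1 - q) * q ^ m * (1 - q ^ k) + A * q ^ (m + k)" using Suc step by (intro add_mono)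
    also have "A * q ^ (m + k) = A / (1 - q) * q ^ m * (q ^ k - q ^ Suc k)"
      using q by (simp add: power_add field_simps)
    also have "A / (1 - q) * q ^ m * (1 - q ^ k) + A / (1 - q) * q ^ m * (q ^ k - q ^ Suc k)
        = A / (1 - q) * q ^ m * (1 - q ^ Suc k)" by (simp only: distrib_left[symmetric]) simp
    finally show ?case .
  qed simp
  have bound: "dist (f m) (f n) \<le> A / (1 - q) * q ^ m" if "m \<le> n" for m n
  proof -
    have "dist (f m) (f n) \<le> A / (1 - q) * q ^ m * (1 - q ^ (n - m))" using tele[of m "n - m"] that by simp
    also have "\<dots> \<le> A / (1 - q) * q ^ m * 1" using A q by (intro mult_left_mono) auto
    finally show ?thesis by simp
  qed
  have "(\<lambda>m. A / (1 - q) * q ^ m) \<longlonglongrightarrow> A / (1 - q) * 0" using q by (intro tendsto_intros LIMSEQ_realpow_zero)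
  hence lim0: "(\<lambda>m. A / (1 - q) * q ^ m) \<longlonglongrightarrow> 0" by simp
  have "Cauchy f"
  proof (rule CauchyI')
    fix e :: real assume "0 < e"
    then obtain M where M: "\<And>m. m \<ge> M \<Longrightarrow> A / (1 - q) * q ^ m < e"
      using order_tendstoD(2)[OF lim0] by (auto simp: eventually_sequentially)
    show "\<exists>M. \<forall>m\<ge>M. \<forall>n>m. dist (f m) (f n) < e"
      using M bound by (intro exI[of _ M]) (meson le_less_trans less_imp_le)
  qed
  then obtain L where L: "f \<longlonglongrightarrow> L" using Cauchy_convergent convergent_def by blast
  have "dist (f m) L \<le> A / (1 - q) * q ^ m" for m
    by (rule tendsto_upperbound[OF tendsto_dist[OF tendsto_const L]])
      (use bound in \<open>auto simp: eventually_sequentially intro!: exI[of _ m]\<close>)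
  thus ?thesis using L by blast
qed

context anosov_group
begin

text \<open>\<open>U (matrix_inv g)\<close> is a direction most contracted by \<open>g\<close>, with
  image of norm \<open>1 / opn (matrix_inv g)\<close>. A test vector orthogonal to
  \<open>W g\<close>, available in dimension at least 2, bounds this by \<open>sg g * opn g\<close>,
  while the image has norm at least \<open>opn g\<close> times the pairing with
  \<open>W g\<close>.\<close>

lemma W_inv_orthogonal:
  assumes g: "g \<in> \<Gamma>"
  shows "\<bar>W g \<bullet> U (matrix_inv g)\<bar> \<le> sg g"
proof -
  let ?h = "matrix_inv g"
  have h: "?h \<in> \<Gamma>" using g by (rule \<Gamma>_inv)
  have hp: "0 < opn ?h" "0 < opn g" using g h opn_pos by auto
  have "2 \<le> DIM(real^'n)" using n2 by simp
  then obtain y where y: "y \<noteq> 0" "orthogonal (W g) y" by (rule orthogonal_to_vector_exists)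
  have "norm y = norm (?h *v (g *v y))" using g by (simp add: matrix_vector_mul_assoc \<Gamma>_invertible)
  also have "\<dots> \<le> opn ?h * norm (g *v y)" by (rule opn)
  also have "\<dots> \<le> opn ?h * (opn g * (\<bar>W g \<bullet> y\<bar> + sg g * norm y))"
    using hp by (intro mult_left_mono near_rank_one_norm_le[OF UW[OF g]]) auto
  also have "\<dots> = (opn ?h * opn g * sg g) * norm y" using y by (simp add: orthogonal_def)
  finally have 1: "1 \<le> opn ?h * opn g * sg g" using y by simp
  have "?h *v W ?h = opn ?h *\<^sub>R U ?h" using UW[OF h] by (simp add: near_rank_one_def)
  hence "g *v (?h *v W ?h) = opn ?h *\<^sub>R (g *v U ?h)" by (simp add: matrix_vector_mult_scaleR)
  hence "W ?h = opn ?h *\<^sub>R (g *v U ?h)" using g by (simp add: matrix_vector_mul_assoc \<Gamma>_invertible)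
  from arg_cong[OF this, of norm] have 2: "1 = opn ?h * norm (g *v U ?h)" using h hp by simp
  have "opn ?h * (opn g * \<bar>W g \<bullet> U ?h\<bar>) \<le> opn ?h * norm (g *v U ?h)"
    using hp by (intro mult_left_mono near_rank_one_norm_ge[OF UW[OF g]]) auto
  hence "(opn ?h * opn g) * \<bar>W g \<bullet> U ?h\<bar> \<le> (opn ?h * opn g) * sg g" using 1 2 by (simp add: mult.assoc)
  moreover have "0 < opn ?h * opn g" using hp by simp
  ultimately show ?thesis by (simp only: mult_le_cancel_left_pos)
qed

text \<open>\<open>W (matrix_inv x)\<close> is almost orthogonal to \<open>U x\<close> but
  transverse to \<open>U z\<close>, so it tells the two lines apart; the constant is c^2 -
  (c/2)^2.\<close>

lemma separation:
  "\<exists>c>0. \<exists>m. \<forall>x\<in>\<Gamma>. \<forall>z\<in>\<Gamma>. gp x z \<le> B \<longrightarrow> m \<le> wl x \<longrightarrow> m \<le> wl z \<longrightarrow> c \<le> dist (Ul x) (Ul z)"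
proof -
  obtain c m where c: "0 < c" and m: "\<And>x z. x \<in> \<Gamma> \<Longrightarrow> z \<in> \<Gamma> \<Longrightarrow> gp x z \<le> B \<Longrightarrow> m \<le> wl x \<Longrightarrow> m \<le> wl z \<Longrightarrow> c \<le> \<bar>W (matrix_inv x) \<bullet> U z\<bar>"
    using transversality[of B] by blast
  obtain m' where m': "\<And>g. g \<in> \<Gamma> \<Longrightarrow> m' \<le> wl g \<Longrightarrow> sg g < c / 2" using sg_small[of "c / 2"] c by auto
  have "3 * c\<^sup>2 / 4 \<le> dist (Ul x) (Ul z)"
    if x: "x \<in> \<Gamma>" and z: "z \<in> \<Gamma>" and "gp x z \<le> B" and xm: "max m m' \<le> wl x" "max m m' \<le> wl z" for x z
  proof -
    let ?w = "W (matrix_inv x)"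
    have xi: "matrix_inv x \<in> \<Gamma>" using x by (rule \<Gamma>_inv)
    have "c \<le> \<bar>U z \<bullet> ?w\<bar>" using m[OF x z] that by (simp add: inner_commute)
    hence 1: "c\<^sup>2 \<le> (U z \<bullet> ?w)\<^sup>2" using c by (metis abs_le_square_iff abs_of_pos)
    have "\<bar>U x \<bullet> ?w\<bar> \<le> c / 2"
      using W_inv_orthogonal[OF xi] m'[OF xi] xm x
      by (simp add: matrix_inv_inv \<Gamma>_invertible wl_inv inner_commute)
    hence "(U x \<bullet> ?w)\<^sup>2 \<le> (c / 2)\<^sup>2" using c by (metis abs_le_square_iff abs_of_pos half_gt_zero)
    hence "3 * c\<^sup>2 / 4 \<le> (U z \<bullet> ?w)\<^sup>2 - (U x \<bullet> ?w)\<^sup>2" using 1 by (simp add: power_divide)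
    thus ?thesis using inner_outer_diff[of ?w "U x" "U z"] xi by simp
  qed
  thus ?thesis using c by (intro exI[of _ "3 * c\<^sup>2 / 4"] conjI exI[of _ "max m m'"]) auto
qed

lemma exp_gp_small: assumes "0 < e" shows "\<exists>M. \<forall>x\<ge>M. H * exp (- C * x) < e"
proof -
  have "((\<lambda>x. H * exp (- C * x)) \<longlongrightarrow> H * 0) at_top"
    using C by (intro tendsto_intros filterlim_compose[OF exp_at_bot]
       filterlim_tendsto_neg_mult_at_bot[OF tendsto_const _ filterlim_ident]) auto
  hence "eventually (\<lambda>x. H * exp (- C * x) < e) at_top" using assms by (intro order_tendstoD(2)) auto
  thus ?thesis by (simp add: eventually_at_top_linorder)
qed

text \<open>A qualitative form of Gromov hyperbolicity: large products stay large under transitivity.\<close>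

lemma weak_ultrametric:
  "\<exists>M. \<forall>x\<in>\<Gamma>. \<forall>y\<in>\<Gamma>. \<forall>z\<in>\<Gamma>. M \<le> gp x y \<longrightarrow> M \<le> gp y z \<longrightarrow> B \<le> gp x z"
proof -
  obtain c m where c: "0 < c" and m: "\<And>x z. x \<in> \<Gamma> \<Longrightarrow> z \<in> \<Gamma> \<Longrightarrow> gp x z \<le> B \<Longrightarrow> m \<le> wl x \<Longrightarrow> m \<le> wl z \<Longrightarrow> c \<le> dist (Ul x) (Ul z)"
    using separation[of B] by blast
  obtain M where M: "\<And>x. M \<le> x \<Longrightarrow> H * exp (- C * x) < c / 2" using exp_gp_small[of "c / 2"] c by auto
  have "B \<le> gp x z" if x: "x \<in> \<Gamma>" and y: "y \<in> \<Gamma>" and z: "z \<in> \<Gamma>"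
    and g: "max M m \<le> gp x y" "max M m \<le> gp y z" for x y z
  proof (rule ccontr)
    assume "\<not> B \<le> gp x z"
    moreover have "m \<le> wl x" "m \<le> wl z" using gp_le[OF x y] gp_le'[OF y z] g by auto
    ultimately have "c \<le> dist (Ul x) (Ul z)" using m[OF x z] by simp
    also have "\<dots> \<le> dist (Ul x) (Ul y) + dist (Ul y) (Ul z)" by (rule dist_triangle)
    also have "\<dots> < c / 2 + c / 2"
      using U_hoelder[OF x y] U_hoelder[OF y z] M[of "gp x y"] M[of "gp y z"] g by (intro add_strict_mono) auto
    finally show False by simp
  qed
  thus ?thesis by blast
qed

section \<open>Sequences converging at infinity and geodesic rays\<close>

lemma conv_in: "conv_infty S \<Gamma> x \<Longrightarrow> x k \<in> \<Gamma>" by (simp add: conv_infty_def)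

lemma conv_wl: "conv_infty S \<Gamma> x \<Longrightarrow> \<exists>N. \<forall>i\<ge>N. (M :: real) \<le> wl (x i)"
  unfolding conv_infty_def by (metis gp_self)

text \<open>A converse to \<open>U_hoelder\<close>: by \<open>separation\<close>, long elements with
  close lines have a large Gromov product.\<close>

lemma conv_inftyI:
  assumes x: "\<And>k. x k \<in> \<Gamma>" and inf: "\<And>M :: nat. \<exists>N. \<forall>i\<ge>N. M \<le> wl (x i)"
    and lim: "(\<lambda>i. Ul (x i)) \<longlonglongrightarrow> z"
  shows "conv_infty S \<Gamma> x"
  unfolding conv_infty_def
proof (intro conjI allI)
  fix M :: real
  obtain c m where c: "0 < c" and m: "\<And>x z. x \<in> \<Gamma> \<Longrightarrow> z \<in> \<Gamma> \<Longrightarrow> gp x z \<le> M \<Longrightarrow> m \<le> wl x \<Longrightarrow> m \<le> wl z \<Longrightarrow> c \<le> dist (Ul x) (Ul z)"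
    using separation[of M] by blast
  obtain N1 where N1: "\<And>i. i \<ge> N1 \<Longrightarrow> m \<le> wl (x i)" using inf by blast
  have "Cauchy (\<lambda>i. Ul (x i))" using lim by (rule LIMSEQ_imp_Cauchy)
  then obtain N2 where N2: "\<And>i j. i \<ge> N2 \<Longrightarrow> j \<ge> N2 \<Longrightarrow> dist (Ul (x i)) (Ul (x j)) < c"
    using metric_CauchyD[OF _ c] by blast
  have "M \<le> gp (x i) (x j)" if "i \<ge> max N1 N2" "j \<ge> max N1 N2" for i j
    using m[OF x x, of i j] N1[of i] N1[of j] N2[of i j] that by force
  thus "\<exists>N. \<forall>i\<ge>N. \<forall>j\<ge>N. M \<le> gp (x i) (x j)" by blast
qed (rule x)

text \<open>Koenig's lemma. The invariant \<open>P\<close> says that for infinitely many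
  \<open>i\<close> some geodesic from the identity to \<open>x i\<close> passes through
  \<open>g\<close>; pigeonholing their next letters in the finite set \<open>T\<close> extends the
  ray by one step.\<close>

lemma geodesic_ray:
  assumes x: "conv_infty S \<Gamma> x"
  shows "\<exists>q. (\<forall>j. q j \<in> \<Gamma> \<and> wl (q j) = j \<and> infinite {i. gp (q j) (x i) = j}) \<and> (\<forall>j. \<exists>s\<in>T. q (Suc j) = q j ** s)"
proof -
  define P where "P j g \<longleftrightarrow> g \<in> \<Gamma> \<and> wl g = j \<and> infinite {i. wl (x i) = j + wl (matrix_inv g ** x i)}" for j g
  have "\<exists>f. \<forall>j. P j (f j) \<and> (\<exists>s\<in>T. f (Suc j) = f j ** s)"
  proof (rule dependent_nat_choice)
    show "\<exists>g. P 0 g" by (rule exI[of _ "mat 1"]) (simp add: P_def \<Gamma>_1 matrix_inv_1)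
  next
    fix g j assume P: "P j g"
    have g: "g \<in> \<Gamma>" "wl g = j" using P by (auto simp: P_def)
    obtain N where N: "\<And>i. i \<ge> N \<Longrightarrow> real (Suc j) \<le> wl (x i)" using conv_wl[OF x] by blast
    define I where "I = {i. wl (x i) = j + wl (matrix_inv g ** x i)} - {..<N}"
    have I: "infinite I" unfolding I_def using P by (simp add: P_def)
    have "\<exists>s\<in>T. wl (matrix_inv (g ** s) ** x i) + 1 \<le> wl (matrix_inv g ** x i)" if "i \<in> I" for i
    proof -
      have i: "wl (x i) = j + wl (matrix_inv g ** x i)" "N \<le> i" using that by (auto simp: I_def)
      hence pos: "0 < wl (matrix_inv g ** x i)" using N[of i] by simp
      have "matrix_inv g ** x i \<in> \<Gamma>" using g conv_in[OF x] by (simp add: \<Gamma>_mult \<Gamma>_inv)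
      then obtain ws where ws: "set ws \<subseteq> T" "length ws = wl (matrix_inv g ** x i)" "word_prod ws = matrix_inv g ** x i"
        by (rule wl_word)
      then obtain s vs where sv: "ws = s # vs" using pos by (cases ws) auto
      have s: "s \<in> T" "s \<in> \<Gamma>" using ws sv word_prod_in[of "[s]"] by auto
      have "matrix_inv (g ** s) ** x i = matrix_inv s ** (matrix_inv g ** x i)"
        using g s by (simp add: matrix_inv_mult \<Gamma>_invertible matrix_mul_assoc)
      also have "\<dots> = matrix_inv s ** (s ** word_prod vs)" using ws(3) unfolding sv by simp
      also have "\<dots> = word_prod vs" using s by simp
      finally have "wl (matrix_inv (g ** s) ** x i) \<le> length vs" using wl_le[of vs] ws sv by simp
      thus ?thesis using s ws sv by (intro bexI[of _ s]) auto
    qed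
    then obtain f where f: "\<And>i. i \<in> I \<Longrightarrow> f i \<in> T \<and> wl (matrix_inv (g ** f i) ** x i) + 1 \<le> wl (matrix_inv g ** x i)"
      by metis
    have "finite (f ` I)" using f finite_T by (meson finite_subset image_subsetI)
    then obtain a where a: "a \<in> I" "infinite {b \<in> I. f b = f a}" using pigeonhole_infinite[OF I] by blast
    define s where "s = f a"
    have s: "s \<in> T" "s \<in> \<Gamma>" using f[OF a(1)] word_prod_in[of "[s]"] by (auto simp: s_def)
    have gs: "g ** s \<in> \<Gamma>" using g s by (simp add: \<Gamma>_mult)
    have le: "wl (g ** s) \<le> Suc j" using wl_mult[OF g(1) s(2)] wl_le[of "[s]"] s g by simp
    have eq: "wl (x b) = Suc j + wl (matrix_inv (g ** s) ** x b) \<and> wl (g ** s) = Suc j" if "b \<in> I" "f b = s" for b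
      using f[OF that(1)] that wl_tri[OF gs conv_in[OF x], of b] le by (auto simp: I_def)
    have "wl (g ** s) = Suc j" using eq[OF a(1)] by (simp add: s_def)
    moreover have "infinite {i. wl (x i) = Suc j + wl (matrix_inv (g ** s) ** x i)}"
    proof (rule infinite_super[OF _ a(2)])
      show "{b \<in> I. f b = f a} \<subseteq> {i. wl (x i) = Suc j + wl (matrix_inv (g ** s) ** x i)}"
        using eq by (auto simp: s_def)
    qed
    ultimately have "P (Suc j) (g ** s)" using gs by (simp add: P_def)
    thus "\<exists>g'. P (Suc j) g' \<and> (\<exists>s\<in>T. g' = g ** s)" using s by blast
  qed
  then obtain q where q: "\<And>j. P j (q j)" "\<And>j. \<exists>s\<in>T. q (Suc j) = q j ** s" by blast
  have "infinite {i. gp (q j) (x i) = j}" for j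
  proof (rule infinite_super)
    show "infinite {i. wl (x i) = j + wl (matrix_inv (q j) ** x i)}" using q(1)[of j] by (simp add: P_def)
    show "{i. wl (x i) = j + wl (matrix_inv (q j) ** x i)} \<subseteq> {i. gp (q j) (x i) = j}"
      using q(1)[of j] by (auto simp: P_def gromov_prod_def)
  qed
  thus ?thesis using q by (intro exI[of _ q]) (auto simp: P_def)
qed

text \<open>The full sequence of lines converges, so its limit can be tested along the infinitely
  many \<open>i\<close> for which \<open>q j\<close> lies on a geodesic to \<open>x i\<close>; there
  \<open>U_hoelder\<close> gives a bound depending on \<open>j\<close> only.\<close>

lemma ray_limit:
  assumes x: "conv_infty S \<Gamma> x" and lim: "(\<lambda>i. Ul (x i)) \<longlonglongrightarrow> z"
    and q: "\<And>j. q j \<in> \<Gamma>" "\<And>j. infinite {i. gp (q j) (x i) = real j}"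
  shows "(\<lambda>j. Ul (q j)) \<longlonglongrightarrow> z"
proof -
  have le: "dist (Ul (q j)) z \<le> H * exp (- C * real j)" for j
  proof (rule ccontr)
    assume "\<not> ?thesis"
    moreover have "(\<lambda>i. dist (Ul (q j)) (Ul (x i))) \<longlonglongrightarrow> dist (Ul (q j)) z"
      by (intro tendsto_intros lim)
    ultimately have "eventually (\<lambda>i. H * exp (- C * real j) < dist (Ul (q j)) (Ul (x i))) sequentially"
      by (intro order_tendstoD(1)) auto
    then obtain N where N: "\<And>i. i \<ge> N \<Longrightarrow> H * exp (- C * real j) < dist (Ul (q j)) (Ul (x i))"
      by (auto simp: eventually_sequentially)
    obtain i where "i \<ge> N" "gp (q j) (x i) = j"
      using q(2)[of j] unfolding infinite_nat_iff_unbounded_le by blast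
    thus False using N[of i] U_hoelder[OF q(1)[of j] conv_in[OF x], of i] by simp
  qed
  have lim0: "(\<lambda>j. H * exp (- C * real j)) \<longlonglongrightarrow> 0" by (rule exp_seq_tendsto_0[OF C])
  have "(\<lambda>j. dist (Ul (q j)) z) \<longlonglongrightarrow> 0"
    by (rule tendsto_sandwich[OF _ _ tendsto_const lim0]) (use le in \<open>auto intro!: always_eventually\<close>)
  thus ?thesis by (simp only: tendsto_dist_iff[symmetric])
qed

text \<open>Prepending the letters of \<open>x\<close> from its end, the product after
  \<open>k\<close> letters has length at least \<open>wl y + k\<close>. The steps of the input line
  thus sum to a geometric series starting at order \<open>exp (- C * wl y)\<close>.\<close>

lemma W_geodesic_extension:
  assumes x: "x \<in> \<Gamma>" and y: "y \<in> \<Gamma>" and geo: "wl (x ** y) = wl x + wl y"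
  shows "dist (Wl y) (Wl (x ** y)) \<le> H * exp (- C * wl y)"
proof -
  obtain a where a: "set a \<subseteq> T" "length a = wl x" "word_prod a = x" using wl_word[OF x] .
  have bound: "2 * K\<^sup>2 * sg (word_prod (drop (length a - k) a) ** y) \<le> 2 * K\<^sup>2 * exp C' * exp (- C * wl y) * exp (- C * \<bar>real k - 0\<bar>)"
    if "k < length a" for k
  proof -
    let ?b = "word_prod (take (length a - k) a)" and ?c = "word_prod (drop (length a - k) a)"
    have sub: "set (take (length a - k) a) \<subseteq> T" "set (drop (length a - k) a) \<subseteq> T"
      using a by (meson order_trans set_drop_subset set_take_subset)+
    have b: "?b \<in> \<Gamma>" "?c \<in> \<Gamma>" using sub by (auto intro: word_prod_in)
    hence p: "?c ** y \<in> \<Gamma>" using y by (simp add: \<Gamma>_mult)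
    have "x = ?b ** ?c" using a(3) by (metis append_take_drop_id word_prod_append)
    hence "x ** y = ?b ** (?c ** y)" by (simp add: matrix_mul_assoc)
    hence "wl x + wl y \<le> wl ?b + wl (?c ** y)" using wl_mult[OF b(1) p] geo by simp
    also have "wl ?b \<le> length a - k" using wl_le[OF sub(1)] by simp
    finally have "wl y + k \<le> wl (?c ** y)" using that a by simp
    hence "C * (real (wl y) + real k) \<le> C * real (wl (?c ** y))"
      using C by (intro mult_left_mono) (auto simp flip: of_nat_add)
    hence "C' - C * wl (?c ** y) \<le> C' + (- C * wl y + - C * \<bar>real k - 0\<bar>)" by (simp add: algebra_simps)
    hence "exp (C' - C * wl (?c ** y)) \<le> exp (C' + (- C * wl y + - C * \<bar>real k - 0\<bar>))" by simp
    hence "sg (?c ** y) \<le> exp C' * (exp (- C * wl y) * exp (- C * \<bar>real k - 0\<bar>))"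
      using sg_le[OF p] unfolding exp_add by linarith
    from mult_left_mono[OF this, of "2 * K\<^sup>2"] show ?thesis by (simp add: ac_simps)
  qed
  have "dist (Wl y) (Wl (x ** y)) \<le> (\<Sum>k<length a. 2 * K\<^sup>2 * sg (word_prod (drop (length a - k) a) ** y))"
    using W_path[OF y a(1)] by (simp add: a)
  also have "\<dots> \<le> (\<Sum>k<length a. 2 * K\<^sup>2 * exp C' * exp (- C * wl y) * exp (- C * \<bar>real k - 0\<bar>))"
    by (intro sum_mono bound) auto
  also have "\<dots> = 2 * K\<^sup>2 * exp C' * exp (- C * wl y) * (\<Sum>k<length a. exp (- C * \<bar>real k - 0\<bar>))"
    unfolding sum_distrib_left ..
  also have "\<dots> \<le> 2 * K\<^sup>2 * exp C' * exp (- C * wl y) * (2 * exp C / (1 - exp (- C)))"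
    by (intro mult_left_mono sum_exp_dist_le C order_refl) auto
  finally show ?thesis by (simp add: H_def ac_simps)
qed

lemma ray_segment:
  assumes q: "\<And>j. q j \<in> \<Gamma>" "\<And>j. wl (q j) = j" "\<And>j. \<exists>s\<in>T. q (Suc j) = q j ** s" and "j \<le> i"
  shows "wl (matrix_inv (q j) ** q i) = i - j"
proof -
  have "\<exists>ws. set ws \<subseteq> T \<and> length ws = i - j \<and> q i = q j ** word_prod ws"
    using \<open>j \<le> i\<close>
  proof (induction i rule: dec_induct)
    case base show ?case by (intro exI[of _ "[]"]) simp
  next
    case (step n)
    then obtain ws s where "set ws \<subseteq> T" "length ws = n - j" "q n = q j ** word_prod ws" "s \<in> T" "q (Suc n) = q n ** s"
      using q(3) by blast
    thus ?case using step by (intro exI[of _ "ws @ [s]"]) (auto simp: word_prod_append matrix_mul_assoc)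
  qed
  then obtain ws where ws: "set ws \<subseteq> T" "length ws = i - j" "q i = q j ** word_prod ws" by blast
  hence "matrix_inv (q j) ** q i = word_prod ws" using q(1) by simp
  hence "wl (matrix_inv (q j) ** q i) \<le> i - j" using wl_le[OF ws(1)] ws by simp
  moreover have "i \<le> j + wl (matrix_inv (q j) ** q i)" using wl_tri[OF q(1) q(1), of i j] q(2) by simp
  ultimately show ?thesis by simp
qed

text \<open>Ping-pong with a single player: unit vectors whose pairing with \<open>W y\<close> is at
  least \<open>e / 2\<close> are stretched by a factor at least 2 and land so close to
  \<open>U y\<close> that the pairing stays at least \<open>e / 2\<close>.\<close>

lemma power_norm_growth:
  assumes y: "y \<in> \<Gamma>" and e: "0 < e" "e \<le> \<bar>W y \<bullet> U y\<bar>" and s: "sg y < e\<^sup>2 / 16" "sg y < e ^ 3 / 16"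
  shows "2 ^ k \<le> opn (mpow y k)"
proof -
  \<comment> \<open>A small ratio is a large gap, which determinant 1 turns into a large
    norm.\<close>
  have n: "4 / e \<le> opn y"
  proof (rule power2_le_imp_le)
    have "(4 / e)\<^sup>2 \<le> 1 / sg y" using s(1) e sg_pos[of y] by (simp add: field_simps power_divide)
    also have "\<dots> = exp (mu 1 y - mu 2 y)" by (simp add: sg_def exp_minus[symmetric] divide_inverse)
    also have "\<dots> \<le> (opn y)\<^sup>2" by (rule near_rank_one_SL(2)[OF n2 \<Gamma>_SL[OF y]])
    finally show "(4 / e)\<^sup>2 \<le> (opn y)\<^sup>2" .
  qed (rule opn_nonneg)
  have "\<exists>z r. norm z = 1 \<and> 2 ^ k \<le> r \<and> mpow y k *v U y = r *\<^sub>R z \<and> e / 2 \<le> \<bar>W y \<bullet> z\<bar>" for k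
  proof (induction k)
    case 0 show ?case using y e by (intro exI[of _ "U y"] exI[of _ 1]) auto
  next
    case (Suc k)
    then obtain z r where z: "norm z = 1" "2 ^ k \<le> r" "mpow y k *v U y = r *\<^sub>R z" "e / 2 \<le> \<bar>W y \<bullet> z\<bar>" by blast
    define a where "a = norm (y *v z)"
    have "2 = 4 / e * (e / 2)" using e by simp
    also have "\<dots> \<le> opn y * \<bar>W y \<bullet> z\<bar>" using n z e opn_nonneg by (intro mult_mono) auto
    also have "\<dots> \<le> a" unfolding a_def by (rule near_rank_one_norm_ge[OF UW[OF y]])
    finally have a: "2 \<le> a" .
    define z' where "z' = (1 / a) *\<^sub>R (y *v z)"
    have z': "norm z' = 1" "y *v z = a *\<^sub>R z'" using a by (auto simp: z'_def a_def)
    have "dist (Ul y) (outer z') \<le> 2 * sg y / (e / 2)"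
      using z z' e sg_pos[of y] opn_pos[OF y] by (intro image_near_top_line[OF UW[OF y] z(1)]) auto
    also have "\<dots> = 4 * sg y / e" by simp
    also have "\<dots> \<le> e\<^sup>2 / 4" using s(2) e by (simp add: field_simps power2_eq_square power3_eq_cube)
    finally have d: "dist (Ul y) (outer z') \<le> e\<^sup>2 / 4" .
    have "e\<^sup>2 \<le> (U y \<bullet> W y)\<^sup>2" using e by (metis abs_le_square_iff abs_of_pos inner_commute)
    moreover have "\<bar>(U y \<bullet> W y)\<^sup>2 - (z' \<bullet> W y)\<^sup>2\<bar> \<le> e\<^sup>2 / 4"
      using inner_outer_diff[of "W y" "U y" z'] d y by simp
    ultimately have "e\<^sup>2 / 4 \<le> (z' \<bullet> W y)\<^sup>2" using zero_le_power2[of e] by argo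
    hence "(e / 2)\<^sup>2 \<le> \<bar>W y \<bullet> z'\<bar>\<^sup>2" by (simp add: power_divide inner_commute)
    hence "e / 2 \<le> \<bar>W y \<bullet> z'\<bar>" by (rule power2_le_imp_le) simp
    moreover have "mpow y (Suc k) *v U y = (r * a) *\<^sub>R z'"
      using z z' by (simp add: matrix_vector_mul_assoc[symmetric] matrix_vector_mult_scaleR)
    moreover have "2 ^ Suc k \<le> r * a" using mult_mono[OF z(2) a] order_trans[OF _ z(2), of 0] by (simp add: mult.commute)
    ultimately show ?case using z' by blast
  qed
  then obtain z r where "norm z = 1" "2 ^ k \<le> r" "mpow y k *v U y = r *\<^sub>R z" by blast
  thus ?thesis using opn[of "mpow y k" "U y"] y by simp
qed

text \<open>Linear growth of the length of powers implies infinite order, as the eigenvalue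
  hypothesis asks, and through the gap inequality an exponential gap along the powers.\<close>

definition undistorted :: "'n mat \<Rightarrow> bool" where
  "undistorted h \<longleftrightarrow> h \<in> \<Gamma> \<and> (\<exists>\<tau>>0. \<forall>k. \<tau> * real k \<le> wl (mpow h k))"

text \<open>Along a geodesic ray some \<open>W (q j)\<close> and \<open>W (q i)\<close> nearly agree; then
  \<open>q j\<^sup>-\<^sup>1 q i\<close> has transverse top singular vectors, so its powers grow.\<close>

lemma exists_undistorted:
  assumes q: "\<And>j. q j \<in> \<Gamma>" "\<And>j. wl (q j) = j" "\<And>j. \<exists>s\<in>T. q (Suc j) = q j ** s"
  shows "\<exists>g. undistorted g"
proof -
  obtain c m where c: "0 < c" and m: "\<And>x z. x \<in> \<Gamma> \<Longrightarrow> z \<in> \<Gamma> \<Longrightarrow> gp x z \<le> 0 \<Longrightarrow> m \<le> wl x \<Longrightarrow> m \<le> wl z \<Longrightarrow> c \<le> \<bar>W (matrix_inv x) \<bullet> U z\<bar>"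
    using transversality[of 0] by blast
  define e where "e = c / 2"
  have e: "0 < e" using c by (simp add: e_def)
  obtain m1 where m1: "\<And>g. g \<in> \<Gamma> \<Longrightarrow> m1 \<le> wl g \<Longrightarrow> sg g < min (e\<^sup>2 / 16) (e ^ 3 / 16)"
    using sg_small[of "min (e\<^sup>2 / 16) (e ^ 3 / 16)"] e by auto
  obtain m2 where m2: "\<And>t. m2 \<le> t \<Longrightarrow> H * exp (- C * t) < c\<^sup>2 / 4" using exp_gp_small[of "c\<^sup>2 / 4"] c by auto
  have "\<forall>j. Wl (q j) \<in> outer ` sphere 0 1" using q by simp
  then obtain w r where r: "strict_mono (r :: nat \<Rightarrow> nat)" "((\<lambda>j. Wl (q j)) \<circ> r) \<longlonglongrightarrow> w"
    using compact_outer_sphere[unfolded compact_def] by metis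
  have "Cauchy ((\<lambda>j. Wl (q j)) \<circ> r)" using r(2) by (rule LIMSEQ_imp_Cauchy)
  moreover have "0 < c\<^sup>2 / 4" using c by simp
  ultimately obtain N where N: "\<And>a b. a \<ge> N \<Longrightarrow> b \<ge> N \<Longrightarrow> dist (Wl (q (r a))) (Wl (q (r b))) < c\<^sup>2 / 4"
    unfolding comp_def using metric_CauchyD by blast
  define a where "a = max N m"
  define j where "j = r a"
  \<comment> \<open>Long enough for the segment from \<open>q j\<close> to \<open>q i\<close> to
    satisfy the transversality bound (\<open>m\<close>), the ratio bounds (\<open>m1\<close>) and
    the closeness of input lines (\<open>m2\<close>).\<close>
  define L where "L = m + m1 + nat \<lceil>m2\<rceil>"
  define i where "i = r (a + j + L)"
  have j: "m \<le> j" using seq_suble[OF r(1), of a] by (simp add: j_def a_def)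
  have i: "j + L \<le> i" using seq_suble[OF r(1), of "a + j + L"] by (simp add: i_def)
  define y where "y = matrix_inv (q j) ** q i"
  have y: "y \<in> \<Gamma>" using q by (simp add: y_def \<Gamma>_mult \<Gamma>_inv)
  have wy: "wl y = i - j" unfolding y_def using i by (intro ray_segment q) auto
  have qy: "q j ** y = q i" using q by (simp add: y_def)
  have yL: "m \<le> wl y" "m1 \<le> wl y" "m2 \<le> wl y" using wy i by (auto simp: L_def) linarith
  have ji: "j \<le> i" using i by simp
  \<comment> \<open>\<open>q j\<close> followed by \<open>y\<close> is a geodesic to
    \<open>q i\<close>, so nothing cancels at the junction.\<close>
  have "gp (matrix_inv (q j)) y = 0"
    using q wy ji by (simp add: gromov_prod_def wl_inv matrix_inv_inv \<Gamma>_invertible qy of_nat_diff)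
  hence "c \<le> \<bar>W (q j) \<bullet> U y\<bar>"
    using m[OF \<Gamma>_inv[OF q(1)[of j]] y] q yL j by (simp add: wl_inv matrix_inv_inv \<Gamma>_invertible)
  hence 1: "c\<^sup>2 \<le> (W (q j) \<bullet> U y)\<^sup>2" using c by (metis abs_le_square_iff abs_of_pos)
  have "dist (Wl y) (Wl (q i)) \<le> H * exp (- C * wl y)"
    using W_geodesic_extension[OF q(1) y, of j] q wy ji by (simp add: qy)
  hence "dist (Wl y) (Wl (q i)) < c\<^sup>2 / 4" using m2[OF yL(3)] by simp
  moreover have "dist (Wl (q i)) (Wl (q j)) < c\<^sup>2 / 4"
    unfolding i_def j_def by (rule N) (auto simp: a_def)
  ultimately have "dist (Wl y) (Wl (q j)) < c\<^sup>2 / 2"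
    using dist_triangle[of "Wl y" "Wl (q j)" "Wl (q i)"] by simp
  hence "\<bar>(W y \<bullet> U y)\<^sup>2 - (W (q j) \<bullet> U y)\<^sup>2\<bar> < c\<^sup>2 / 2"
    using inner_outer_diff[of "U y" "W y" "W (q j)"] y by simp
  hence "c\<^sup>2 / 4 \<le> (W y \<bullet> U y)\<^sup>2" using 1 zero_le_power2[of c] by argo
  hence "e\<^sup>2 \<le> \<bar>W y \<bullet> U y\<bar>\<^sup>2" by (simp add: e_def power_divide)
  hence eW: "e \<le> \<bar>W y \<bullet> U y\<bar>" by (rule power2_le_imp_le) simp
  \<comment> \<open>The norm is at most exponential in the word length, so exponential growth of the
    norms of the powers forces linear growth of their lengths.\<close>
  have grow: "2 ^ k \<le> K ^ wl (mpow y k)" for k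
    using power_norm_growth[OF y e eW, of k] m1[OF y yL(2)] opn_wl[OF \<Gamma>_mpow[OF y], of k] by simp
  have K1: "1 < K"
  proof (rule ccontr)
    assume "\<not> 1 < K"
    hence "K = 1" using K(1) by simp
    thus False using grow[of 1] by simp
  qed
  have "ln 2 / ln K * real k \<le> wl (mpow y k)" for k
  proof -
    have "ln (2 ^ k) \<le> ln (K ^ wl (mpow y k))" using grow[of k] K1 by (subst ln_le_cancel_iff) auto
    hence "real k * ln 2 \<le> real (wl (mpow y k)) * ln K" using K1 by (simp add: ln_realpow)
    thus ?thesis using K1 by (simp add: field_simps)
  qed
  moreover have "0 < ln 2 / ln K" using K1 by simp
  ultimately have "undistorted y" using y unfolding undistorted_def by blast
  thus ?thesis by blast
qed

end

section \<open>Powers of undistorted elements\<close>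

lemma poly_map_of_real: "poly (map_poly complex_of_real p) (complex_of_real c) = complex_of_real (poly p c)"
  by (induction p) (auto simp: map_poly_pCons)

lemma eigenvalue_root:
  fixes h :: "real^'n^'n"
  assumes "h *v u = c *\<^sub>R u" "u \<noteq> 0"
  shows "complex_of_real c \<in> complex_eigenvalues h"
proof -
  define M where "M = (\<chi> i j. (if i = j then c else 0) - h $ i $ j)"
  have "M *v u = 0"
  proof -
    have "(\<Sum>j\<in>UNIV. ((if i = j then c else 0) - h $ i $ j) * u $ j) = c * u $ i - (h *v u) $ i" for i
      by (simp add: matrix_vector_mult_def left_diff_distrib sum_subtractf if_distrib[of "\<lambda>x. x * u $ j" for j] cong: if_cong)
    thus ?thesis using assms(1) by (simp add: M_def vec_eq_iff matrix_vector_mult_def)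
  qed
  have "det M = 0"
  proof (rule ccontr)
    assume "det M \<noteq> 0"
    hence "matrix_inv M ** M = mat 1" by (simp add: invertible_det_nz)
    hence "u = matrix_inv M *v (M *v u)" by (simp add: matrix_vector_mul_assoc)
    thus False using \<open>M *v u = 0\<close> assms(2) by simp
  qed
  hence "poly (charpoly h) c = 0" by (simp add: poly_charpoly M_def)
  hence "poly (map_poly complex_of_real (charpoly h)) (complex_of_real c) = 0"
    by (simp add: poly_map_of_real)
  thus ?thesis by (simp add: complex_eigenvalues_def)
qed

lemma mpow_Suc_right: "mpow g (Suc k) = mpow g k ** g"
  using mpow_add[of g k 1] by simp

lemma mpow_eigenvector: "h *v u = c *\<^sub>R u \<Longrightarrow> mpow h m *v u = (c ^ m) *\<^sub>R u"
proof (induction m)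
  case (Suc m)
  have "mpow h (Suc m) *v u = h *v (mpow h m *v u)" by (simp add: matrix_vector_mul_assoc)
  thus ?case using Suc by (simp add: matrix_vector_mult_scaleR)
qed simp

context anosov_group
begin

lemma mpow_inv: "g \<in> \<Gamma> \<Longrightarrow> mpow (matrix_inv g) k = matrix_inv (mpow g k)"
proof (induction k)
  case (Suc k)
  thus ?case unfolding mpow_Suc_right[of g] by (simp add: matrix_inv_mult \<Gamma>_invertible \<Gamma>_mpow)
qed (simp add: matrix_inv_1)

lemma undistorted_inv: "undistorted g \<Longrightarrow> undistorted (matrix_inv g)"
  unfolding undistorted_def by (auto simp: \<Gamma>_inv mpow_inv wl_inv \<Gamma>_mpow)

lemma undistorted_infinite_order:
  assumes "undistorted g" "0 < k" shows "mpow g k \<noteq> mat 1"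
proof
  assume eq: "mpow g k = mat 1"
  obtain t where t: "0 < t" "\<And>k. t * real k \<le> wl (mpow g k)" using assms by (auto simp: undistorted_def)
  have "t * real k \<le> 0" using t(2)[of k] by (simp add: eq)
  thus False using t(1) assms(2) by (simp add: mult_le_0_iff)
qed

text \<open>The powers of \<open>h\<close> form a cocycle whose unit step is \<open>h\<close>
  itself, bounded by \<open>L\<close> together with its inverse; the gap exponent is
  \<open>C * t\<close>, with \<open>t\<close> a linear growth rate of the word length. Convergence
  of the lines comes from summing steps, transversality from the norm estimate.\<close>

lemma undistorted_powers:
  assumes h: "undistorted h"
  obtains u w c m A q where "norm u = 1" "norm w = 1" "0 < c" "0 \<le> q" "q < 1"
    "(\<lambda>k. Ul (mpow h k)) \<longlonglongrightarrow> outer u"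
    "(\<lambda>k. Wl (mpow h k)) \<longlonglongrightarrow> outer w"
    "\<And>k. dist (Wl (mpow h k)) (outer w) \<le> A * q ^ k"
    "\<And>k. sg (mpow h k) \<le> A * q ^ k"
    "\<And>a b. m \<le> a \<Longrightarrow> m \<le> b \<Longrightarrow> c \<le> \<bar>W (mpow h a) \<bullet> U (mpow h b)\<bar>"
    "conv_infty S \<Gamma> (mpow h)"
proof -
  obtain t where t: "0 < t" "\<And>k. t * real k \<le> wl (mpow h k)" and hG: "h \<in> \<Gamma>" using h by (auto simp: undistorted_def)
  have G: "mpow h k \<in> \<Gamma>" for k using hG by (rule \<Gamma>_mpow)
  define q where "q = exp (- (C * t))"
  have q: "0 \<le> q" "q < 1" using C t by (auto simp: q_def)
  have qk: "q ^ k = exp (- (C * t) * real k)" for k by (simp add: q_def exp_of_nat_mult[symmetric] mult.commute)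
  have sgk: "sg (mpow h k) \<le> exp C' * q ^ k" for k
  proof -
    have "sg (mpow h k) \<le> exp (C' - C * wl (mpow h k))" by (rule sg_le[OF G])
    also have "\<dots> \<le> exp (C' + - (C * t) * real k)"
      using mult_left_mono[OF t(2)[of k], of C] C by (simp add: algebra_simps)
    finally show ?thesis unfolding qk exp_add .
  qed
  define L where "L = max 1 (max (opn h) (opn (matrix_inv h)))"
  have L: "1 \<le> L" "opn h \<le> L" "opn (matrix_inv h) \<le> L" by (auto simp: L_def)
  have inv: "h ** matrix_inv h = mat 1" "matrix_inv h ** h = mat 1" using hG \<Gamma>_invertible by auto
  have "dist (Ul (mpow h k)) (Ul (mpow h (Suc k))) \<le> 2 * L\<^sup>2 * sg (mpow h k)" for k
    unfolding mpow_Suc_right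
    by (rule top_line_mult_right[OF UW[OF G] UW[OF \<Gamma>_mult[OF G hG]] L(2,3) inv(1) opn_pos[OF G] less_imp_le[OF sg_pos]])
  moreover have "dist (Wl (mpow h k)) (Wl (mpow h (Suc k))) \<le> 2 * L\<^sup>2 * sg (mpow h k)" for k
    unfolding mpow.simps
    by (rule top_line_mult_left[OF UW[OF G] UW[OF \<Gamma>_mult[OF hG G]] L(2,3) inv(2) opn_pos[OF G] less_imp_le[OF sg_pos]])
  moreover have le: "2 * L\<^sup>2 * sg (mpow h k) \<le> 2 * L\<^sup>2 * exp C' * q ^ k" for k
    using mult_left_mono[OF sgk[of k], of "2 * L\<^sup>2"] by (simp add: mult.assoc)
  ultimately have "dist (Ul (mpow h k)) (Ul (mpow h (Suc k))) \<le> 2 * L\<^sup>2 * exp C' * q ^ k"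
    "dist (Wl (mpow h k)) (Wl (mpow h (Suc k))) \<le> 2 * L\<^sup>2 * exp C' * q ^ k" for k
    using order_trans by blast+
  from geometric_steps_converge[of "\<lambda>k. Ul (mpow h k)", OF this(1) q]
    geometric_steps_converge[of "\<lambda>k. Wl (mpow h k)", OF this(2) q]
  obtain u' w' where u': "(\<lambda>k. Ul (mpow h k)) \<longlonglongrightarrow> u'" and w': "(\<lambda>k. Wl (mpow h k)) \<longlonglongrightarrow> w'"
    and rate: "\<And>k. dist (Wl (mpow h k)) w' \<le> 2 * L\<^sup>2 * exp C' / (1 - q) * q ^ k" by blast
  obtain u where u: "norm u = 1" "u' = outer u" using outer_limit[OF _ u'] G by auto
  obtain w where w: "norm w = 1" "w' = outer w" using outer_limit[OF _ w'] G by auto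
  define A where "A = max (exp C') (2 * L\<^sup>2 * exp C' / (1 - q))"
  have coc: "gap_cocycle (\<lambda>j i. transpose (mpow h (j - i))) (\<lambda>i. transpose (matrix_inv h)) N L (exp C') (C * t)" for N
  proof
    show "transpose (mpow h (k - i)) = transpose (mpow h (k - j)) ** transpose (mpow h (j - i))"
      if "i \<le> j" "j \<le> k" for i j k
      using that mpow_add[of h "j - i" "k - j"] by (simp flip: matrix_transpose_mul)
    show "\<exists>u w. near_rank_one (transpose (mpow h (j - i))) (exp C' * exp (- (C * t) * (real j - real i))) u w"
      if "i < j" for i j
    proof -
      have "sg (mpow h (j - i)) \<le> exp C' * exp (- (C * t) * (real j - real i))"
        using sgk[of "j - i"] that by (simp add: qk of_nat_diff)
      from near_rank_one_mono[OF near_rank_one_transpose[OF UW[OF G]] this] show ?thesis by blast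
    qed
  qed (use L inv C t in \<open>simp_all add: opn_transpose transpose_mat matrix_transpose_mul[symmetric]\<close>)
  obtain c where c: "0 < c" and main: "\<And>(Y :: nat \<Rightarrow> nat \<Rightarrow> 'n mat) Z N m. gap_cocycle Y Z N L (exp C') (C * t) \<Longrightarrow> m \<le> N \<Longrightarrow>
           c * (opn (Y N m) * opn (Y m 0)) \<le> opn (Y N 0)"
    using gap_cocycle_norm_supermultiplicative[of L "exp C'" "C * t", where 'n = 'n] L C t
    by (metis exp_ge_zero mult_pos_pos)
  have sup: "c * (opn (mpow h a) * opn (mpow h b)) \<le> opn (mpow h a ** mpow h b)" for a b
    using main[OF coc[of "a + b"], of a] by (simp add: opn_transpose mpow_add mult.commute)
  have qlim: "(\<lambda>k. exp C' * q ^ k) \<longlonglongrightarrow> 0"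
    using tendsto_mult[OF tendsto_const LIMSEQ_realpow_zero[OF q], of "exp C'"] by simp
  have "0 < min (c / 4) 1" using c by simp
  then obtain m where m: "\<And>k. m \<le> k \<Longrightarrow> exp C' * q ^ k < min (c / 4) 1"
    using order_tendstoD(2)[OF qlim] unfolding eventually_sequentially by blast
  have "c / 2 \<le> \<bar>W (mpow h a) \<bullet> U (mpow h b)\<bar>" if "m \<le> a" "m \<le> b" for a b
  proof -
    have s: "sg (mpow h a) < min (c / 4) 1" "sg (mpow h b) < min (c / 4) 1"
      using m[OF that(1)] m[OF that(2)] sgk[of a] sgk[of b] by simp_all
    have "c - sg (mpow h a) - sg (mpow h b) \<le> \<bar>W (mpow h a) \<bullet> U (mpow h b)\<bar>"
      using s sup[of a b] sg_pos less_imp_le by (intro top_vectors_inner_ge[OF UW[OF G] UW[OF G]] opn_pos G) auto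
    thus ?thesis using s by simp
  qed
  moreover have "conv_infty S \<Gamma> (mpow h)"
  proof (rule conv_inftyI[OF G _ u'])
    fix M :: nat
    have "M \<le> wl (mpow h i)" if "nat \<lceil>real M / t\<rceil> \<le> i" for i
    proof -
      have "real M / t \<le> real i" using that by linarith
      hence "real M \<le> t * real i" using t by (simp add: field_simps)
      thus ?thesis using t(2)[of i] by linarith
    qed
    thus "\<exists>N. \<forall>i\<ge>N. M \<le> wl (mpow h i)" by blast
  qed
  moreover have "dist (Wl (mpow h k)) (outer w) \<le> A * q ^ k" for k
    by (rule order_trans[OF rate[of k, unfolded w]], rule mult_right_mono) (use q in \<open>auto simp: A_def\<close>)
  moreover have "sg (mpow h k) \<le> A * q ^ k" for k
    by (rule order_trans[OF sgk[of k]], rule mult_right_mono) (use q in \<open>auto simp: A_def\<close>)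
  moreover have "0 < c / 2" using c by simp
  ultimately show ?thesis using that[OF u(1) w(1) _ q] u'[unfolded u] w'[unfolded w] by blast
qed

text \<open>The limit line \<open>u\<close> is invariant, with eigenvalue \<open>l\<close>, and
  transverse to the input lines of high powers, so the norm of the k-th power is at most of order
  |l|^k, hence |c|^k. If \<open>v\<close> were orthogonal to the limit \<open>w\<close>, its images,
  of norm |c|^k, would be negligible against that norm, a contradiction. So \<open>v\<close> is
  transverse to \<open>w\<close>, and high powers, which fix the line of \<open>v\<close>, also
  bring it close to their \<open>U\<close>.\<close>

lemma power_limit_is_top_eigenline:
  assumes h: "undistorted h" and v: "norm v = 1" "h *v v = c *\<^sub>R v"
    and top: "\<And>z. z \<in> complex_eigenvalues h \<Longrightarrow> cmod z \<le> \<bar>c\<bar>"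
  shows "(\<lambda>k. Ul (mpow h k)) \<longlonglongrightarrow> outer v"
proof -
  obtain u w d m A q where uw: "norm u = 1" "norm w = 1" and d: "0 < d" and q: "0 \<le> q" "q < 1"
    and limU: "(\<lambda>k. Ul (mpow h k)) \<longlonglongrightarrow> outer u"
    and limW: "(\<lambda>k. Wl (mpow h k)) \<longlonglongrightarrow> outer w"
    and rate: "\<And>k. dist (Wl (mpow h k)) (outer w) \<le> A * q ^ k"
    and sgk: "\<And>k. sg (mpow h k) \<le> A * q ^ k"
    and trans: "\<And>a b. m \<le> a \<Longrightarrow> m \<le> b \<Longrightarrow> d \<le> \<bar>W (mpow h a) \<bullet> U (mpow h b)\<bar>"
    using undistorted_powers[OF h] by metis
  have hG: "h \<in> \<Gamma>" using h by (simp add: undistorted_def)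
  have G: "mpow h k \<in> \<Gamma>" for k using hG by (rule \<Gamma>_mpow)
  have h_inj: "h *v x = 0 \<Longrightarrow> x = 0" for x
    using hG by (metis \<Gamma>_invertible matrix_inv_cancel(2) matrix_vector_mul_assoc matrix_vector_mul_lid matrix_vector_mult_0_right)
  have A: "0 \<le> A" using sgk[of 0] sg_pos[of "mpow h 0"] by simp
  have sg0: "(\<lambda>k. sg (mpow h k)) \<longlonglongrightarrow> 0"
  proof (rule tendsto_sandwich[OF _ _ tendsto_const])
    show "(\<lambda>k. A * q ^ k) \<longlonglongrightarrow> 0" using tendsto_mult[OF tendsto_const LIMSEQ_realpow_zero[OF q], of A] by simp
  qed (use sgk sg_pos less_imp_le in \<open>auto intro!: always_eventually\<close>)
  \<comment> \<open>\<open>h\<close> sends \<open>U (mpow h k)\<close> close to the line of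
    \<open>U (mpow h (Suc k))\<close>, so the limit line is invariant. A limit vector, on which
    \<open>h\<close> can act, is extracted along a subsequence, as only the lines are known to
    converge.\<close>
  have "\<exists>l. h *v u = l *\<^sub>R u"
  proof -
    have "compact (sphere (0 :: real^'n) 1)" by (rule compact_sphere)
    moreover have "\<forall>k. U (mpow h k) \<in> sphere 0 1" using G by simp
    ultimately obtain u' r where u': "u' \<in> sphere 0 1" and r: "strict_mono (r :: nat \<Rightarrow> nat)"
      and lim': "((\<lambda>k. U (mpow h k)) \<circ> r) \<longlonglongrightarrow> u'"
      unfolding compact_def by metis
    have nu': "norm u' = 1" using u' by simp
    have "(\<lambda>k. outer (((\<lambda>k. U (mpow h k)) \<circ> r) k)) \<longlonglongrightarrow> outer u'"
      by (rule continuous_on_tendsto_compose[OF continuous_on_outer[of UNIV] lim']) auto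
    moreover have "(\<lambda>k. outer (((\<lambda>k. U (mpow h k)) \<circ> r) k)) \<longlonglongrightarrow> outer u"
      using LIMSEQ_subseq_LIMSEQ[OF limU r] by (simp add: comp_def)
    ultimately have ou: "outer u' = outer u" by (rule LIMSEQ_unique)
    define z where "z k = (1 / norm (h *v U (mpow h k))) *\<^sub>R (h *v U (mpow h k))" for k
    have hU: "h *v U (mpow h k) \<noteq> 0" for k using h_inj[of "U (mpow h k)"] norm_UW(1)[OF G[of k]] by auto
    have nz: "norm (z k) = 1" for k using hU by (simp add: z_def)
    have "(\<lambda>k. dist (Wl (mpow h (Suc k))) (Wl (mpow h k))) \<longlonglongrightarrow> dist (outer w) (outer w)"
      by (intro tendsto_dist limW LIMSEQ_Suc[OF limW])
    hence "eventually (\<lambda>k. dist (Wl (mpow h (Suc k))) (Wl (mpow h k)) < 1) sequentially"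
      by (intro order_tendstoD(2)) auto
    hence ev: "eventually (\<lambda>k. dist (Ul (mpow h (Suc k))) (outer (z k)) \<le> 4 * sg (mpow h (Suc k))) sequentially"
    proof eventually_elim
      case (elim k)
      have n: "norm (W (mpow h (Suc k))) = 1" "norm (W (mpow h k)) = 1" using norm_UW(2)[OF G] by blast+
      have "(dist (Wl (mpow h (Suc k))) (Wl (mpow h k)))\<^sup>2 \<le> 1" using elim by (intro power_le_one) auto
      hence "1 / 2 \<le> (W (mpow h (Suc k)) \<bullet> W (mpow h k))\<^sup>2" unfolding dist_outer[OF n] by simp
      hence "(1 / 2)\<^sup>2 \<le> \<bar>W (mpow h (Suc k)) \<bullet> W (mpow h k)\<bar>\<^sup>2" by (simp add: power2_eq_square)
      hence half: "1 / 2 \<le> \<bar>W (mpow h (Suc k)) \<bullet> W (mpow h k)\<bar>" by (rule power2_le_imp_le) simp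
      have "mpow h k *v W (mpow h k) = opn (mpow h k) *\<^sub>R U (mpow h k)" using UW[OF G] by (simp add: near_rank_one_def)
      hence "h *v (mpow h k *v W (mpow h k)) = opn (mpow h k) *\<^sub>R (h *v U (mpow h k))" by (simp add: matrix_vector_mult_scaleR)
      hence "mpow h (Suc k) *v W (mpow h k) = opn (mpow h k) *\<^sub>R (h *v U (mpow h k))" by (simp add: matrix_vector_mul_assoc)
      also have "\<dots> = (opn (mpow h k) * norm (h *v U (mpow h k))) *\<^sub>R z k" using hU by (simp add: z_def)
      finally have "dist (Ul (mpow h (Suc k))) (outer (z k)) \<le> 2 * sg (mpow h (Suc k)) / (1 / 2)"
        by (intro image_near_top_line[OF UW[OF G] n(2) half _ opn_pos[OF G] nz]) (use sg_pos less_imp_le in auto)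
      thus ?case by simp
    qed
    have "(\<lambda>k. 4 * sg (mpow h (Suc k))) \<longlonglongrightarrow> 0"
      using tendsto_mult[OF tendsto_const LIMSEQ_Suc[OF sg0], of 4] by simp
    hence "(\<lambda>k. dist (Ul (mpow h (Suc k))) (outer (z k))) \<longlonglongrightarrow> 0"
      by (intro tendsto_sandwich[OF _ ev tendsto_const]) auto
    hence "(\<lambda>k. Ul (mpow h (Suc k)) - outer (z k)) \<longlonglongrightarrow> 0"
      by (simp add: dist_norm tendsto_norm_zero_iff)
    from tendsto_diff[OF LIMSEQ_Suc[OF limU] this] have "(\<lambda>k. outer (z k)) \<longlonglongrightarrow> outer u" by simp
    hence l1: "(\<lambda>k. outer (z (r k))) \<longlonglongrightarrow> outer u" using LIMSEQ_subseq_LIMSEQ[OF _ r] by (auto simp: comp_def)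
    have hu': "h *v u' \<noteq> 0" using h_inj[of u'] nu' by auto
    have lim'': "(\<lambda>k. U (mpow h (r k))) \<longlonglongrightarrow> u'" using lim' by (simp add: comp_def)
    have "(\<lambda>k. h *v U (mpow h (r k))) \<longlonglongrightarrow> h *v u'"
      by (rule bounded_linear.tendsto[OF _ lim'']) simp
    hence "(\<lambda>k. z (r k)) \<longlonglongrightarrow> (1 / norm (h *v u')) *\<^sub>R (h *v u')"
      unfolding z_def by (intro tendsto_intros) (use hu' in auto)
    hence "(\<lambda>k. outer (z (r k))) \<longlonglongrightarrow> outer ((1 / norm (h *v u')) *\<^sub>R (h *v u'))"
      by (rule continuous_on_tendsto_compose[OF continuous_on_outer[of UNIV]]) auto
    hence "outer ((1 / norm (h *v u')) *\<^sub>R (h *v u')) = outer u" using l1 LIMSEQ_unique by blast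
    hence "span {(1 / norm (h *v u')) *\<^sub>R (h *v u')} = span {u'}"
      using hu' nu' ou by (intro outer_eq_imp_span_eq) auto
    hence "(1 / norm (h *v u')) *\<^sub>R (h *v u') \<in> span {u'}" by (metis insertI1 span_base)
    then obtain k where "(1 / norm (h *v u')) *\<^sub>R (h *v u') = k *\<^sub>R u'" by (auto simp: span_singleton)
    hence "norm (h *v u') *\<^sub>R ((1 / norm (h *v u')) *\<^sub>R (h *v u')) = norm (h *v u') *\<^sub>R (k *\<^sub>R u')" by simp
    hence "h *v u' = (norm (h *v u') * k) *\<^sub>R u'" using hu' by simp
    then obtain s where hu: "h *v u' = s *\<^sub>R u'" by blast
    have "u \<in> span {u'}" using outer_eq_imp_span_eq[OF nu' uw(1) ou] by (simp add: span_base)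
    then obtain k' where "u = k' *\<^sub>R u'" by (auto simp: span_singleton)
    hence "h *v u = s *\<^sub>R u" using hu by (simp add: matrix_vector_mult_scaleR)
    thus ?thesis by blast
  qed
  then obtain l where l: "h *v u = l *\<^sub>R u" by blast
  have "u \<noteq> 0" using uw by auto
  hence lc: "\<bar>l\<bar> \<le> \<bar>c\<bar>" using top[OF eigenvalue_root[OF l]] by simp
  have c0: "c \<noteq> 0" using h_inj[of v] v by auto
  have Wu: "d \<le> \<bar>W (mpow h k) \<bullet> u\<bar>" if "m \<le> k" for k
  proof -
    have n: "norm (W (mpow h k)) = 1" using norm_UW(2)[OF G] .
    have "(\<lambda>b. Ul (mpow h b) \<bullet> Wl (mpow h k)) \<longlonglongrightarrow> outer u \<bullet> Wl (mpow h k)"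
      by (intro tendsto_intros limU)
    moreover have "eventually (\<lambda>b. d\<^sup>2 \<le> Ul (mpow h b) \<bullet> Wl (mpow h k)) sequentially"
      unfolding eventually_sequentially
    proof (intro exI[of _ m] allI impI)
      fix b assume "m \<le> b"
      hence "d \<le> \<bar>W (mpow h k) \<bullet> U (mpow h b)\<bar>" by (rule trans[OF that])
      thus "d\<^sup>2 \<le> Ul (mpow h b) \<bullet> Wl (mpow h k)"
        unfolding inner_outer using d by (metis abs_le_square_iff abs_of_pos inner_commute)
    qed
    ultimately have "d\<^sup>2 \<le> outer u \<bullet> Wl (mpow h k)" by (intro tendsto_lowerbound) auto
    hence "d\<^sup>2 \<le> \<bar>W (mpow h k) \<bullet> u\<bar>\<^sup>2" by (simp add: inner_outer inner_commute)
    thus ?thesis by (rule power2_le_imp_le) simp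
  qed
  have op_le: "d * opn (mpow h k) \<le> \<bar>c\<bar> ^ k" if "m \<le> k" for k
  proof -
    have "d * opn (mpow h k) \<le> \<bar>W (mpow h k) \<bullet> u\<bar> * opn (mpow h k)" by (intro mult_right_mono Wu that opn_nonneg)
    also have "\<dots> \<le> norm (mpow h k *v u)" using near_rank_one_norm_ge[OF UW[OF G], of k u] by (simp add: mult.commute)
    also have "\<dots> = \<bar>l\<bar> ^ k" using mpow_eigenvector[OF l, of k] uw by (simp add: power_abs)
    also have "\<dots> \<le> \<bar>c\<bar> ^ k" using lc by (intro power_mono) auto
    finally show ?thesis .
  qed
  have "w \<bullet> v \<noteq> 0"
  proof
    assume wv: "w \<bullet> v = 0"
    \<comment> \<open>The rate \<open>q\<close> controls the squared pairing, so the pairing itself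
      decays at the rate of the square root.\<close>
    define p where "p = sqrt q"
    have p: "0 \<le> p" "p < 1" "q = p\<^sup>2" using q by (auto simp: p_def)
    have low: "d \<le> (sqrt A + A) * p ^ k" if k: "m \<le> k" for k
    proof -
      have "(W (mpow h k) \<bullet> v)\<^sup>2 \<le> A * q ^ k"
        using inner_outer_diff[OF v(1), of "W (mpow h k)" w] rate[of k] by (simp add: wv)
      also have "\<dots> = (sqrt A * p ^ k)\<^sup>2" using A by (simp add: p(3) power_mult_distrib power_mult[symmetric] mult.commute)
      finally have 1: "\<bar>W (mpow h k) \<bullet> v\<bar> \<le> sqrt A * p ^ k"
        using A p by (metis abs_le_square_iff abs_of_nonneg mult_nonneg_nonneg real_sqrt_ge_zero zero_le_power)
      have "sg (mpow h k) \<le> A * q ^ k" by (rule sgk)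
      also have "\<dots> \<le> A * p ^ k" 
        using A p by (intro mult_left_mono power_mono) (auto simp: power2_eq_square mult_left_le)
      finally have 2: "sg (mpow h k) \<le> A * p ^ k" .
      have "\<bar>c\<bar> ^ k = norm (mpow h k *v v)" using mpow_eigenvector[OF v(2), of k] v(1) by (simp add: power_abs)
      also have "\<dots> \<le> opn (mpow h k) * (\<bar>W (mpow h k) \<bullet> v\<bar> + sg (mpow h k) * norm v)"
        by (rule near_rank_one_norm_le[OF UW[OF G]])
      also have "\<dots> \<le> opn (mpow h k) * ((sqrt A + A) * p ^ k)"
        using 1 2 v opn_nonneg by (intro mult_left_mono) (auto simp: algebra_simps)
      finally have "d * \<bar>c\<bar> ^ k \<le> (d * opn (mpow h k)) * ((sqrt A + A) * p ^ k)" using d by simp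
      also have "\<dots> \<le> \<bar>c\<bar> ^ k * ((sqrt A + A) * p ^ k)" using A p by (intro mult_right_mono op_le k) auto
      finally show ?thesis using c0 by (simp add: mult.commute)
    qed
    have "(\<lambda>k. (sqrt A + A) * p ^ k) \<longlonglongrightarrow> 0"
      using tendsto_mult[OF tendsto_const LIMSEQ_realpow_zero[OF p(1,2)], of "sqrt A + A"] by simp
    hence "d \<le> 0" by (rule tendsto_lowerbound) (auto intro: eventually_sequentiallyI[of m] low)
    thus False using d by simp
  qed
  hence wv: "0 < (w \<bullet> v)\<^sup>2" by simp
  define \<kappa> where "\<kappa> = sqrt ((w \<bullet> v)\<^sup>2 / 2)"
  have \<kappa>: "0 < \<kappa>" "\<kappa>\<^sup>2 = (w \<bullet> v)\<^sup>2 / 2" using wv by (auto simp: \<kappa>_def)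
  have "(\<lambda>k. Wl (mpow h k) \<bullet> outer v) \<longlonglongrightarrow> outer w \<bullet> outer v" by (intro tendsto_intros limW)
  hence "eventually (\<lambda>k. \<kappa>\<^sup>2 < Wl (mpow h k) \<bullet> outer v) sequentially"
    unfolding \<kappa> by (rule order_tendstoD(1)) (use wv in \<open>simp add: inner_outer\<close>)
  hence ev: "eventually (\<lambda>k. dist (Ul (mpow h k)) (outer v) \<le> 2 * sg (mpow h k) / \<kappa>) sequentially"
  proof eventually_elim
    case (elim k)
    hence "\<kappa>\<^sup>2 \<le> \<bar>W (mpow h k) \<bullet> v\<bar>\<^sup>2" by (simp add: inner_outer)
    hence "\<kappa> \<le> \<bar>W (mpow h k) \<bullet> v\<bar>" by (rule power2_le_imp_le) simp
    thus ?case
      by (intro image_near_top_line[OF UW[OF G] v(1) _ \<kappa>(1) opn_pos[OF G] v(1) mpow_eigenvector[OF v(2)] less_imp_le[OF sg_pos]])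
  qed
  have "(\<lambda>k. 2 * sg (mpow h k) / \<kappa>) \<longlonglongrightarrow> 2 * 0 / \<kappa>" using \<kappa> by (intro tendsto_intros sg0) auto
  hence "(\<lambda>k. dist (Ul (mpow h k)) (outer v)) \<longlonglongrightarrow> 0"
    by (intro tendsto_sandwich[OF _ ev tendsto_const]) auto
  thus ?thesis by (simp only: tendsto_dist_iff[symmetric])
qed

text \<open>\<open>W (mpow g k)\<close> is almost orthogonal to the line of the inverse power and
  uniformly transverse to the line of the power.\<close>

lemma undistorted_opposite_limits:
  assumes g: "undistorted g" and u: "(\<lambda>k. Ul (mpow g k)) \<longlonglongrightarrow> a"
    and u': "(\<lambda>k. Ul (mpow (matrix_inv g) k)) \<longlonglongrightarrow> b"
  shows "a \<noteq> b"
proof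
  assume "a = b"
  obtain u0 w d m A q where d: "0 < d" and q: "0 \<le> q" "q < 1"
    and sgk: "\<And>k. sg (mpow g k) \<le> A * q ^ k"
    and trans: "\<And>a b. m \<le> a \<Longrightarrow> m \<le> b \<Longrightarrow> d \<le> \<bar>W (mpow g a) \<bullet> U (mpow g b)\<bar>"
    using undistorted_powers[OF g] by metis
  have gG: "g \<in> \<Gamma>" using g by (simp add: undistorted_def)
  have G: "mpow g k \<in> \<Gamma>" for k using gG by (rule \<Gamma>_mpow)
  have "d\<^sup>2 - (A * q ^ k)\<^sup>2 \<le> dist (Ul (mpow g k)) (Ul (mpow (matrix_inv g) k))" if "m \<le> k" for k
  proof -
    let ?w = "W (mpow g k)"
    have "\<bar>?w \<bullet> U (mpow (matrix_inv g) k)\<bar> \<le> A * q ^ k"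
      using W_inv_orthogonal[OF G, of k] sgk[of k] by (simp add: mpow_inv[OF gG])
    hence "\<bar>U (mpow (matrix_inv g) k) \<bullet> ?w\<bar>\<^sup>2 \<le> (A * q ^ k)\<^sup>2" by (intro power_mono) (auto simp: inner_commute)
    moreover have "d\<^sup>2 \<le> \<bar>U (mpow g k) \<bullet> ?w\<bar>\<^sup>2"
      using trans[OF that that] d by (intro power_mono) (auto simp: inner_commute)
    ultimately have "d\<^sup>2 - (A * q ^ k)\<^sup>2 \<le> (U (mpow g k) \<bullet> ?w)\<^sup>2 - (U (mpow (matrix_inv g) k) \<bullet> ?w)\<^sup>2" by simp
    thus ?thesis using inner_outer_diff[OF norm_UW(2)[OF G], of "U (mpow g k)" k "U (mpow (matrix_inv g) k)"] by linarith
  qed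
  moreover have "(\<lambda>k. dist (Ul (mpow g k)) (Ul (mpow (matrix_inv g) k))) \<longlonglongrightarrow> dist a b"
    by (intro tendsto_dist u u')
  moreover have "(\<lambda>k. d\<^sup>2 - (A * q ^ k)\<^sup>2) \<longlonglongrightarrow> d\<^sup>2 - (A * 0)\<^sup>2"
    by (intro tendsto_intros LIMSEQ_realpow_zero q)
  ultimately have "d\<^sup>2 - (A * 0)\<^sup>2 \<le> dist a b"
    by (intro tendsto_le[OF trivial_limit_sequentially]) (auto simp: eventually_sequentially)
  thus False using d \<open>a = b\<close> by simp
qed

end

section \<open>The boundary map as a limit of singular lines\<close>

lemma span_normalize:
  fixes v :: "'a::real_normed_vector"
  assumes "v \<noteq> 0" shows "span {v} = span {(1 / norm v) *\<^sub>R v}"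
proof -
  have "v = norm v *\<^sub>R ((1 / norm v) *\<^sub>R v)" using assms by simp
  hence "v \<in> span {(1 / norm v) *\<^sub>R v}" by (metis insertI1 span_base span_scale)
  moreover have "(1 / norm v) *\<^sub>R v \<in> span {v}" by (intro span_scale span_base) simp
  ultimately show ?thesis by (intro antisym span_minimal) auto
qed

lemma mat_act_line_span: "mat_act_line g (span {v}) = span {g *v v}"
  unfolding mat_act_line_def using linear_span_image[of "(*v) g" "{v}"] by simp

context anosov_group
begin

section \<open>The action on boundary classes\<close>

lemma conv_translate:
  assumes g: "g \<in> \<Gamma>" and x: "conv_infty S \<Gamma> x"
  shows "conv_infty S \<Gamma> (\<lambda>i. g ** x i)"
  unfolding conv_infty_def
proof (intro conjI allI)
  show "g ** x k \<in> \<Gamma>" for k using g conv_in[OF x] by (rule \<Gamma>_mult)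
  fix M :: real
  obtain N where N: "\<forall>i\<ge>N. \<forall>j\<ge>N. M + wl g \<le> gp (x i) (x j)" using x unfolding conv_infty_def by blast
  have "M \<le> gp (g ** x i) (g ** x j)" if "i \<ge> N" "j \<ge> N" for i j
    using N that gp_translate[OF g conv_in[OF x] conv_in[OF x], of i j] by force
  thus "\<exists>N. \<forall>i\<ge>N. \<forall>j\<ge>N. M \<le> gp (g ** x i) (g ** x j)" by blast
qed

lemma equiv_translate:
  assumes g: "g \<in> \<Gamma>" and x: "\<And>i. x i \<in> \<Gamma>" "\<And>i. y i \<in> \<Gamma>" and xy: "seq_equiv S x y"
  shows "seq_equiv S (\<lambda>i. g ** x i) (\<lambda>i. g ** y i)"
  unfolding seq_equiv_def
proof
  fix M :: real
  obtain N where N: "\<forall>i\<ge>N. \<forall>j\<ge>N. M + wl g \<le> gp (x i) (y j)" using xy unfolding seq_equiv_def by blast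
  have "M \<le> gp (g ** x i) (g ** y j)" if "i \<ge> N" "j \<ge> N" for i j
    using N that gp_translate[OF g x(1)[of i] x(2)[of j]] by force
  thus "\<exists>N. \<forall>i\<ge>N. \<forall>j\<ge>N. M \<le> gp (g ** x i) (g ** y j)" by blast
qed

lemma bdry_act_class:
  assumes g: "g \<in> \<Gamma>" and x: "conv_infty S \<Gamma> x"
  shows "bdry_act g (bdry_class S \<Gamma> x) = bdry_class S \<Gamma> (\<lambda>i. g ** x i)"
proof
  show "bdry_act g (bdry_class S \<Gamma> x) \<subseteq> bdry_class S \<Gamma> (\<lambda>i. g ** x i)"
    using conv_translate[OF g] equiv_translate[OF g] conv_in x by (auto simp: bdry_act_def bdry_class_def)
  show "bdry_class S \<Gamma> (\<lambda>i. g ** x i) \<subseteq> bdry_act g (bdry_class S \<Gamma> x)"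
  proof
    fix z assume "z \<in> bdry_class S \<Gamma> (\<lambda>i. g ** x i)"
    hence z: "conv_infty S \<Gamma> z" "seq_equiv S (\<lambda>i. g ** x i) z" by (auto simp: bdry_class_def)
    let ?y = "\<lambda>i. matrix_inv g ** z i"
    have "conv_infty S \<Gamma> ?y" by (rule conv_translate[OF \<Gamma>_inv[OF g] z(1)])
    moreover have "seq_equiv S x ?y"
      using equiv_translate[OF \<Gamma>_inv[OF g] _ conv_in[OF z(1)] z(2)] g conv_in[OF x] by (simp add: \<Gamma>_mult)
    ultimately have "?y \<in> bdry_class S \<Gamma> x" by (simp add: bdry_class_def)
    moreover have "z = (\<lambda>i. g ** ?y i)" using g by simp
    ultimately show "z \<in> bdry_act g (bdry_class S \<Gamma> x)" unfolding bdry_act_def by (intro image_eqI[where x = ?y])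
  qed
qed

lemma class_self: "conv_infty S \<Gamma> x \<Longrightarrow> x \<in> bdry_class S \<Gamma> x"
  by (simp add: bdry_class_def seq_equiv_def) (simp add: conv_infty_def)

lemma sg_tendsto_0:
  assumes x: "conv_infty S \<Gamma> x" shows "(\<lambda>i. sg (x i)) \<longlonglongrightarrow> 0"
proof (rule LIMSEQ_I)
  fix e :: real assume "0 < e"
  then obtain m where m: "\<And>g. g \<in> \<Gamma> \<Longrightarrow> m \<le> wl g \<Longrightarrow> sg g < e" using sg_small by blast
  obtain N where "\<forall>i\<ge>N. real m \<le> wl (x i)" using conv_wl[OF x] by blast
  thus "\<exists>N. \<forall>n\<ge>N. norm (sg (x n) - 0) < e"
    using m conv_in[OF x] sg_pos by (intro exI[of _ N]) (auto simp: less_imp_le)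
qed

text \<open>Of the two fixed lines of \<open>g\<close>, at least one is far from
  \<open>U (matrix_inv (x k))\<close>. For it the Gromov products of \<open>matrix_inv (x k)\<close>
  with high powers are bounded uniformly in \<open>k\<close>. This is used twice: in the group it
  makes the translated fixed point converge to the class of \<open>x\<close>, and in projective
  space it makes \<open>x k\<close> send the fixed line near \<open>U (x k)\<close>. Continuity and
  equivariance identify the limits.\<close>

lemma boundary_map_is_limit:
  fixes \<xi> :: "(nat \<Rightarrow> real ^ 'n ^ 'n) set \<Rightarrow> (real ^ 'n) set"
  assumes \<xi>_range: "\<xi> ` gromov_bdry S \<Gamma> \<subseteq> proj_space"
    and \<xi>_cont: "\<And>a b. (\<forall>k. a k \<in> gromov_bdry S \<Gamma>) \<Longrightarrow> b \<in> gromov_bdry S \<Gamma> \<Longrightarrow>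
                  bdry_tendsto S a b \<Longrightarrow> (\<lambda>k. line_dist (\<xi> (a k)) (\<xi> b)) \<longlonglongrightarrow> 0"
    and \<xi>_equiv: "\<And>g a. g \<in> \<Gamma> \<Longrightarrow> a \<in> gromov_bdry S \<Gamma> \<Longrightarrow>
                  \<xi> (bdry_act g a) = mat_act_line g (\<xi> a)"
    and \<xi>_eig: "\<And>g. g \<in> \<Gamma> \<Longrightarrow> (\<forall>k>0. mpow g k \<noteq> mat 1) \<Longrightarrow>
                  \<exists>c::real. \<exists>v. complex_of_real c \<in> complex_eigenvalues g \<and>
                     (\<forall>z \<in> complex_eigenvalues g. z \<noteq> complex_of_real c \<longrightarrow> cmod z < \<bar>c\<bar>) \<and>
                     v \<noteq> 0 \<and> g *v v = c *\<^sub>R v \<and> \<xi> (attr_pt S \<Gamma> g) = span {v}"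
    and x: "conv_infty S \<Gamma> x"
  shows "\<exists>v. norm v = 1 \<and> \<xi> (bdry_class S \<Gamma> x) = span {v} \<and> (\<lambda>i. Ul (x i)) \<longlonglongrightarrow> outer v"
proof -
  have xG: "x k \<in> \<Gamma>" for k using x by (rule conv_in)
  have xiG: "matrix_inv (x k) \<in> \<Gamma>" for k using xG by (rule \<Gamma>_inv)
  obtain q where "\<And>j. q j \<in> \<Gamma>" "\<And>j. wl (q j) = j" "\<And>j. \<exists>s\<in>T. q (Suc j) = q j ** s"
    using geodesic_ray[OF x] by blast
  then obtain g where g: "undistorted g" using exists_undistorted by blast
  let ?g' = "matrix_inv g"
  have g': "undistorted ?g'" using g by (rule undistorted_inv)
  have attr: "\<exists>v. norm v = 1 \<and> \<xi> (attr_pt S \<Gamma> h) = span {v} \<and> (\<lambda>k. Ul (mpow h k)) \<longlonglongrightarrow> outer v"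
    if h: "undistorted h" for h
  proof -
    have "h \<in> \<Gamma>" using h by (simp add: undistorted_def)
    then obtain c v where v: "\<And>z. z \<in> complex_eigenvalues h \<Longrightarrow> z \<noteq> complex_of_real c \<Longrightarrow> cmod z < \<bar>c\<bar>"
      "v \<noteq> 0" "h *v v = c *\<^sub>R v" "\<xi> (attr_pt S \<Gamma> h) = span {v}"
      using \<xi>_eig undistorted_infinite_order[OF h] by metis
    let ?v = "(1 / norm v) *\<^sub>R v"
    have "cmod z \<le> \<bar>c\<bar>" if "z \<in> complex_eigenvalues h" for z
      using v(1)[OF that] by (cases "z = complex_of_real c") auto
    moreover have "norm ?v = 1" "h *v ?v = c *\<^sub>R ?v" using v by (auto simp: matrix_vector_mult_scaleR)
    ultimately have "(\<lambda>k. Ul (mpow h k)) \<longlonglongrightarrow> outer ?v" by (intro power_limit_is_top_eigenline[OF h])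
    thus ?thesis using \<open>norm ?v = 1\<close> v(4) span_normalize[OF v(2)] by (intro exI[of _ ?v]) simp
  qed
  obtain p where p: "norm p = 1" "\<xi> (attr_pt S \<Gamma> g) = span {p}" "(\<lambda>k. Ul (mpow g k)) \<longlonglongrightarrow> outer p"
    using attr[OF g] by blast
  obtain p' where p': "norm p' = 1" "\<xi> (attr_pt S \<Gamma> ?g') = span {p'}" "(\<lambda>k. Ul (mpow ?g' k)) \<longlonglongrightarrow> outer p'"
    using attr[OF g'] by blast
  \<comment> \<open>A quarter, so that a line within \<open>2 * \<rho>\<close> of one fixed line is
    at least \<open>2 * \<rho>\<close> away from the other.\<close>
  define \<rho> where "\<rho> = dist (outer p) (outer p') / 4"
  have \<rho>: "0 < \<rho>" using undistorted_opposite_limits[OF g p(3) p'(3)] by (simp add: \<rho>_def)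
  define far where "far k \<longleftrightarrow> 2 * \<rho> \<le> dist (Ul (matrix_inv (x k))) (outer p)" for k
  define h where "h k = (if far k then g else ?g')" for k
  define v where "v k = (if far k then p else p')" for k
  have h: "undistorted (h k)" and v: "norm (v k) = 1" "\<xi> (attr_pt S \<Gamma> (h k)) = span {v k}"
    and hlim: "(\<lambda>n. Ul (mpow (h k) n)) \<longlonglongrightarrow> outer (v k)" for k
    using g g' p p' by (simp_all add: h_def v_def)
  have hG: "mpow (h k) n \<in> \<Gamma>" for k n using h[of k] \<Gamma>_mpow by (simp add: undistorted_def)
  have hconv: "conv_infty S \<Gamma> (mpow (h k))" for k using undistorted_powers[OF h[of k]] by metis
  have v_far: "2 * \<rho> \<le> dist (Ul (matrix_inv (x k))) (outer (v k))" for k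
    using dist_triangle2[of "outer p" "outer p'" "Ul (matrix_inv (x k))"]
    by (auto simp: v_def far_def \<rho>_def dist_commute)
  obtain M where M: "\<And>t. M \<le> t \<Longrightarrow> H * exp (- C * t) < \<rho>" using exp_gp_small[OF \<rho>] by blast
  \<comment> \<open>By \<open>U_hoelder\<close> a large product would make the lines close. The
    bound \<open>M\<close> is independent of \<open>k\<close>; only \<open>N\<close> may vary with
    it.\<close>
  have "\<exists>N. \<forall>n\<ge>N. gp (matrix_inv (x k)) (mpow (h k) n) < M" for k
  proof -
    have "(\<lambda>n. dist (Ul (matrix_inv (x k))) (Ul (mpow (h k) n))) \<longlonglongrightarrow> dist (Ul (matrix_inv (x k))) (outer (v k))"
      by (intro tendsto_intros hlim)
    moreover have "\<rho> < dist (Ul (matrix_inv (x k))) (outer (v k))" using v_far[of k] \<rho> by simp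
    ultimately have "eventually (\<lambda>n. \<rho> < dist (Ul (matrix_inv (x k))) (Ul (mpow (h k) n))) sequentially"
      by (rule order_tendstoD(1))
    then obtain N where N: "\<And>n. n \<ge> N \<Longrightarrow> \<rho> < dist (Ul (matrix_inv (x k))) (Ul (mpow (h k) n))"
      unfolding eventually_sequentially by blast
    have "gp (matrix_inv (x k)) (mpow (h k) n) < M" if "n \<ge> N" for n
      using N[OF that] M[of "gp (matrix_inv (x k)) (mpow (h k) n)"] U_hoelder[OF xiG hG, of k k n] by force
    thus ?thesis by blast
  qed
  then obtain N where N: "\<And>k n. N k \<le> n \<Longrightarrow> gp (matrix_inv (x k)) (mpow (h k) n) < M" by metis
  let ?b = "bdry_class S \<Gamma> x"
  define a where "a k = bdry_act (x k) (attr_pt S \<Gamma> (h k))" for k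
  have a_eq: "a k = bdry_class S \<Gamma> (\<lambda>n. x k ** mpow (h k) n)" for k
    unfolding a_def attr_pt_def by (rule bdry_act_class[OF xG hconv])
  have a_conv: "conv_infty S \<Gamma> (\<lambda>n. x k ** mpow (h k) n)" for k by (rule conv_translate[OF xG hconv])
  have a_in: "a k \<in> gromov_bdry S \<Gamma>" for k unfolding a_eq gromov_bdry_def using a_conv by simp
  have b_in: "?b \<in> gromov_bdry S \<Gamma>" unfolding gromov_bdry_def using x by simp
  have "bdry_tendsto S a ?b"
    unfolding bdry_tendsto_def
  proof
    fix B :: real
    obtain B1 where B1: "\<And>x y z. x \<in> \<Gamma> \<Longrightarrow> y \<in> \<Gamma> \<Longrightarrow> z \<in> \<Gamma> \<Longrightarrow> B1 \<le> gp x y \<Longrightarrow> B1 \<le> gp y z \<Longrightarrow> B \<le> gp x z"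
      using weak_ultrametric[of B] by blast
    obtain K1 where K1: "\<forall>i\<ge>K1. B1 + M \<le> wl (x i)" using conv_wl[OF x] by blast
    obtain K2 where K2: "\<forall>i\<ge>K2. \<forall>j\<ge>K2. B1 \<le> gp (x i) (x j)" using x unfolding conv_infty_def by blast
    have "\<exists>y\<in>a k. \<exists>z\<in>?b. \<exists>N. \<forall>i\<ge>N. \<forall>j\<ge>N. B \<le> gp (y i) (z j)" if k: "k \<ge> max K1 K2" for k
    proof (intro bexI exI allI impI)
      show "(\<lambda>n. x k ** mpow (h k) n) \<in> a k" unfolding a_eq by (rule class_self[OF a_conv])
      show "x \<in> ?b" by (rule class_self[OF x])
      fix i j assume ij: "max (N k) K2 \<le> i" "max (N k) K2 \<le> j"
      show "B \<le> gp (x k ** mpow (h k) i) (x j)"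
      \<comment> \<open>\<open>x k\<close> is the intermediate point: close to the translated powers
        by \<open>gp_mult\<close>, and to the tail of \<open>x\<close> by convergence.\<close>
      proof (rule B1[of _ "x k"])
        show "B1 \<le> gp (x k ** mpow (h k) i) (x k)"
          using gp_mult[OF xG hG, of k k i] N[of k i] K1 ij k by force
        show "B1 \<le> gp (x k) (x j)" using K2 ij k by simp
      qed (simp_all add: xG hG \<Gamma>_mult)
    qed
    thus "\<exists>K. \<forall>k\<ge>K. \<exists>y\<in>a k. \<exists>z\<in>?b. \<exists>N. \<forall>i\<ge>N. \<forall>j\<ge>N. B \<le> gp (y i) (z j)" by blast
  qed
  hence lim: "(\<lambda>k. line_dist (\<xi> (a k)) (\<xi> ?b)) \<longlonglongrightarrow> 0" using a_in b_in by (intro \<xi>_cont) auto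
  have "\<xi> ?b \<in> proj_space" using \<xi>_range b_in by blast
  then obtain y0 where "y0 \<noteq> 0" "\<xi> ?b = span {y0}" by (auto simp: proj_space_def)
  then obtain y where y: "norm y = 1" "\<xi> ?b = span {y}"
    using span_normalize[of y0] by (metis norm_eq_zero norm_sgn sgn_div_norm divide_inverse mult_1)
  define z where "z k = (1 / norm (x k *v v k)) *\<^sub>R (x k *v v k)" for k
  have xv: "x k *v v k \<noteq> 0" for k
  proof
    assume "x k *v v k = 0"
    hence "matrix_inv (x k) *v (x k *v v k) = 0" by simp
    hence "v k = 0" using xG[of k] by (simp add: matrix_vector_mul_assoc \<Gamma>_invertible)
    thus False using v(1)[of k] by simp
  qed
  have z: "norm (z k) = 1" for k using xv by (simp add: z_def)
  have "attr_pt S \<Gamma> (h k) \<in> gromov_bdry S \<Gamma>" for k unfolding attr_pt_def gromov_bdry_def using hconv by simp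
  hence "\<xi> (a k) = span {x k *v v k}" for k
    unfolding a_def by (subst \<xi>_equiv[OF xG]) (simp_all add: v mat_act_line_span)
  hence "\<xi> (a k) = span {z k}" for k using span_normalize[OF xv] by (simp add: z_def)
  hence "(\<lambda>k. line_dist (span {z k}) (span {y})) \<longlonglongrightarrow> 0" using lim y by simp
  hence zlim: "(\<lambda>k. outer (z k)) \<longlonglongrightarrow> outer y" by (rule line_dist_tendsto_0_imp[OF z y(1)])
  obtain c m where c: "0 < c" and m: "\<And>x z. x \<in> \<Gamma> \<Longrightarrow> z \<in> \<Gamma> \<Longrightarrow> gp x z \<le> M \<Longrightarrow> m \<le> wl x \<Longrightarrow> m \<le> wl z \<Longrightarrow> c \<le> \<bar>W (matrix_inv x) \<bullet> U z\<bar>"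
    using transversality[of M] by blast
  \<comment> \<open>The bounded products make \<open>v k\<close> transverse to
    \<open>W (x k)\<close> in the limit over \<open>n\<close>, and \<open>x k\<close> sends such a
    line close to \<open>U (x k)\<close>.\<close>
  have near: "dist (Ul (x k)) (outer (z k)) \<le> 2 * sg (x k) / c" if k: "m \<le> wl (x k)" for k
  proof -
    obtain N' where N': "\<forall>n\<ge>N'. real m \<le> wl (mpow (h k) n)" using conv_wl[OF hconv] by blast
    have "c\<^sup>2 \<le> Ul (mpow (h k) n) \<bullet> Wl (x k)" if "n \<ge> max N' (N k)" for n
    proof -
      have "c \<le> \<bar>W (matrix_inv (matrix_inv (x k))) \<bullet> U (mpow (h k) n)\<bar>"
        using N[of k n] N' that k by (intro m xiG hG) (auto simp: wl_inv xG)
      hence "c \<le> \<bar>U (mpow (h k) n) \<bullet> W (x k)\<bar>" by (simp add: matrix_inv_inv \<Gamma>_invertible xG inner_commute)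
      thus ?thesis unfolding inner_outer using c by (metis abs_le_square_iff abs_of_pos)
    qed
    hence "eventually (\<lambda>n. c\<^sup>2 \<le> Ul (mpow (h k) n) \<bullet> Wl (x k)) sequentially"
      by (rule eventually_sequentiallyI)
    moreover have "(\<lambda>n. Ul (mpow (h k) n) \<bullet> Wl (x k)) \<longlonglongrightarrow> outer (v k) \<bullet> Wl (x k)"
      by (intro tendsto_intros hlim)
    ultimately have "c\<^sup>2 \<le> outer (v k) \<bullet> Wl (x k)" by (intro tendsto_lowerbound) auto
    hence "c\<^sup>2 \<le> \<bar>W (x k) \<bullet> v k\<bar>\<^sup>2" by (simp add: inner_outer inner_commute)
    hence "c \<le> \<bar>W (x k) \<bullet> v k\<bar>" by (rule power2_le_imp_le) simp
    moreover have "x k *v v k = norm (x k *v v k) *\<^sub>R z k" using xv by (simp add: z_def)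
    ultimately show ?thesis
      by (intro image_near_top_line[OF UW[OF xG] v(1) _ c opn_pos[OF xG] z _ less_imp_le[OF sg_pos]])
  qed
  obtain N0 where "\<forall>k\<ge>N0. real m \<le> wl (x k)" using conv_wl[OF x] by blast
  hence ev: "eventually (\<lambda>k. dist (Ul (x k)) (outer (z k)) \<le> 2 * sg (x k) / c) sequentially"
    using near by (intro eventually_sequentiallyI[of N0]) auto
  have "(\<lambda>k. 2 * sg (x k) / c) \<longlonglongrightarrow> 2 * 0 / c" using c by (intro tendsto_intros sg_tendsto_0 x) auto
  hence "(\<lambda>k. dist (Ul (x k)) (outer (z k))) \<longlonglongrightarrow> 0"
    by (intro tendsto_sandwich[OF _ ev tendsto_const]) auto
  hence "(\<lambda>k. Ul (x k) - outer (z k)) \<longlonglongrightarrow> 0" by (simp add: dist_norm tendsto_norm_zero_iff)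
  from tendsto_add[OF this zlim] have "(\<lambda>k. Ul (x k)) \<longlonglongrightarrow> outer y" by simp
  thus ?thesis using y by blast
qed

end

section \<open>Covering the limit set\<close>

lemma hausdorff_approx_le:
  assumes G: "countable G" and cov: "E \<subseteq> (\<Union>g\<in>G. V g)" and VX: "\<And>g. g \<in> G \<Longrightarrow> V g \<subseteq> X"
    and diam: "\<And>g. g \<in> G \<Longrightarrow> diam_d d (V g) \<le> \<delta>" and \<delta>: "0 \<le> \<delta>"
    and f: "\<And>g. g \<in> G \<Longrightarrow> diam_d d (V g) powr s \<le> f g"
    and sum: "\<And>F. finite F \<Longrightarrow> F \<subseteq> G \<Longrightarrow> sum f F \<le> \<eta>"
  shows "hausdorff_approx X d s \<delta> E \<le> ennreal \<eta>"
proof -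
  define I where "I = to_nat_on G ` G"
  define Uf where "Uf i = (if i \<in> I then V (from_nat_into G i) else {})" for i
  have from_to: "from_nat_into G (to_nat_on G g) = g" if "g \<in> G" for g using G that by simp
  have fI: "from_nat_into G i \<in> G" if "i \<in> I" for i using that from_to by (auto simp: I_def)
  have inj: "inj_on (from_nat_into G) I" by (rule inj_onI) (auto simp: I_def from_to)
  have empty: "diam_d d {} = 0" by (simp add: diam_d_def)
  have "E \<subseteq> (\<Union>i. Uf i)"
  proof
    fix l assume "l \<in> E"
    then obtain g where "g \<in> G" "l \<in> V g" using cov by blast
    hence "l \<in> Uf (to_nat_on G g)" by (simp add: Uf_def I_def from_to)
    thus "l \<in> (\<Union>i. Uf i)" by blast
  qed
  moreover have "Uf i \<subseteq> X \<and> diam_d d (Uf i) \<le> \<delta>" for i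
    using VX[OF fI] diam[OF fI] \<delta> by (auto simp: Uf_def empty)
  ultimately have "hausdorff_approx X d s \<delta> E \<le> (\<Sum>i. ennreal (diam_d d (Uf i) powr s))"
    unfolding hausdorff_approx_def by (intro INF_lower) auto
  also have "\<dots> \<le> ennreal \<eta>"
  proof (rule suminf_le_const)
    fix n
    have "(\<Sum>i<n. ennreal (diam_d d (Uf i) powr s)) = ennreal (\<Sum>i<n. diam_d d (Uf i) powr s)" by (rule sum_ennreal) simp
    also have "(\<Sum>i<n. diam_d d (Uf i) powr s) = (\<Sum>i\<in>{..<n} \<inter> I. diam_d d (V (from_nat_into G i)) powr s)"
      by (intro sum.mono_neutral_cong_right) (auto simp: Uf_def empty)
    also have "\<dots> \<le> (\<Sum>i\<in>{..<n} \<inter> I. f (from_nat_into G i))" by (intro sum_mono f fI) auto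
    also have "\<dots> = sum f (from_nat_into G ` ({..<n} \<inter> I))"
      by (rule sum.reindex_cong[symmetric, OF _ refl refl]) (rule inj_on_subset[OF inj], auto)
    also have "\<dots> \<le> \<eta>" using fI by (intro sum) auto
    finally show "(\<Sum>i<n. ennreal (diam_d d (Uf i) powr s)) \<le> ennreal \<eta>" by (simp add: ennreal_leI)
  qed simp
  finally show ?thesis .
qed

context anosov_group
begin

section \<open>Orbit counting and the covering by shadows\<close>

definition "\<alpha> g = mu 1 g - mu 2 g" for g :: "'n mat"

lemma sg_powr: "sg g powr t = exp (- t * \<alpha> g)" by (simp add: sg_def \<alpha>_def powr_def algebra_simps)

text \<open>The gap inequality bounds the word length, so every \<open>card\<close> in
  \<open>delta12\<close> counts a finite set rather than taking the default value 0.\<close>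

lemma finite_\<alpha>: "finite {g \<in> \<Gamma>. \<alpha> g \<le> R}"
proof (rule finite_subset[OF _ finite_ball])
  show "{g \<in> \<Gamma>. \<alpha> g \<le> R} \<subseteq> {g \<in> \<Gamma>. wl g \<le> nat \<lceil>(R + C') / C\<rceil>}"
  proof safe
    fix g assume g: "g \<in> \<Gamma>" "\<alpha> g \<le> R"
    have "C * real (wl g) \<le> R + C'" using gap[OF g(1)] g(2) by (simp add: \<alpha>_def)
    hence "real (wl g) \<le> (R + C') / C" using C by (simp add: field_simps)
    thus "wl g \<le> nat \<lceil>(R + C') / C\<rceil>" by linarith
  qed
qed

text \<open>The identity is counted as soon as \<open>R\<close> is large, so the logarithm is not
  negative. Exponents above \<open>delta12\<close> are thereby positive.\<close>

lemma delta12_nonneg: "0 \<le> delta12 \<Gamma>"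
  unfolding delta12_def
proof (rule le_Limsup)
  show "eventually (\<lambda>R. 0 \<le> ereal (ln (real (card {\<gamma> \<in> \<Gamma>. mu 1 \<gamma> - mu 2 \<gamma> \<le> R})) / R)) at_top"
    using eventually_ge_at_top[of "max 1 (\<alpha> (mat 1))"]
  proof eventually_elim
    case (elim R)
    have "mat 1 \<in> {\<gamma> \<in> \<Gamma>. mu 1 \<gamma> - mu 2 \<gamma> \<le> R}" using elim \<Gamma>_1 by (simp add: \<alpha>_def)
    moreover have "finite {\<gamma> \<in> \<Gamma>. mu 1 \<gamma> - mu 2 \<gamma> \<le> R}" using finite_\<alpha>[of R] by (simp add: \<alpha>_def)
    ultimately have "0 < card {\<gamma> \<in> \<Gamma>. mu 1 \<gamma> - mu 2 \<gamma> \<le> R}" using card_gt_0_iff by blast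
    hence "1 \<le> card {\<gamma> \<in> \<Gamma>. mu 1 \<gamma> - mu 2 \<gamma> \<le> R}" by simp
    thus ?case using elim by simp
  qed
qed simp

lemma card_growth:
  assumes "delta12 \<Gamma> < ereal r"
  obtains R0 where "0 < R0" "\<And>R. R0 \<le> R \<Longrightarrow> real (card {g \<in> \<Gamma>. \<alpha> g \<le> R}) \<le> exp (r * R)"
proof -
  have "eventually (\<lambda>R. ereal (ln (real (card {\<gamma> \<in> \<Gamma>. mu 1 \<gamma> - mu 2 \<gamma> \<le> R})) / R) < ereal r) at_top"
    using assms unfolding delta12_def by (rule Limsup_lessD)
  then obtain R1 where R1: "\<And>R. R1 \<le> R \<Longrightarrow> ln (real (card {g \<in> \<Gamma>. \<alpha> g \<le> R})) / R < r"
    by (auto simp: eventually_at_top_linorder \<alpha>_def)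
  have "real (card {g \<in> \<Gamma>. \<alpha> g \<le> R}) \<le> exp (r * R)" if "max 1 R1 \<le> R" for R
  proof (cases "card {g \<in> \<Gamma>. \<alpha> g \<le> R} = 0")
    case False
    have "ln (real (card {g \<in> \<Gamma>. \<alpha> g \<le> R})) \<le> r * R" using R1[of R] that by (simp add: field_simps)
    hence "exp (ln (real (card {g \<in> \<Gamma>. \<alpha> g \<le> R}))) \<le> exp (r * R)" by simp
    thus ?thesis using False by simp
  qed (simp only: of_nat_0 exp_ge_zero)
  thus ?thesis using that[of "max 1 R1"] by simp
qed

text \<open>Group the elements by \<open>\<alpha>\<close> rounded up: level \<open>n\<close> has at
  most exp(r n) elements, each contributing at most exp(t) exp(- t n), which leaves a geometric
  series of ratio exp(-(t - r)).\<close>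

lemma poincare_tail:
  assumes t: "delta12 \<Gamma> < ereal t" and \<eta>: "0 < \<eta>"
  shows "\<exists>R. \<forall>F. finite F \<longrightarrow> F \<subseteq> {g \<in> \<Gamma>. R < \<alpha> g} \<longrightarrow> (\<Sum>g\<in>F. exp (- t * \<alpha> g)) \<le> \<eta>"
proof -
  obtain r where r: "delta12 \<Gamma> < ereal r" "r < t" using ereal_dense2[OF t] by auto
  obtain R0 where R0: "0 < R0" and card: "\<And>R. R0 \<le> R \<Longrightarrow> real (card {g \<in> \<Gamma>. \<alpha> g \<le> R}) \<le> exp (r * R)"
    using card_growth[OF r(1)] by blast
  have "0 < ereal t" using delta12_nonneg t by (rule le_less_trans)
  hence tpos: "0 < t" by simp
  define \<theta> where "\<theta> = exp (- (t - r))"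
  have \<theta>: "0 \<le> \<theta>" "\<theta> < 1" using r by (auto simp: \<theta>_def)
  have "(\<lambda>n. exp t / (1 - \<theta>) * \<theta> ^ n) \<longlonglongrightarrow> 0"
    using tendsto_mult[OF tendsto_const LIMSEQ_realpow_zero[OF \<theta>], of "exp t / (1 - \<theta>)"] by simp
  from order_tendstoD(2)[OF this \<eta>] obtain n0 where n0: "\<And>n. n0 \<le> n \<Longrightarrow> exp t / (1 - \<theta>) * \<theta> ^ n < \<eta>"
    unfolding eventually_sequentially by blast
  define n1 where "n1 = n0 + nat \<lceil>R0\<rceil>"
  have n1: "n0 \<le> n1" "R0 \<le> real n1" by (auto simp: n1_def) linarith
  have "(\<Sum>g\<in>F. exp (- t * \<alpha> g)) \<le> \<eta>" if F: "finite F" "F \<subseteq> {g \<in> \<Gamma>. real n1 < \<alpha> g}" for F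
  proof -
    define lev where "lev g = nat \<lceil>\<alpha> g\<rceil>" for g
    have lev: "\<alpha> g \<le> real (lev g)" "real (lev g) < \<alpha> g + 1" "n1 \<le> lev g" if "g \<in> F" for g
    proof -
      have "real n1 < \<alpha> g" using that F by auto
      thus "\<alpha> g \<le> real (lev g)" "real (lev g) < \<alpha> g + 1" "n1 \<le> lev g" unfolding lev_def by linarith+
    qed
    have "(\<Sum>g\<in>F. exp (- t * \<alpha> g)) \<le> (\<Sum>g\<in>F. exp t * exp (- t * real (lev g)))"
    proof (intro sum_mono)
      fix g assume "g \<in> F"
      hence "t * real (lev g) \<le> t * (\<alpha> g + 1)" using lev tpos by (intro mult_left_mono) (auto intro: less_imp_le)
      thus "exp (- t * \<alpha> g) \<le> exp t * exp (- t * real (lev g))" by (simp add: algebra_simps flip: exp_add)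
    qed
    also have "\<dots> = (\<Sum>n\<in>lev ` F. \<Sum>g\<in>{g \<in> F. lev g = n}. exp t * exp (- t * real (lev g)))"
      using F(1) by (rule sum.image_gen)
    also have "\<dots> \<le> (\<Sum>n\<in>lev ` F. exp t * \<theta> ^ n)"
    proof (intro sum_mono)
      fix n assume "n \<in> lev ` F"
      hence "n1 \<le> n" using lev by auto
      hence nR: "R0 \<le> real n" using n1 by linarith
      have "card {g \<in> F. lev g = n} \<le> card {g \<in> \<Gamma>. \<alpha> g \<le> real n}"
        using F(2) lev(1) by (intro card_mono finite_\<alpha>) auto
      hence "real (card {g \<in> F. lev g = n}) \<le> exp (r * real n)" using card[OF nR] by linarith
      hence "real (card {g \<in> F. lev g = n}) * (exp t * exp (- t * real n)) \<le> exp (r * real n) * (exp t * exp (- t * real n))"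
        by (intro mult_right_mono) auto
      also have "\<dots> = exp t * \<theta> ^ n"
        by (simp add: \<theta>_def algebra_simps flip: exp_add exp_of_nat_mult)
      finally show "(\<Sum>g\<in>{g \<in> F. lev g = n}. exp t * exp (- t * real (lev g))) \<le> exp t * \<theta> ^ n" by simp
    qed
    finally have "(\<Sum>g\<in>F. exp (- t * \<alpha> g)) \<le> (\<Sum>n\<in>lev ` F. exp t * \<theta> ^ n)" .
    have ge: "n1 \<le> n" if "n \<in> lev ` F" for n using lev(3) that by auto
    have inj: "inj_on (\<lambda>n. n - n1) (lev ` F)" by (rule inj_onI) (metis eq_diff_iff ge)
    note \<open>(\<Sum>g\<in>F. exp (- t * \<alpha> g)) \<le> (\<Sum>n\<in>lev ` F. exp t * \<theta> ^ n)\<close>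
    also have "(\<Sum>n\<in>lev ` F. exp t * \<theta> ^ n) = exp t * \<theta> ^ n1 * (\<Sum>n\<in>lev ` F. \<theta> ^ (n - n1))"
      unfolding sum_distrib_left using lev(3) by (intro sum.cong) (auto simp: mult.assoc simp flip: power_add)
    also have "(\<Sum>n\<in>lev ` F. \<theta> ^ (n - n1)) = (\<Sum>k\<in>(\<lambda>n. n - n1) ` (lev ` F). \<theta> ^ k)"
      by (rule sum.reindex_cong[symmetric, OF inj refl refl])
    also have "\<dots> \<le> (\<Sum>k. \<theta> ^ k)" using \<theta> F by (intro sum_le_suminf summable_geometric) auto
    also have "(\<Sum>k. \<theta> ^ k) = 1 / (1 - \<theta>)" using \<theta> by (intro suminf_geometric) auto
    finally have "(\<Sum>g\<in>F. exp (- t * \<alpha> g)) \<le> exp t * \<theta> ^ n1 * (1 / (1 - \<theta>))" by (simp add: mult_left_mono \<theta>)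
    thus ?thesis using n0[OF n1(1)] by (simp add: ac_simps)
  qed
  thus ?thesis by blast
qed

text \<open>Choosing the point of the ray beyond \<open>k0\<close> with the smallest gap makes the whole tail of steps
  summable against a power \<open>1 - e\<close> of that single gap.\<close>

lemma ray_shadow:
  assumes q: "\<And>j. q j \<in> \<Gamma>" "\<And>j. wl (q j) = j" "\<And>j. \<exists>s\<in>T. q (Suc j) = q j ** s"
    and lim: "(\<lambda>j. Ul (q j)) \<longlonglongrightarrow> z" and e: "0 < e" "e < 1"
  shows "\<exists>g\<in>\<Gamma>. k0 \<le> wl g \<and> dist (Ul g) z \<le> 2 * K\<^sup>2 * exp (e * C') / (1 - exp (- (e * C))) * sg g powr (1 - e)"
proof -
  define f where "f j = sg (q j)" for j
  have fpos: "0 < f j" for j by (simp add: f_def sg_pos)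
  have f_le: "f j \<le> exp (C' - C * real j)" for j using sg_le[OF q(1), of j] by (simp add: f_def q(2))
  \<comment> \<open>From length \<open>n\<close> on every ratio is below that of
    \<open>q k0\<close>, so the largest ratio of the infinite tail is attained in the window from
    \<open>k0\<close> to \<open>k0 + n\<close>.\<close>
  obtain n where n: "\<And>g. g \<in> \<Gamma> \<Longrightarrow> n \<le> wl g \<Longrightarrow> sg g < f k0" using sg_small[OF fpos[of k0]] by blast
  have "Max (f ` {k0..k0 + n}) \<in> f ` {k0..k0 + n}" by (intro Max_in) auto
  then obtain k where k: "k \<in> {k0..k0 + n}" and fk: "f k = Max (f ` {k0..k0 + n})" by (metis imageE)
  have kmax: "f j \<le> f k" if "j \<in> {k0..k0 + n}" for j unfolding fk using that by (intro Max_ge) auto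
  have max: "f j \<le> f k" if "k0 \<le> j" for j
  proof (cases "j \<le> k0 + n")
    case False
    hence "f j < f k0" unfolding f_def[of j] by (intro n q(1)) (simp add: q(2))
    thus ?thesis using kmax[of k0] by simp
  qed (use kmax that in auto)
  define \<theta> where "\<theta> = exp (- (e * C))"
  have \<theta>: "0 \<le> \<theta>" "\<theta> < 1" using e C by (auto simp: \<theta>_def)
  define A where "A = 2 * K\<^sup>2 * exp (e * C') * f k powr (1 - e)"
  have step: "dist (Ul (q (k + i))) (Ul (q (k + Suc i))) \<le> A * \<theta> ^ i" for i
  proof -
    obtain s where s: "s \<in> T" "q (Suc (k + i)) = q (k + i) ** s" using q(3) by blast
    have 1: "dist (Ul (q (k + i))) (Ul (q (k + Suc i))) \<le> 2 * K\<^sup>2 * f (k + i)"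
      using U_generator_step[OF q(1) s(1), of "k + i"] s(2) by (simp add: f_def)
    \<comment> \<open>The power \<open>1 - e\<close> is compared with the maximal ratio; the power
      \<open>e\<close> is spent on the Anosov inequality, whose bound decays geometrically in
      \<open>i\<close>.\<close>
    have "f (k + i) = f (k + i) powr (1 - e) * f (k + i) powr e" using fpos[of "k + i"] by (simp flip: powr_add)
    also have "\<dots> \<le> f k powr (1 - e) * (exp (e * C') * \<theta> ^ i)"
    proof (rule mult_mono)
      show "f (k + i) powr (1 - e) \<le> f k powr (1 - e)"
        using e max[of "k + i"] k less_imp_le[OF fpos] by (intro powr_mono2) auto
      have "f (k + i) powr e \<le> exp (C' - C * real (k + i)) powr e"
        using e less_imp_le[OF fpos] by (intro powr_mono2 f_le) auto
      also have "\<dots> = exp (e * C' + - (e * C * real k) + real i * - (e * C))" by (simp add: powr_def algebra_simps)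
      also have "\<dots> \<le> exp (e * C' + real i * - (e * C))" using e C by simp
      also have "\<dots> = exp (e * C') * \<theta> ^ i" unfolding \<theta>_def exp_add exp_of_nat_mult ..
      finally show "f (k + i) powr e \<le> exp (e * C') * \<theta> ^ i" .
    qed auto
    finally have "2 * K\<^sup>2 * f (k + i) \<le> 2 * K\<^sup>2 * (f k powr (1 - e) * (exp (e * C') * \<theta> ^ i))"
      by (intro mult_left_mono) auto
    with 1 show ?thesis by (simp add: A_def ac_simps)
  qed
  from geometric_steps_converge[of "\<lambda>i. Ul (q (k + i))", OF step \<theta>] obtain L where
    L: "(\<lambda>i. Ul (q (k + i))) \<longlonglongrightarrow> L" "\<And>m. dist (Ul (q (k + m))) L \<le> A / (1 - \<theta>) * \<theta> ^ m" by blast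
  have "(\<lambda>i. Ul (q (k + i))) \<longlonglongrightarrow> z" using LIMSEQ_ignore_initial_segment[OF lim, of k] by (simp add: add.commute)
  hence "L = z" using L(1) LIMSEQ_unique by blast
  hence "dist (Ul (q k)) z \<le> A / (1 - \<theta>)" using L(2)[of 0] by simp
  also have "\<dots> = 2 * K\<^sup>2 * exp (e * C') / (1 - exp (- (e * C))) * sg (q k) powr (1 - e)"
    by (simp add: A_def f_def \<theta>_def)
  finally show ?thesis using q(1,2) k by (intro bexI[of _ "q k"]) auto
qed

text \<open>An exponent \<open>t\<close> between \<open>delta12\<close> and \<open>s\<close> leaves
  room for the loss: with \<open>(1 - e) * s = t\<close>, the \<open>s\<close>-th power of a radius
  of order \<open>sg g powr (1 - e)\<close> is of order \<open>exp (- t * \<alpha> g)\<close>, the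
  term bounded by \<open>poincare_tail\<close>.\<close>

lemma hausdorff_measure_zero:
  assumes E: "\<And>l. l \<in> E \<Longrightarrow> \<exists>v q. norm v = 1 \<and> l = span {v} \<and> (\<forall>j. q j \<in> \<Gamma> \<and> wl (q j) = j \<and> (\<exists>s\<in>T. q (Suc j) = q j ** s)) \<and>
        (\<lambda>j. Ul (q j)) \<longlonglongrightarrow> outer v"
    and s: "delta12 \<Gamma> < ereal s"
  shows "hausdorff_measure proj_space line_dist s E = 0"
proof -
  have s0: "0 < s" using le_less_trans[OF delta12_nonneg s] by simp
  obtain t where t: "delta12 \<Gamma> < ereal t" "t < s" using ereal_dense2[OF s] by auto
  have t0: "0 < t" using le_less_trans[OF delta12_nonneg t(1)] by simp
  define e where "e = 1 - t / s"
  have e: "0 < e" "e < 1" "(1 - e) * s = t" using t t0 s0 by (auto simp: e_def)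
  define A where "A = 2 * K\<^sup>2 * exp (e * C') / (1 - exp (- (e * C)))"
  have A: "0 \<le> A" using e C by (simp add: A_def)
  define V where "V g = {l. \<exists>v. norm v = 1 \<and> l = span {v} \<and> dist (Ul g) (outer v) \<le> A * sg g powr (1 - e)}" for g
  have VX: "V g \<subseteq> proj_space" for g
  proof
    fix l assume "l \<in> V g"
    then obtain v where "norm v = 1" "l = span {v}" by (auto simp: V_def)
    thus "l \<in> proj_space" unfolding proj_space_def by (auto intro!: exI[of _ v])
  qed
  \<comment> \<open>The factor 8 is 2 for the triangle inequality through \<open>Ul g\<close>, times
    4 for passing from projections to angles.\<close>
  have ld: "0 \<le> line_dist l l' \<and> line_dist l l' \<le> 8 * A * sg g powr (1 - e)" if lV: "l \<in> V g" "l' \<in> V g" for l l' g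
  proof -
    obtain v where v: "norm v = 1" "l = span {v}" "dist (Ul g) (outer v) \<le> A * sg g powr (1 - e)"
      using lV by (auto simp: V_def)
    obtain v' where v': "norm v' = 1" "l' = span {v'}" "dist (Ul g) (outer v') \<le> A * sg g powr (1 - e)"
      using lV by (auto simp: V_def)
    have "line_dist l l' \<le> 4 * dist (outer v) (outer v')" unfolding v v' by (rule line_dist_le_outer[OF v(1) v'(1)])
    also have "dist (outer v) (outer v') \<le> 2 * (A * sg g powr (1 - e))"
      using v(3) v'(3) dist_triangle3[of "outer v" "outer v'" "Ul g"] by simp
    finally have "line_dist l l' \<le> 8 * A * sg g powr (1 - e)" by simp
    moreover have "0 \<le> line_dist l l'"
      unfolding v v' line_dist_span[OF v(1) v'(1)] using abs_inner_le_1[OF v(1) v'(1)] by (intro arccos_lbound) auto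
    ultimately show ?thesis by simp
  qed
  have diam: "0 \<le> diam_d line_dist (V g) \<and> diam_d line_dist (V g) \<le> 8 * A * sg g powr (1 - e)" for g
  proof (cases "V g = {}")
    case True thus ?thesis using A by (simp add: diam_d_def)
  next
    case False
    then obtain l where l: "l \<in> V g" by blast
    let ?D = "{line_dist x y | x y. x \<in> V g \<and> y \<in> V g}"
    have ub: "z \<le> 8 * A * sg g powr (1 - e)" if "z \<in> ?D" for z using that ld by blast
    have "line_dist l l \<in> ?D" using l by blast
    hence "line_dist l l \<le> Sup ?D" using ub by (intro cSup_upper bdd_aboveI) auto
    moreover have "Sup ?D \<le> 8 * A * sg g powr (1 - e)" using ub l by (intro cSup_least) auto
    ultimately show ?thesis using ld[OF l l] False by (simp add: diam_d_def)
  qed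
  have small: "hausdorff_approx proj_space line_dist s \<delta> E \<le> ennreal \<eta>" if \<delta>: "0 < \<delta>" and \<eta>: "0 < \<eta>" for \<delta> \<eta>
  proof -
    define B where "B = (8 * A + 1) powr s"
    have B: "0 < B" using A by (simp add: B_def)
    obtain R where R: "\<And>F. finite F \<Longrightarrow> F \<subseteq> {g \<in> \<Gamma>. R < \<alpha> g} \<Longrightarrow> (\<Sum>g\<in>F. exp (- t * \<alpha> g)) \<le> \<eta> / B"
      using poincare_tail[OF t(1), of "\<eta> / B"] \<eta> B by auto
    \<comment> \<open>Ratios below the first bound have \<open>\<alpha> g > R\<close>, where the
      tail estimate applies; ratios below the second give diameters at most
      \<open>\<delta>\<close>.\<close>
    define \<epsilon> where "\<epsilon> = min (exp (- R)) ((\<delta> / (8 * A + 1)) powr (1 / (1 - e)))"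
    have \<epsilon>: "0 < \<epsilon>" using A \<delta> by (simp add: \<epsilon>_def)
    obtain k0 where k0: "\<And>g. g \<in> \<Gamma> \<Longrightarrow> k0 \<le> wl g \<Longrightarrow> sg g < \<epsilon>" using sg_small[OF \<epsilon>] by blast
    define G where "G = {g \<in> \<Gamma>. k0 \<le> wl g}"
    have GR: "R < \<alpha> g" if "g \<in> G" for g
      using k0[of g] that by (simp add: G_def \<epsilon>_def sg_def \<alpha>_def)
    have Gd: "(8 * A + 1) * sg g powr (1 - e) \<le> \<delta>" if "g \<in> G" for g
    proof -
      have "sg g \<le> (\<delta> / (8 * A + 1)) powr (1 / (1 - e))" using k0[of g] that by (simp add: G_def \<epsilon>_def)
      hence "sg g powr (1 - e) \<le> ((\<delta> / (8 * A + 1)) powr (1 / (1 - e))) powr (1 - e)"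
        using e sg_pos[of g] by (intro powr_mono2) auto
      also have "\<dots> = \<delta> / (8 * A + 1)" using e A \<delta> by (simp add: powr_powr)
      finally show ?thesis using A by (simp add: field_simps)
    qed
    have le1: "8 * A * sg g powr (1 - e) \<le> (8 * A + 1) * sg g powr (1 - e)" for g by (intro mult_right_mono) auto
    show ?thesis
    proof (rule hausdorff_approx_le[where G = G and V = V and f = "\<lambda>g. B * exp (- t * \<alpha> g)"])
      have "\<Gamma> \<subseteq> (\<Union>n. {g \<in> \<Gamma>. wl g \<le> n})" by auto
      moreover have "countable (\<Union>n. {g \<in> \<Gamma>. wl g \<le> n})" using finite_ball by (intro countable_UN) (auto intro: countable_finite)
      ultimately have "countable \<Gamma>" by (rule countable_subset)
      thus "countable G" by (rule countable_subset[rotated]) (auto simp: G_def)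
      show "E \<subseteq> (\<Union>g\<in>G. V g)"
      proof
        fix l assume "l \<in> E"
        then obtain v q where v: "norm v = 1" "l = span {v}"
          and q: "\<And>j. q j \<in> \<Gamma>" "\<And>j. wl (q j) = j" "\<And>j. \<exists>s\<in>T. q (Suc j) = q j ** s" "(\<lambda>j. Ul (q j)) \<longlonglongrightarrow> outer v"
          using E by meson
        obtain g where "g \<in> \<Gamma>" "k0 \<le> wl g" "dist (Ul g) (outer v) \<le> A * sg g powr (1 - e)"
          using ray_shadow[OF q e(1,2), of k0] unfolding A_def by blast
        thus "l \<in> (\<Union>g\<in>G. V g)" using v by (auto simp: G_def V_def)
      qed
      show "V g \<subseteq> proj_space" for g by (rule VX)
      show "diam_d line_dist (V g) \<le> \<delta>" if "g \<in> G" for g using diam[of g] le1[of g] Gd[OF that] by linarith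
      show "0 \<le> \<delta>" using \<delta> by simp
      show "diam_d line_dist (V g) powr s \<le> B * exp (- t * \<alpha> g)" for g
      proof -
        have "diam_d line_dist (V g) powr s \<le> ((8 * A + 1) * sg g powr (1 - e)) powr s"
          using diam[of g] le1[of g] s0 by (intro powr_mono2) auto
        also have "\<dots> = B * sg g powr t" using A by (simp add: powr_mult B_def powr_powr e(3))
        finally show ?thesis by (simp add: sg_powr)
      qed
      show "(\<Sum>g\<in>F. B * exp (- t * \<alpha> g)) \<le> \<eta>" if "finite F" "F \<subseteq> G" for F
      proof -
        have "(\<Sum>g\<in>F. exp (- t * \<alpha> g)) \<le> \<eta> / B" using that GR by (intro R) (auto simp: G_def)
        hence "B * (\<Sum>g\<in>F. exp (- t * \<alpha> g)) \<le> \<eta>" using B by (simp add: field_simps)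
        thus ?thesis by (simp add: sum_distrib_left)
      qed
    qed
  qed
  have "hausdorff_approx proj_space line_dist s \<delta> E \<le> 0" if "0 < \<delta>" for \<delta>
    by (rule ennreal_le_epsilon) (use small[OF that] in simp)
  hence "hausdorff_measure proj_space line_dist s E \<le> 0"
    unfolding hausdorff_measure_def by (intro SUP_least) auto
  thus ?thesis by simp
qed

end

theorem theorem4p1:
  fixes S \<Gamma> :: "(real ^ 'n ^ 'n) set"
    and \<xi> :: "(nat \<Rightarrow> real ^ 'n ^ 'n) set \<Rightarrow> (real ^ 'n) set"
  assumes n2: "CARD('n::finite) \<ge> 2"
    and anosov: "projective_Anosov S \<Gamma>"
    and \<xi>_range: "\<xi> ` gromov_bdry S \<Gamma> \<subseteq> proj_space"
    and \<xi>_cont: "\<And>a b. (\<forall>k. a k \<in> gromov_bdry S \<Gamma>) \<Longrightarrow> b \<in> gromov_bdry S \<Gamma> \<Longrightarrow>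
                  bdry_tendsto S a b \<Longrightarrow> (\<lambda>k. line_dist (\<xi> (a k)) (\<xi> b)) \<longlonglongrightarrow> 0"
    and \<xi>_equiv: "\<And>g a. g \<in> \<Gamma> \<Longrightarrow> a \<in> gromov_bdry S \<Gamma> \<Longrightarrow>
                  \<xi> (bdry_act g a) = mat_act_line g (\<xi> a)"
    and \<xi>_eig: "\<And>g. g \<in> \<Gamma> \<Longrightarrow> (\<forall>k>0. mpow g k \<noteq> mat 1) \<Longrightarrow>
                  \<exists>c::real. \<exists>v. complex_of_real c \<in> complex_eigenvalues g \<and>
                     (\<forall>z \<in> complex_eigenvalues g. z \<noteq> complex_of_real c \<longrightarrow> cmod z < \<bar>c\<bar>) \<and>
                     v \<noteq> 0 \<and> g *v v = c *\<^sub>R v \<and> \<xi> (attr_pt S \<Gamma> g) = span {v}"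
  shows "hausdorff_dim proj_space line_dist (\<xi> ` gromov_bdry S \<Gamma>) \<le> delta12 \<Gamma>"
proof -
  obtain C C' where C: "0 < C" and gap: "\<forall>g\<in>\<Gamma>. mu 1 g - mu 2 g \<ge> C * real (word_length S g) - C'"
    and S: "finite S" "S \<subseteq> SL" and \<Gamma>: "\<Gamma> = generated S"
    using anosov unfolding projective_Anosov_def by blast
  interpret anosov_group S C C'
    by unfold_locales (use S n2 C gap \<Gamma> in auto)
  have ray: "\<exists>v q. norm v = 1 \<and> l = span {v} \<and> (\<forall>j. q j \<in> generated S \<and> wl (q j) = j \<and> (\<exists>s\<in>T. q (Suc j) = q j ** s)) \<and>
        (\<lambda>j. Ul (q j)) \<longlonglongrightarrow> outer v"
    if l: "l \<in> \<xi> ` gromov_bdry S \<Gamma>" for l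
  proof -
    obtain x where x: "conv_infty S \<Gamma> x" "l = \<xi> (bdry_class S \<Gamma> x)" using l by (auto simp: gromov_bdry_def)
    have x': "conv_infty S (generated S) x" using x \<Gamma> by simp
    have "\<exists>v. norm v = 1 \<and> \<xi> (bdry_class S (generated S) x) = span {v} \<and> (\<lambda>i. Ul (x i)) \<longlonglongrightarrow> outer v"
      by (rule boundary_map_is_limit[OF \<xi>_range[unfolded \<Gamma>] \<xi>_cont[unfolded \<Gamma>] \<xi>_equiv[unfolded \<Gamma>] \<xi>_eig[unfolded \<Gamma>] x'])
    then obtain v where v: "norm v = 1" "\<xi> (bdry_class S \<Gamma> x) = span {v}" "(\<lambda>i. Ul (x i)) \<longlonglongrightarrow> outer v"
      unfolding \<Gamma>[symmetric] by blast
    obtain q where q: "\<And>j. q j \<in> generated S" "\<And>j. wl (q j) = j" "\<And>j. infinite {i. gp (q j) (x i) = real j}" "\<And>j. \<exists>s\<in>T. q (Suc j) = q j ** s"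
      using geodesic_ray[OF x'] by blast
    have "(\<lambda>j. Ul (q j)) \<longlonglongrightarrow> outer v" by (rule ray_limit[OF x' v(3) q(1,3)])
    thus ?thesis using v x q by blast
  qed
  show ?thesis
  \<comment> \<open>Reduces to real \<open>s\<close> above \<open>delta12\<close>. The infimum in
    \<open>hausdorff_dim\<close> runs over positive \<open>s\<close>, and positivity comes from
    \<open>delta12_nonneg\<close>.\<close>
  proof (rule dense_ge)
    fix y assume y: "delta12 \<Gamma> < y"
    show "hausdorff_dim proj_space line_dist (\<xi> ` gromov_bdry S \<Gamma>) \<le> y"
    proof (cases y)
      case (real s)
      have s: "delta12 (generated S) < ereal s" using y real \<Gamma> by simp
      have "0 < s" using le_less_trans[OF delta12_nonneg s] by simp
      moreover have "hausdorff_measure proj_space line_dist s (\<xi> ` gromov_bdry S \<Gamma>) = 0"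
        by (rule hausdorff_measure_zero[OF ray s])
      ultimately show ?thesis unfolding real hausdorff_dim_def by (intro INF_lower) auto
    qed (use y in auto)
  qed
qed

end
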